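(* Consider the urn model described in the context. Assume that there is an integer constant $C$ with $A_n\vee B_n\vee N_n\le C$ for all $n\ge 1$; that $E[A_n]=E[B_n]=m_n$ for all $n$, with $m_n\to m\in(0,+\infty)$; that $$E[N_n|\mathcal F_{n-1}]\xrightarrow{a.s.}N,\qquad E[N_n^2|\mathcal F_{n-1}]\xrightarrow{a.s.}Q,$$ where $N$ and $Q$ are strictly positive finite random variables; and that $$E[A_n^2]\to q_A,\qquad E[B_n^2]\to q_B,\qquad E[A_nB_n]\to q_{AB},$$ where $q_A,q_B,q_{AB}$ are strictly positive finite constants. Let $Z$ be the almost sure limit of $Z_n$ (which exists under these assumptions). Then $\sqrt n\,(Z_n-Z)$ converges, in the sense of the almost sure conditional convergence with respect to $\mathcal F=(\mathcal F_n)$, to the Gaussian kernel $\mathcal N(0,V)$, where $$\begin{aligned}V&=Z(1-Z)\,\frac{(1-Z)q_A[(1-Z)N+ZQ]+Zq_B[ZN+(1-Z)Q]-2Z(1-Z)q_{AB}(Q-N)}{(mN)^2}\\&=Z(1-Z)\,\frac{N[(1-Z)^2q_A+Z^2q_B+2Z(1-Z)q_{AB}]+Z(1-Z)Q[q_A+q_B-2q_{AB}]}{(mN)^2}.\end{aligned}$$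
   Context: Urn model. An urn initially contains $a\ge 1$ balls of color A and $b\ge 1$ balls of color B ($a,b$ integers). On a probability space $(\Omega,\mathcal A,P)$ there are random variables $N_n,X_n,A_n,B_n$, $n\ge 1$, where $N_n$ is the size of the sample drawn without replacement at time $n$, $X_n$ is the number of sampled balls of color A, and after the draw the sampled balls are returned together with $A_nX_n$ new balls of color A and $B_n(N_n-X_n)$ new balls of color B. Put, for $n\ge 0$, $H_n=a+\sum_{j=1}^n A_jX_j$ (balls of color A), $K_n=b+\sum_{j=1}^n B_j(N_j-X_j)$ (balls of color B), $S_n=H_n+K_n$. For each $n\ge1$: (A1) the conditional distribution of $N_n$ given $[N_1,X_1,A_1,B_1,\dots,N_{n-1},X_{n-1},A_{n-1},B_{n-1}]$ is concentrated on $\{1,\dots,S_{n-1}\}$; (A2) the conditional distribution of $X_n$ given $[N_1,X_1,A_1,B_1,\dots,N_{n-1},X_{n-1},A_{n-1},B_{n-1},N_n]$ is hypergeometric with parameters $N_n,S_{n-1},H_{n-1}$, i.e. it gives mass $\binom{H_{n-1}}{k}\binom{S_{n-1}-H_{n-1}}{N_n-k}/\binom{S_{n-1}}{N_n}$ to $k$; (A3) the random vector $[A_n,B_n]$ takes values in $(\mathbb N\setminus\{0\})^2$ and is independent of $[N_1,X_1,A_1,B_1,\dots,N_{n-1},X_{n-1},A_{n-1},B_{n-1},N_n,X_n]$ ($A_n$ and $B_n$ may be correlated with each other and their law may depend on $n$). The proportion of balls of color A is $Z_n=H_n/S_n$, $n\ge0$. Filtration: $\mathcal F_0=\{\emptyset,\Omega\}$,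 $\mathcal F_n=\sigma(N_1,X_1,A_1,B_1,\dots,N_n,X_n,A_n,B_n)$ for $n\ge1$. Almost sure conditional convergence. A kernel on a Polish space $S$ is a family $K=\{K(\omega):\omega\in\Omega\}$ of Borel probability measures on $S$ such that $\omega\mapsto Kf(\omega)=\int f(x)\,K(\omega)(dx)$ is $\mathcal A$-measurable for every bounded Borel $f:S\to\mathbb R$. Given sub-$\sigma$-fields $(\mathcal F_n)$ of $\mathcal A$, a sequence $(Y_n)$ of $S$-valued random variables converges to $K$ in the sense of the almost sure conditional convergence with respect to $(\mathcal F_n)$ if $E[f(Y_n)|\mathcal F_n]\to Kf$ almost surely for each bounded continuous $f:S\to\mathbb R$. For a non-negative random variable $V$, $\mathcal N(0,V)$ denotes the kernel $\{\mathcal N(0,V(\omega)):\omega\in\Omega\}$ on $\mathbb R$, with $\mathcal N(0,0)=\delta_0$. *)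

theory Defs
  imports "HOL-Probability.Probability"
begin

subsection \<open>Conditional distributions\<close>

definition cond_distribution ::
    "'w measure \<Rightarrow> 'w measure \<Rightarrow> 's measure \<Rightarrow> ('w \<Rightarrow> 's) \<Rightarrow> ('w \<Rightarrow> 's measure) \<Rightarrow> bool" where
  "cond_distribution M G T Y \<kappa> \<longleftrightarrow>
     \<kappa> \<in> measurable G (prob_algebra T) \<and>
     (\<forall>D\<in>sets T. AE \<omega> in M.
        measure (\<kappa> \<omega>) D = real_cond_exp M G (\<lambda>\<omega>'. indicat_real D (Y \<omega>')) \<omega>)"

(* Sample size n, population size s, h marked items. The guard is needed because n - k is
   truncated: for k > n the binomial coefficient with negative lower index has to be 0. *)
definition hypergeometric_mass :: "nat \<Rightarrow> nat \<Rightarrow> nat \<Rightarrow> nat \<Rightarrow> real" where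
  "hypergeometric_mass n s h k =
     (if k \<le> n then real (h choose k) * real ((s - h) choose (n - k)) / real (s choose n) else 0)"

subsection \<open>Almost sure conditional convergence\<close>

definition prob_kernel :: "'w measure \<Rightarrow> ('w \<Rightarrow> 's::polish_space measure) \<Rightarrow> bool" where
  "prob_kernel M K \<longleftrightarrow>
     (\<forall>\<omega>\<in>space M. prob_space (K \<omega>) \<and> sets (K \<omega>) = sets borel) \<and>
     (\<forall>f :: 's \<Rightarrow> real. f \<in> borel_measurable borel \<and> bounded (range f) \<longrightarrow>
        (\<lambda>\<omega>. \<integral>x. f x \<partial>(K \<omega>)) \<in> borel_measurable M)"

definition as_cond_converges ::
    "'w measure \<Rightarrow> (nat \<Rightarrow> 'w measure) \<Rightarrow> (nat \<Rightarrow> 'w \<Rightarrow> 's::polish_space) \<Rightarrow>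
     ('w \<Rightarrow> 's measure) \<Rightarrow> bool" where
  "as_cond_converges M F Y K \<longleftrightarrow>
     (\<forall>n. subalgebra M (F n)) \<and>
     (\<forall>n. Y n \<in> borel_measurable M) \<and>
     prob_kernel M K \<and>
     (\<forall>f :: 's \<Rightarrow> real. continuous_on UNIV f \<and> bounded (range f) \<longrightarrow>
        (AE \<omega> in M. (\<lambda>n. real_cond_exp M (F n) (\<lambda>\<omega>'. f (Y n \<omega>')) \<omega>)
                        \<longlonglongrightarrow> (\<integral>x. f x \<partial>(K \<omega>))))"

(* The second argument of normal_density is the standard deviation. Negative v is not meaningful;
   the Dirac measure makes the definition total. *)
definition centered_normal :: "real \<Rightarrow> real measure" where
  "centered_normal v =
     (if v > 0 then density lborel (\<lambda>x. ennreal (normal_density 0 (sqrt v) x))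
      else return borel 0)"

subsection \<open>The urn model\<close>

(* Sequences are indexed by n >= 1; the values at index 0 are never used. *)

(* The vector [N_1, X_1, A_1, B_1, ..., N_n, X_n, A_n, B_n]. It takes values in a countable set,
   on which the product sigma-field is the discrete one. *)
definition urn_history ::
    "(nat \<Rightarrow> 'w \<Rightarrow> nat) \<Rightarrow> (nat \<Rightarrow> 'w \<Rightarrow> nat) \<Rightarrow> (nat \<Rightarrow> 'w \<Rightarrow> nat) \<Rightarrow> (nat \<Rightarrow> 'w \<Rightarrow> nat) \<Rightarrow>
     nat \<Rightarrow> 'w \<Rightarrow> (nat \<times> nat \<times> nat \<times> nat) list" where
  "urn_history N X A B n \<omega> = map (\<lambda>j. (N j \<omega>, X j \<omega>, A j \<omega>, B j \<omega>)) [1..<Suc n]"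

definition generated_field :: "'w measure \<Rightarrow> ('w \<Rightarrow> 's) \<Rightarrow> 'w measure" where
  "generated_field M Y = vimage_algebra (space M) Y (count_space UNIV)"

definition urn_filtration ::
    "'w measure \<Rightarrow> (nat \<Rightarrow> 'w \<Rightarrow> nat) \<Rightarrow> (nat \<Rightarrow> 'w \<Rightarrow> nat) \<Rightarrow> (nat \<Rightarrow> 'w \<Rightarrow> nat) \<Rightarrow>
     (nat \<Rightarrow> 'w \<Rightarrow> nat) \<Rightarrow> nat \<Rightarrow> 'w measure" where
  "urn_filtration M N X A B n = generated_field M (urn_history N X A B n)"

definition urn_H :: "nat \<Rightarrow> (nat \<Rightarrow> 'w \<Rightarrow> nat) \<Rightarrow> (nat \<Rightarrow> 'w \<Rightarrow> nat) \<Rightarrow> nat \<Rightarrow> 'w \<Rightarrow> nat" where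
  "urn_H a X A n \<omega> = a + (\<Sum>j=1..n. A j \<omega> * X j \<omega>)"

(* The truncated subtraction is harmless: X_j <= N_j almost surely, since the hypergeometric
   distribution has no mass beyond the sample size. *)
definition urn_K ::
    "nat \<Rightarrow> (nat \<Rightarrow> 'w \<Rightarrow> nat) \<Rightarrow> (nat \<Rightarrow> 'w \<Rightarrow> nat) \<Rightarrow> (nat \<Rightarrow> 'w \<Rightarrow> nat) \<Rightarrow>
     nat \<Rightarrow> 'w \<Rightarrow> nat" where
  "urn_K b N X B n \<omega> = b + (\<Sum>j=1..n. B j \<omega> * (N j \<omega> - X j \<omega>))"

definition urn_S ::
    "nat \<Rightarrow> nat \<Rightarrow> (nat \<Rightarrow> 'w \<Rightarrow> nat) \<Rightarrow> (nat \<Rightarrow> 'w \<Rightarrow> nat) \<Rightarrow> (nat \<Rightarrow> 'w \<Rightarrow> nat) \<Rightarrow>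
     (nat \<Rightarrow> 'w \<Rightarrow> nat) \<Rightarrow> nat \<Rightarrow> 'w \<Rightarrow> nat" where
  "urn_S a b N X A B n \<omega> = urn_H a X A n \<omega> + urn_K b N X B n \<omega>"

definition urn_Z ::
    "nat \<Rightarrow> nat \<Rightarrow> (nat \<Rightarrow> 'w \<Rightarrow> nat) \<Rightarrow> (nat \<Rightarrow> 'w \<Rightarrow> nat) \<Rightarrow> (nat \<Rightarrow> 'w \<Rightarrow> nat) \<Rightarrow>
     (nat \<Rightarrow> 'w \<Rightarrow> nat) \<Rightarrow> nat \<Rightarrow> 'w \<Rightarrow> real" where
  "urn_Z a b N X A B n \<omega> = real (urn_H a X A n \<omega>) / real (urn_S a b N X A B n \<omega>)"

locale urn_model = prob_space M for M :: "'w measure" +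
  fixes a b :: nat
    and N X A B :: "nat \<Rightarrow> 'w \<Rightarrow> nat"
  assumes initial: "a \<ge> 1" "b \<ge> 1"
    and random_variables:
      "\<And>n. n \<ge> 1 \<Longrightarrow> random_variable (count_space UNIV) (N n)"
      "\<And>n. n \<ge> 1 \<Longrightarrow> random_variable (count_space UNIV) (X n)"
      "\<And>n. n \<ge> 1 \<Longrightarrow> random_variable (count_space UNIV) (A n)"
      "\<And>n. n \<ge> 1 \<Longrightarrow> random_variable (count_space UNIV) (B n)"
    and sample_size: "\<And>n. n \<ge> 1 \<Longrightarrow>
      \<exists>\<kappa>. cond_distribution M (urn_filtration M N X A B (n - 1)) (count_space UNIV) (N n) \<kappa> \<and>
          (AE \<omega> in M. measure (\<kappa> \<omega>) {1..urn_S a b N X A B (n - 1) \<omega>} = 1)"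
    and sample: "\<And>n. n \<ge> 1 \<Longrightarrow>
      \<exists>\<kappa>. cond_distribution M
            (generated_field M (\<lambda>\<omega>. (urn_history N X A B (n - 1) \<omega>, N n \<omega>)))
            (count_space UNIV) (X n) \<kappa> \<and>
          (AE \<omega> in M. \<forall>k. measure (\<kappa> \<omega>) {k} =
            hypergeometric_mass (N n \<omega>) (urn_S a b N X A B (n - 1) \<omega>) (urn_H a X A (n - 1) \<omega>) k)"
    and reinforcement_positive:
      "\<And>n \<omega>. n \<ge> 1 \<Longrightarrow> \<omega> \<in> space M \<Longrightarrow> A n \<omega> \<ge> 1 \<and> B n \<omega> \<ge> 1"
    and reinforcement_indep: "\<And>n. n \<ge> 1 \<Longrightarrow>
      indep_set (sets (generated_field M (\<lambda>\<omega>. (A n \<omega>, B n \<omega>))))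
        (sets (generated_field M (\<lambda>\<omega>. (urn_history N X A B (n - 1) \<omega>, N n \<omega>, X n \<omega>))))"

end

theory Submission
  imports Defs "HOL-Real_Asymp.Real_Asymp"
begin

text \<open>
  Write \<open>Y\<^sub>k = Z\<^sub>k\<^sub>+\<^sub>1 - Z\<^sub>k\<close>. Equal means of \<open>A\<^sub>n\<close> and \<open>B\<^sub>n\<close> cancel the first-order drift, so that
  \<open>\<bar>Y\<^sub>k\<bar> = O(1/k)\<close> and \<open>E[Y\<^sub>k | F\<^sub>k] = O(1/k\<^sup>2)\<close>, and hypergeometric moments together with
  \<open>S\<^sub>n / n \<longlonglongrightarrow> m N\<close> give \<open>U\<^sub>k = (k+1)(k+2) E[Y\<^sub>k\<^sup>2 | F\<^sub>k] \<longlonglongrightarrow> V\<close> almost surely. With \<open>u = t \<surd>n\<close> and the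
  variance frozen at \<open>U\<^sub>n\<close>, the process \<open>exp(i u (Z\<^sub>j - Z\<^sub>n) - u\<^sup>2 U\<^sub>n / (2(j+1)))\<close>, \<open>j \<ge> n\<close>, is almost a
  martingale: telescoping from \<open>j = n\<close> to \<open>j = \<infinity>\<close> shows that the conditional characteristic function
  of \<open>\<surd>n (Z - Z\<^sub>n)\<close> given \<open>F\<^sub>n\<close> differs from \<open>exp(- t\<^sup>2 n U\<^sub>n / (2(n+1)))\<close> by at most
  \<open>K(t)/\<surd>n + (t\<^sup>2/2) E[sup\<^sub>j\<^sub>\<ge>\<^sub>n \<bar>U\<^sub>j - U\<^sub>n\<bar> | F\<^sub>n]\<close>. The last term vanishes by Doob's maximal
  inequality. Each \<open>F\<^sub>n\<close> is generated by a discrete variable, so conditional laws are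
  elementary conditional distributions on its atoms, and Levy's continuity theorem applies
  for almost every \<open>\<omega>\<close>.
\<close>

subsection \<open>Martingale limit theorems\<close>

text \<open>The factor (k+1)(k+2) is chosen because the sum of 1/((k+1)(k+2)) over k \<ge> j is
  exactly 1/(j+1). If all increments had conditional variance U_n / ((k+1)(k+2)), the exponent u^2
  U_n / (2(j+1)) would be the part still unspent at time j: it vanishes in the limit, and at j = n
  it is the exponent of the Gaussian target. Freezing at U_n keeps this correction measurable at
  time n, while the true remaining variance depends on the future. The price is a deviation term in
  which both the conditioning field and the variable vary with n, so convergence of one fixed
  martingale is not enough; the deviations are dominated by a sequence decreasing in n. The drift
  arises only because the denominator S_{k+1} is correlated with the numerator of the increment.
  Replacing it by S_k costs a relative error O(1/k); the resulting drifts sum to O(1/n) beyond time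
  n, which is negligible after multiplication by sqrt n. Working on atoms gives one conditional law
  per \<omega>, hence a null set that depends neither on t nor on the test function.\<close>

lemma cesaro_tendsto:
  fixes x :: "nat \<Rightarrow> real"
  assumes "x \<longlonglongrightarrow> L"
  shows "(\<lambda>n. (\<Sum>k<n. x k) / real n) \<longlonglongrightarrow> L"
proof (rule LIMSEQ_I)
  fix e :: real assume "0 < e"
  then obtain m where m: "\<And>k. k \<ge> m \<Longrightarrow> norm (x k - L) < e / 2"
    using LIMSEQ_D[OF assms, of "e / 2"] by auto
  define S where "S = (\<Sum>k<m. \<bar>x k - L\<bar>)"
  have "(\<lambda>n. S / real n) \<longlonglongrightarrow> 0"
    by (rule lim_const_over_n)
  then obtain n0 where n0: "\<And>n. n \<ge> n0 \<Longrightarrow> norm (S / real n - 0) < e / 2"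
    using LIMSEQ_D[of _ 0 "e / 2"] \<open>0 < e\<close> by (metis half_gt_zero)
  have "norm ((\<Sum>k<n. x k) / real n - L) < e" if n: "n \<ge> max n0 (Suc m)" for n
  proof -
    have n_pos: "real n > 0" using n by auto
    have "(\<Sum>k<n. x k) / real n - L = (\<Sum>k<n. x k - L) / real n"
      using n_pos by (simp add: sum_subtractf field_simps)
    also have "\<bar>\<dots>\<bar> \<le> (\<Sum>k<n. \<bar>x k - L\<bar>) / real n"
      using n_pos by (auto simp: abs_divide intro!: divide_right_mono sum_abs)
    also have "(\<Sum>k<n. \<bar>x k - L\<bar>) = S + (\<Sum>k\<in>{m..<n}. \<bar>x k - L\<bar>)"
      unfolding S_def lessThan_atLeast0 using n by (subst sum.atLeastLessThan_concat) auto
    also have "(\<Sum>k\<in>{m..<n}. \<bar>x k - L\<bar>) \<le> (\<Sum>k\<in>{m..<n}. e / 2)"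
      using m by (intro sum_mono) (auto intro: less_imp_le)
    also have "\<dots> \<le> real n * (e / 2)"
      using \<open>0 < e\<close> by (simp add: mult_right_mono)
    also have "(S + real n * (e / 2)) / real n = S / real n + e / 2"
      using n_pos by (simp add: field_simps)
    also have "S / real n < e / 2"
      using n0[of n] n abs_ge_self[of "S / real n"] by simp
    finally show ?thesis using n_pos by (simp add: divide_right_mono)
  qed
  then show "\<exists>n0. \<forall>n\<ge>n0. norm ((\<Sum>k<n. x k) / real n - L) < e" by blast
qed

text \<open>Summation by parts: with \<open>s n\<close> the weighted partial sums, the plain average
  equals \<open>s n\<close> minus the Cesaro mean of \<open>s\<close>, and both have the same
  limit.\<close>

lemma kronecker_lemma:
  fixes d :: "nat \<Rightarrow> real"
  assumes "convergent (\<lambda>n. \<Sum>k<n. d k / real (Suc k))"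
  shows "(\<lambda>n. (\<Sum>k<n. d k) / real n) \<longlonglongrightarrow> 0"
proof -
  define s where "s n = (\<Sum>k<n. d k / real (Suc k))" for n
  obtain L where L: "s \<longlonglongrightarrow> L"
    using assms by (auto simp: convergent_def s_def[abs_def])
  have "(\<Sum>k<n. d k) = real n * s n - (\<Sum>k<n. s k)" for n
  proof (induction n)
    case (Suc n)
    have "s (Suc n) = s n + d n / real (Suc n)" by (simp add: s_def)
    then have "real (Suc n) * s (Suc n) = real (Suc n) * s n + d n" by (simp add: field_simps)
    with Suc show ?case by (simp add: algebra_simps)
  qed simp
  then have eq: "(\<Sum>k<n. d k) / real n = s n - (\<Sum>k<n. s k) / real n" if "n > 0" for n
    using that by (simp add: field_simps)
  have "(\<lambda>n. s n - (\<Sum>k<n. s k) / real n) \<longlonglongrightarrow> L - L"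
    by (intro tendsto_diff L cesaro_tendsto)
  moreover have "\<forall>\<^sub>F n in sequentially. s n - (\<Sum>k<n. s k) / real n = (\<Sum>k<n. d k) / real n"
    using eq by (auto simp: eventually_sequentially intro!: exI[of _ 1])
  ultimately show ?thesis
    by (simp add: Lim_transform_eventually)
qed

lemma summable_inverse_Suc_square: "summable (\<lambda>k. (c / real (Suc k))\<^sup>2)"
proof -
  have "summable (\<lambda>k. inverse ((real (Suc k))\<^sup>2))"
    using inverse_power_summable[of 2, where 'a=real] summable_Suc_iff[of "\<lambda>k. inverse (real k ^ 2)"] by simp
  from summable_mult[OF this, of "c\<^sup>2"] show ?thesis
    by (simp only: power_mult_distrib power_inverse divide_inverse)
qed

lemma (in prob_space) sigma_finite_subalgebraI: "subalgebra M G \<Longrightarrow> sigma_finite_subalgebra M G"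
  by (intro finite_measure_subalgebra_is_sigma_finite
      finite_measure_subalgebra.intro finite_measure_subalgebra_axioms.intro) unfold_locales

section \<open>Filtrations, maximal inequalities and almost sure martingale limits\<close>

locale filtered_prob_space = prob_space M for M :: "'w measure" +
  fixes F :: "nat \<Rightarrow> 'w measure"
  assumes sub: "\<And>n. subalgebra M (F n)"
    and sets_F_Suc: "\<And>n. sets (F n) \<subseteq> sets (F (Suc n))"
begin

abbreviation cexp :: "nat \<Rightarrow> ('w \<Rightarrow> real) \<Rightarrow> 'w \<Rightarrow> real" where
  "cexp n \<equiv> real_cond_exp M (F n)"

lemma sfs: "sigma_finite_subalgebra M (F n)"
  by (rule sigma_finite_subalgebraI[OF sub])

lemma space_F [simp]: "space (F n) = space M"
  using sub[of n] by (simp add: subalgebra_def)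

lemma sets_F_mono: "m \<le> n \<Longrightarrow> sets (F m) \<subseteq> sets (F n)"
  by (rule lift_Suc_mono_le[of "\<lambda>n. sets (F n)"]) (use sets_F_Suc in auto)

lemma sets_F_M: "D \<in> sets (F n) \<Longrightarrow> D \<in> sets M"
  using sub[of n] by (auto simp: subalgebra_def)

lemma measurable_F_M: "f \<in> borel_measurable (F n) \<Longrightarrow> f \<in> borel_measurable M"
  by (rule measurable_from_subalg[OF sub])

lemma measurable_F_mono: "f \<in> borel_measurable (F m) \<Longrightarrow> m \<le> n \<Longrightarrow> f \<in> borel_measurable (F n)"
  by (rule measurable_from_subalg[of "F n" "F m"]) (auto simp: subalgebra_def sets_F_mono)

lemma integrable_AE_bounded:
  fixes f :: "'w \<Rightarrow> 'b::{banach, second_countable_topology}"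
  assumes "f \<in> borel_measurable M" "AE \<omega> in M. norm (f \<omega>) \<le> K"
  shows "integrable M f"
  using assms by (intro integrable_const_bound) auto

lemma integral_indicator_cexp:
  assumes "integrable M f" "D \<in> sets (F n)"
  shows "(\<integral>\<omega>. indicator D \<omega> * cexp n f \<omega> \<partial>M) = (\<integral>\<omega>. indicator D \<omega> * f \<omega> \<partial>M)"
  using sigma_finite_subalgebra.real_cond_exp_intA[OF sfs assms]
  by (simp add: set_lebesgue_integral_def)

lemma integral_mult_cexp_zero:
  assumes "AE \<omega> in M. cexp n f \<omega> = 0" "g \<in> borel_measurable (F n)"
    "f \<in> borel_measurable M" "integrable M (\<lambda>\<omega>. g \<omega> * f \<omega>)"
  shows "(\<integral>\<omega>. g \<omega> * f \<omega> \<partial>M) = 0"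
proof -
  have "(\<integral>\<omega>. g \<omega> * f \<omega> \<partial>M) = (\<integral>\<omega>. g \<omega> * cexp n f \<omega> \<partial>M)"
    using sigma_finite_subalgebra.real_cond_exp_intg(2)[OF sfs assms(4,2,3)] by simp
  also have "\<dots> = (\<integral>\<omega>. 0 \<partial>M)"
    using assms by (intro integral_cong_AE)
      (auto intro!: borel_measurable_times measurable_F_M borel_measurable_cond_exp)
  finally show ?thesis by simp
qed

text \<open>The submartingale property is required only as an inequality between integrals over
  events of \<open>F k\<close>. This is all the argument uses, and it is the form in which both
  later applications obtain it.\<close>

lemma maximal_inequality_finite:
  assumes meas: "\<And>k. m \<le> k \<Longrightarrow> x k \<in> borel_measurable (F k)"
    and int: "\<And>k. m \<le> k \<Longrightarrow> integrable M (x k)"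
    and nonneg: "AE \<omega> in M. 0 \<le> x n \<omega>"
    and submart: "\<And>k D. m \<le> k \<Longrightarrow> k \<le> n \<Longrightarrow> D \<in> sets (F k) \<Longrightarrow>
      (\<integral>\<omega>. indicator D \<omega> * x k \<omega> \<partial>M) \<le> (\<integral>\<omega>. indicator D \<omega> * x n \<omega> \<partial>M)"
    and "m \<le> n"
  shows "l * prob {\<omega>\<in>space M. \<exists>k\<in>{m..n}. l \<le> x k \<omega>} \<le> (\<integral>\<omega>. x n \<omega> \<partial>M)"
proof -
  \<comment> \<open>\<open>D k\<close> is the event that level \<open>l\<close> is first reached at
    time \<open>k\<close>, counting from \<open>m\<close>. These events are disjoint and
    \<open>D k\<close> is known at time \<open>k\<close>, so \<open>submart\<close> can be applied
    on each of them and the results added, with no stopping time.\<close>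
  define D where "D k = {\<omega>\<in>space M. l \<le> x k \<omega> \<and> (\<forall>j\<in>{m..<k}. x j \<omega> < l)}" for k
  have D_F: "D k \<in> sets (F k)" if "m \<le> k" for k
  proof -
    have "x j \<in> borel_measurable (F k)" if "j \<in> {m..k}" for j
      using that meas measurable_F_mono by auto
    then have "{\<omega>\<in>space (F k). l \<le> x k \<omega>} \<in> sets (F k)"
      "\<And>j. j \<in> {m..<k} \<Longrightarrow> {\<omega>\<in>space (F k). x j \<omega> < l} \<in> sets (F k)"
      using that borel_measurable_le[of "\<lambda>_. l" "F k" "x k"]
        borel_measurable_less[of "x _" "F k" "\<lambda>_. l"] by auto
    then have "{\<omega>\<in>space (F k). l \<le> x k \<omega> \<and> (\<forall>j\<in>{m..<k}. x j \<omega> < l)} \<in> sets (F k)"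
      by (intro sets.sets_Collect_conj sets.sets_Collect_finite_All) auto
    then show ?thesis by (simp add: D_def)
  qed
  have disj: "disjoint_family_on D {m..n}"
    by (auto simp: disjoint_family_on_def D_def)
      (metis atLeastLessThan_iff linorder_neqE_nat not_less)
  have eq: "{\<omega>\<in>space M. \<exists>k\<in>{m..n}. l \<le> x k \<omega>} = (\<Union>k\<in>{m..n}. D k)"
  proof (intro subset_antisym subsetI)
    fix \<omega> assume "\<omega> \<in> {\<omega>\<in>space M. \<exists>k\<in>{m..n}. l \<le> x k \<omega>}"
    then obtain k where k: "\<omega> \<in> space M" "m \<le> k" "k \<le> n" "l \<le> x k \<omega>" by auto
    define j where "j = (LEAST j. m \<le> j \<and> l \<le> x j \<omega>)"
    have "m \<le> j \<and> l \<le> x j \<omega>" "j \<le> k"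
      unfolding j_def using k by (auto intro: LeastI2 Least_le)
    moreover have "x i \<omega> < l" if "i \<in> {m..<j}" for i
      using not_less_Least[of i "\<lambda>j. m \<le> j \<and> l \<le> x j \<omega>"] that by (auto simp: j_def)
    ultimately show "\<omega> \<in> (\<Union>k\<in>{m..n}. D k)"
      using k by (auto simp: D_def)
  qed (auto simp: D_def)
  have int_ind: "integrable M (\<lambda>\<omega>. indicator (D k) \<omega> * x j \<omega>)" if "m \<le> k" "m \<le> j" for k j
    using integrable_mult_indicator[OF sets_F_M[OF D_F[OF that(1)]] int[OF that(2)]] by simp
  have "l * prob {\<omega>\<in>space M. \<exists>k\<in>{m..n}. l \<le> x k \<omega>} = (\<Sum>k\<in>{m..n}. l * prob (D k))"
    unfolding eq using disj sets_F_M[OF D_F]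
    by (subst finite_measure_finite_Union) (auto simp: sum_distrib_left)
  also have "\<dots> \<le> (\<Sum>k\<in>{m..n}. \<integral>\<omega>. indicator (D k) \<omega> * x n \<omega> \<partial>M)"
  proof (rule sum_mono)
    fix k assume k: "k \<in> {m..n}"
    have DM: "D k \<in> sets M" using k D_F sets_F_M by auto
    have "l * prob (D k) = (\<integral>\<omega>. indicator (D k) \<omega> * l \<partial>M)"
      using DM by simp
    also have "\<dots> \<le> (\<integral>\<omega>. indicator (D k) \<omega> * x k \<omega> \<partial>M)"
    proof (rule integral_mono)
      show "indicator (D k) \<omega> * l \<le> indicator (D k) \<omega> * x k \<omega>" for \<omega>
        by (auto simp: indicator_def D_def)
      show "integrable M (\<lambda>\<omega>. indicator (D k) \<omega> * l)"
        using DM by (intro integrable_mult_left) (auto simp: integrable_indicator_iff emeasure_eq_measure)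
    qed (use k int_ind in auto)
    also have "\<dots> \<le> (\<integral>\<omega>. indicator (D k) \<omega> * x n \<omega> \<partial>M)"
      using k submart D_F by auto
    finally show "l * prob (D k) \<le> (\<integral>\<omega>. indicator (D k) \<omega> * x n \<omega> \<partial>M)" .
  qed
  also have "\<dots> = (\<integral>\<omega>. (\<Sum>k\<in>{m..n}. indicator (D k) \<omega> * x n \<omega>) \<partial>M)"
    using \<open>m \<le> n\<close> int_ind by (subst Bochner_Integration.integral_sum) auto
  also have "\<dots> = (\<integral>\<omega>. indicator (\<Union>k\<in>{m..n}. D k) \<omega> * x n \<omega> \<partial>M)"
    using disj by (subst indicator_UN_disjoint) (auto simp: sum_distrib_right)
  also have "\<dots> \<le> (\<integral>\<omega>. x n \<omega> \<partial>M)"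
  proof (rule integral_mono_AE)
    have "(\<Union>k\<in>{m..n}. D k) \<in> sets M" using D_F sets_F_M by auto
    from integrable_mult_indicator[OF this int[OF \<open>m \<le> n\<close>]]
    show "integrable M (\<lambda>\<omega>. indicator (\<Union>k\<in>{m..n}. D k) \<omega> * x n \<omega>)" by simp
    show "AE \<omega> in M. indicator (\<Union>k\<in>{m..n}. D k) \<omega> * x n \<omega> \<le> x n \<omega>"
      using nonneg by eventually_elim (auto simp: indicator_def)
  qed (use int \<open>m \<le> n\<close> in auto)
  finally show ?thesis .
qed

text \<open>The events with finite horizon increase to the event with infinite horizon, and the
  bound \<open>K\<close> does not depend on the horizon.\<close>

lemma maximal_inequality:
  assumes meas: "\<And>k. m \<le> k \<Longrightarrow> x k \<in> borel_measurable (F k)"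
    and int: "\<And>k. m \<le> k \<Longrightarrow> integrable M (x k)"
    and nonneg: "\<And>n. m \<le> n \<Longrightarrow> AE \<omega> in M. 0 \<le> x n \<omega>"
    and submart: "\<And>k n D. m \<le> k \<Longrightarrow> k \<le> n \<Longrightarrow> D \<in> sets (F k) \<Longrightarrow>
      (\<integral>\<omega>. indicator D \<omega> * x k \<omega> \<partial>M) \<le> (\<integral>\<omega>. indicator D \<omega> * x n \<omega> \<partial>M)"
    and bd: "\<And>n. m \<le> n \<Longrightarrow> (\<integral>\<omega>. x n \<omega> \<partial>M) \<le> K"
  shows "l * prob {\<omega>\<in>space M. \<exists>k\<ge>m. l \<le> x k \<omega>} \<le> K"
proof -
  define D where "D i = {\<omega>\<in>space M. \<exists>k\<in>{m..m+i}. l \<le> x k \<omega>}" for i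
  have D: "D i \<in> sets M" for i
  proof -
    have "D i = (\<Union>k\<in>{m..m+i}. {\<omega>\<in>space M. l \<le> x k \<omega>})"
      by (auto simp: D_def)
    also have "\<dots> \<in> sets M"
      using measurable_F_M[OF meas] by (intro sets.finite_UN) auto
    finally show ?thesis .
  qed
  have "l * prob (D i) \<le> K" for i
  proof -
    have "l * prob (D i) \<le> (\<integral>\<omega>. x (m + i) \<omega> \<partial>M)"
      unfolding D_def by (rule maximal_inequality_finite) (use meas int nonneg submart in auto)
    also have "\<dots> \<le> K" by (rule bd) simp
    finally show ?thesis .
  qed
  moreover have "(\<lambda>i. l * prob (D i)) \<longlonglongrightarrow> l * prob (\<Union>i. D i)"
  proof (intro tendsto_mult tendsto_const finite_Lim_measure_incseq)
    show "incseq D"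
      by (rule incseq_SucI) (auto simp: D_def intro: bexI)
  qed (use D in auto)
  moreover have "(\<Union>i. D i) = {\<omega>\<in>space M. \<exists>k\<ge>m. l \<le> x k \<omega>}"
  proof -
    have "\<omega> \<in> D (k - m)" if "\<omega> \<in> space M" "k \<ge> m" "l \<le> x k \<omega>" for \<omega> k
      using that by (auto simp: D_def)
    moreover have "D i \<subseteq> {\<omega>\<in>space M. \<exists>k\<ge>m. l \<le> x k \<omega>}" for i
      by (auto simp: D_def)
    ultimately show ?thesis by blast
  qed
  ultimately show ?thesis
    using LIMSEQ_le_const2[of "\<lambda>i. l * prob (D i)"] by auto
qed

text \<open>The array has two indices because the process restarts at each \<open>m\<close>. The
  event that for every \<open>m\<close> the level is exceeded at some \<open>k\<close> \<ge>
  \<open>m\<close> lies inside each single event, so its probability is at most \<open>K m\<close> /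
  \<open>l\<close> for all \<open>m\<close>, hence zero. Only countably many levels 1/(i+1) are
  used.\<close>

lemma AE_of_vanishing_bound:
  fixes x :: "nat \<Rightarrow> nat \<Rightarrow> 'w \<Rightarrow> real"
  assumes meas [measurable]: "\<And>m k. x m k \<in> borel_measurable M"
    and bound: "\<And>m l. 0 < l \<Longrightarrow> l * prob {\<omega>\<in>space M. \<exists>k\<ge>m. l \<le> x m k \<omega>} \<le> K m"
    and K: "K \<longlonglongrightarrow> 0"
  shows "AE \<omega> in M. \<forall>i. \<exists>m. \<forall>k\<ge>m. x m k \<omega> < 1 / real (Suc i)"
  unfolding AE_all_countable
proof
  fix i :: nat
  define l where "l = 1 / real (Suc i)"
  have l: "l > 0" by (simp add: l_def)
  define S where "S = {\<omega>\<in>space M. \<forall>m. \<exists>k\<ge>m. l \<le> x m k \<omega>}"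
  have D: "{\<omega>\<in>space M. \<exists>k\<ge>m. l \<le> x m k \<omega>} \<in> sets M" for m
    by measurable
  have S: "S \<in> sets M"
    unfolding S_def by measurable
  have "l * prob S \<le> K m" for m
  proof -
    have "l * prob S \<le> l * prob {\<omega>\<in>space M. \<exists>k\<ge>m. l \<le> x m k \<omega>}"
      using l D by (intro mult_left_mono finite_measure_mono) (auto simp: S_def)
    then show ?thesis using bound[OF l, of m] by simp
  qed
  then have "l * prob S \<le> 0"
    using LIMSEQ_le_const[OF K] by blast
  then have "prob S = 0"
    using l measure_nonneg[of M S] by (simp add: mult_le_0_iff)
  then have "AE \<omega> in M. \<omega> \<notin> S"
    using S prob_eq_0 by blast
  then show "AE \<omega> in M. \<exists>m. \<forall>k\<ge>m. x m k \<omega> < 1 / real (Suc i)"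
    using AE_space
  proof eventually_elim
    case (elim \<omega>)
    then obtain m where "\<forall>k\<ge>m. x m k \<omega> < l"
      by (auto simp: S_def not_le) (meson linorder_not_le)
    then show ?case unfolding l_def by blast
  qed
qed

text \<open>For fixed \<open>m\<close> the process \<open>cexp k (W m)\<close> is a martingale, so
  Doob's inequality controls it for all \<open>k\<close> \<ge> \<open>m\<close> at once by the
  expectation of \<open>W m\<close>, which tends to zero by dominated convergence. Monotonicity then
  replaces \<open>W m\<close> by the smaller \<open>W k\<close> on the diagonal.\<close>

lemma cexp_decreasing_tendsto_zero:
  assumes meas: "\<And>n. W n \<in> borel_measurable M"
    and nonneg: "\<And>n \<omega>. 0 \<le> W n \<omega>" and bd: "\<And>n \<omega>. W n \<omega> \<le> K"
    and decr: "\<And>m n \<omega>. m \<le> n \<Longrightarrow> W n \<omega> \<le> W m \<omega>"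
    and lim: "AE \<omega> in M. (\<lambda>n. W n \<omega>) \<longlonglongrightarrow> 0"
  shows "AE \<omega> in M. (\<lambda>n. cexp n (W n) \<omega>) \<longlonglongrightarrow> 0"
proof -
  have int: "integrable M (W n)" for n
    by (rule integrable_AE_bounded[OF meas, of _ K]) (use nonneg bd in auto)
  have cnonneg: "AE \<omega> in M. 0 \<le> cexp n (W m) \<omega>" for n m
    using nonneg meas by (intro sigma_finite_subalgebra.real_cond_exp_pos[OF sfs]) auto
  have cint: "integrable M (cexp k (W m))" for k m
    by (rule sigma_finite_subalgebra.real_cond_exp_int[OF sfs int])
  have cmeas: "cexp k (W m) \<in> borel_measurable (F k)" for k m
    by (rule borel_measurable_cond_exp)
  have Eq: "(\<integral>\<omega>. cexp n (W m) \<omega> \<partial>M) = (\<integral>\<omega>. W m \<omega> \<partial>M)" for n m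
    by (rule sigma_finite_subalgebra.real_cond_exp_int[OF sfs int])
  have "AE \<omega> in M. \<forall>i. \<exists>m. \<forall>k\<ge>m. cexp k (W m) \<omega> < 1 / real (Suc i)"
  proof (rule AE_of_vanishing_bound)
    show "cexp k (W m) \<in> borel_measurable M" for k m
      using cmeas measurable_F_M by blast
    show "l * prob {\<omega>\<in>space M. \<exists>k\<ge>m. l \<le> cexp k (W m) \<omega>} \<le> (\<integral>\<omega>. W m \<omega> \<partial>M)" for m l
    proof (rule maximal_inequality)
      fix k n D assume "k \<le> n" and D: "D \<in> sets (F k)"
      then have "D \<in> sets (F n)" using sets_F_mono by auto
      with D show "(\<integral>\<omega>. indicator D \<omega> * cexp k (W m) \<omega> \<partial>M) \<le> (\<integral>\<omega>. indicator D \<omega> * cexp n (W m) \<omega> \<partial>M)"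
        by (simp add: integral_indicator_cexp[OF int])
    qed (use cint cmeas cnonneg Eq in auto)
    have "(\<lambda>n. \<integral>\<omega>. W n \<omega> \<partial>M) \<longlonglongrightarrow> (\<integral>\<omega>. 0 \<partial>M)"
      using lim nonneg bd meas by (intro integral_dominated_convergence[where w="\<lambda>_. K"]) auto
    then show "(\<lambda>n. \<integral>\<omega>. W n \<omega> \<partial>M) \<longlonglongrightarrow> 0" by simp
  qed
  moreover have "AE \<omega> in M. \<forall>m k. m \<le> k \<longrightarrow> cexp k (W k) \<omega> \<le> cexp k (W m) \<omega>"
    unfolding AE_all_countable
    using decr int sigma_finite_subalgebra.real_cond_exp_mono[OF sfs] by (auto intro!: AE_I2 simp: AE_all_countable)
  moreover have "AE \<omega> in M. \<forall>k. 0 \<le> cexp k (W k) \<omega>"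
    using cnonneg by (simp add: AE_all_countable)
  ultimately show ?thesis
  proof eventually_elim
    case (elim \<omega>)
    show ?case
    proof (rule LIMSEQ_I)
      fix r :: real assume "0 < r"
      then obtain i where i: "1 / real (Suc i) < r"
        using nat_approx_posE by blast
      obtain m where "\<forall>k\<ge>m. cexp k (W m) \<omega> < 1 / real (Suc i)"
        using elim(1) by auto
      then have "norm (cexp k (W k) \<omega> - 0) < r" if "k \<ge> m" for k
        using elim(2,3) that i by (smt (verit, best) real_norm_def)
      then show "\<exists>m. \<forall>k\<ge>m. norm (cexp k (W k) \<omega> - 0) < r" by blast
    qed
  qed
qed

text \<open>Pythagoras on an event of the past: the cross term vanishes because
  \<open>indicator D * s\<close> is known at time \<open>k\<close> and \<open>d\<close> has
  conditional mean zero. The almost sure bounds supply integrability.\<close>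

lemma martingale_sum_square_step:
  assumes meas_s: "s \<in> borel_measurable (F k)" and meas_d: "d \<in> borel_measurable M"
    and bs: "AE \<omega> in M. \<bar>s \<omega>\<bar> \<le> K" and bd: "AE \<omega> in M. \<bar>d \<omega>\<bar> \<le> c"
    and mart: "AE \<omega> in M. cexp k d \<omega> = 0" and D: "D \<in> sets (F k)"
  shows "(\<integral>\<omega>. indicator D \<omega> * (s \<omega> + d \<omega>)\<^sup>2 \<partial>M)
    = (\<integral>\<omega>. indicator D \<omega> * (s \<omega>)\<^sup>2 \<partial>M) + (\<integral>\<omega>. indicator D \<omega> * (d \<omega>)\<^sup>2 \<partial>M)"
proof -
  note [measurable] = measurable_F_M[OF meas_s] meas_d sets_F_M[OF D]
  have b1: "AE \<omega> in M. norm (indicator D \<omega> * (s \<omega>)\<^sup>2) \<le> K\<^sup>2"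
    using bs
  proof eventually_elim
    case (elim \<omega>)
    then have "(s \<omega>)\<^sup>2 \<le> K\<^sup>2" by (intro abs_le_square_iff[THEN iffD1]) simp
    then show ?case by (simp add: indicator_def)
  qed
  have b2: "AE \<omega> in M. norm (indicator D \<omega> * (d \<omega>)\<^sup>2) \<le> c\<^sup>2"
    using bd
  proof eventually_elim
    case (elim \<omega>)
    then have "(d \<omega>)\<^sup>2 \<le> c\<^sup>2" by (intro abs_le_square_iff[THEN iffD1]) simp
    then show ?case by (simp add: indicator_def)
  qed
  have b3: "AE \<omega> in M. norm ((indicator D \<omega> * s \<omega>) * d \<omega>) \<le> K * c"
    using bs bd
  proof eventually_elim
    case (elim \<omega>)
    then have "\<bar>s \<omega>\<bar> * \<bar>d \<omega>\<bar> \<le> K * c" "0 \<le> K * c" by (auto intro!: mult_mono mult_nonneg_nonneg)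
    then show ?case by (simp add: indicator_def abs_mult)
  qed
  have i1: "integrable M (\<lambda>\<omega>. indicator D \<omega> * (s \<omega>)\<^sup>2)"
    by (rule integrable_AE_bounded[OF _ b1]) measurable
  have i2: "integrable M (\<lambda>\<omega>. indicator D \<omega> * (d \<omega>)\<^sup>2)"
    by (rule integrable_AE_bounded[OF _ b2]) measurable
  have i3: "integrable M (\<lambda>\<omega>. (indicator D \<omega> * s \<omega>) * d \<omega>)"
    by (rule integrable_AE_bounded[OF _ b3]) measurable
  have m: "(\<lambda>\<omega>. indicator D \<omega> * s \<omega>) \<in> borel_measurable (F k)"
    using meas_s D by (intro borel_measurable_times borel_measurable_indicator) auto
  have "(\<integral>\<omega>. indicator D \<omega> * (s \<omega> + d \<omega>)\<^sup>2 \<partial>M)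
    = (\<integral>\<omega>. (indicator D \<omega> * (s \<omega>)\<^sup>2 + indicator D \<omega> * (d \<omega>)\<^sup>2) + 2 * ((indicator D \<omega> * s \<omega>) * d \<omega>) \<partial>M)"
    by (intro Bochner_Integration.integral_cong) (auto simp: power2_eq_square algebra_simps)
  also have "\<dots> = (\<integral>\<omega>. indicator D \<omega> * (s \<omega>)\<^sup>2 \<partial>M) + (\<integral>\<omega>. indicator D \<omega> * (d \<omega>)\<^sup>2 \<partial>M)
      + 2 * (\<integral>\<omega>. (indicator D \<omega> * s \<omega>) * d \<omega> \<partial>M)"
    using i1 i2 i3 by (subst Bochner_Integration.integral_add)
      (auto intro!: Bochner_Integration.integrable_add integrable_mult_right)
  also have "(\<integral>\<omega>. (indicator D \<omega> * s \<omega>) * d \<omega> \<partial>M) = 0"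
    by (rule integral_mult_cexp_zero[OF mart m meas_d i3])
  finally show ?thesis by simp
qed

text \<open>The squares of the sums started at \<open>m\<close> form a submartingale whose
  expectations are bounded by the tail \<open>K m\<close> of the series of squares. The maximal
  inequality thus makes the oscillation after \<open>m\<close> small, which is the Cauchy
  property.\<close>

lemma martingale_sum_convergent:
  assumes meas: "\<And>k. d k \<in> borel_measurable (F (Suc k))"
    and bd: "\<And>k. AE \<omega> in M. \<bar>d k \<omega>\<bar> \<le> c k"
    and summ: "summable (\<lambda>k. (c k)\<^sup>2)"
    and mart: "\<And>k. AE \<omega> in M. cexp k (d k) \<omega> = 0"
  shows "AE \<omega> in M. convergent (\<lambda>n. \<Sum>k<n. d k \<omega>)"
proof -
  define s where "s m n \<omega> = (\<Sum>k\<in>{m..<n}. d k \<omega>)" for m n \<omega>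
  define K where "K m = (\<Sum>k. (c (k + m))\<^sup>2)" for m
  have dM [measurable]: "d k \<in> borel_measurable M" for k
    using meas measurable_F_M by blast
  have s_meas: "s m n \<in> borel_measurable (F n)" for m n
    unfolding s_def by (intro borel_measurable_sum) (auto intro!: measurable_F_mono[OF meas])
  have bd': "AE \<omega> in M. \<forall>k. \<bar>d k \<omega>\<bar> \<le> c k"
    using bd by (simp add: AE_all_countable)
  have s_bd: "AE \<omega> in M. \<bar>s m n \<omega>\<bar> \<le> (\<Sum>k\<in>{m..<n}. c k)" for m n
    using bd'
  proof eventually_elim
    case (elim \<omega>)
    have "\<bar>s m n \<omega>\<bar> \<le> (\<Sum>k\<in>{m..<n}. \<bar>d k \<omega>\<bar>)" unfolding s_def by (rule sum_abs)
    also have "\<dots> \<le> (\<Sum>k\<in>{m..<n}. c k)" using elim by (intro sum_mono) auto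
    finally show ?case .
  qed
  have s_int: "integrable M (\<lambda>\<omega>. (s m n \<omega>)\<^sup>2)" for m n
  proof (rule integrable_AE_bounded)
    show "AE \<omega> in M. norm ((s m n \<omega>)\<^sup>2) \<le> (\<Sum>k\<in>{m..<n}. c k)\<^sup>2"
      using s_bd[of m n]
    proof eventually_elim
      case (elim \<omega>)
      then have "(s m n \<omega>)\<^sup>2 \<le> (\<Sum>k\<in>{m..<n}. c k)\<^sup>2" by (intro abs_le_square_iff[THEN iffD1]) simp
      then show ?case by simp
    qed
  qed (use measurable_F_M[OF s_meas] in measurable)
  have s_step: "(\<integral>\<omega>. indicator D \<omega> * (s m (Suc n) \<omega>)\<^sup>2 \<partial>M)
      = (\<integral>\<omega>. indicator D \<omega> * (s m n \<omega>)\<^sup>2 \<partial>M) + (\<integral>\<omega>. indicator D \<omega> * (d n \<omega>)\<^sup>2 \<partial>M)"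
    if "m \<le> n" "D \<in> sets (F n)" for m n D
  proof -
    have "s m (Suc n) = (\<lambda>\<omega>. s m n \<omega> + d n \<omega>)"
      using that by (auto simp: s_def fun_eq_iff)
    then show ?thesis
      using martingale_sum_square_step[OF s_meas dM s_bd bd mart that(2)] by simp
  qed
  have submart: "(\<integral>\<omega>. indicator D \<omega> * (s m k \<omega>)\<^sup>2 \<partial>M) \<le> (\<integral>\<omega>. indicator D \<omega> * (s m n \<omega>)\<^sup>2 \<partial>M)"
    if "m \<le> k" "k \<le> n" "D \<in> sets (F k)" for m n k D
    using that(2)
  proof (induction n rule: dec_induct)
    case (step n)
    have "D \<in> sets (F n)" using that step sets_F_mono by blast
    then have "(\<integral>\<omega>. indicator D \<omega> * (s m (Suc n) \<omega>)\<^sup>2 \<partial>M)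
        = (\<integral>\<omega>. indicator D \<omega> * (s m n \<omega>)\<^sup>2 \<partial>M) + (\<integral>\<omega>. indicator D \<omega> * (d n \<omega>)\<^sup>2 \<partial>M)"
      using s_step[of m n D] that step.hyps by auto
    moreover have "0 \<le> (\<integral>\<omega>. indicator D \<omega> * (d n \<omega>)\<^sup>2 \<partial>M)"
      by (intro integral_nonneg_AE) auto
    ultimately show ?case
      using step.IH by linarith
  qed simp
  have "(\<integral>\<omega>. (s m n \<omega>)\<^sup>2 \<partial>M) \<le> (\<Sum>k\<in>{m..<n}. (c k)\<^sup>2)" if "m \<le> n" for m n
    using that
  proof (induction n rule: dec_induct)
    case (step n)
    have "(\<integral>\<omega>. (d n \<omega>)\<^sup>2 \<partial>M) \<le> (\<integral>\<omega>. (c n)\<^sup>2 \<partial>M)"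
    proof (rule integral_mono_AE)
      show le: "AE \<omega> in M. (d n \<omega>)\<^sup>2 \<le> (c n)\<^sup>2"
        using bd[of n] by eventually_elim (intro abs_le_square_iff[THEN iffD1], simp)
      show "integrable M (\<lambda>\<omega>. (d n \<omega>)\<^sup>2)"
        by (rule integrable_AE_bounded[where K="(c n)\<^sup>2"]) (use le in auto)
    qed auto
    moreover have "(\<integral>\<omega>. (s m (Suc n) \<omega>)\<^sup>2 \<partial>M) = (\<integral>\<omega>. (s m n \<omega>)\<^sup>2 \<partial>M) + (\<integral>\<omega>. (d n \<omega>)\<^sup>2 \<partial>M)"
    proof -
      have "(\<integral>\<omega>. indicator (space M) \<omega> * f \<omega> \<partial>M) = (\<integral>\<omega>. f \<omega> \<partial>M)" for f :: "'w \<Rightarrow> real"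
        by (intro Bochner_Integration.integral_cong) auto
      moreover have "space M \<in> sets (F n)"
        using sets.top[of "F n"] by simp
      ultimately show ?thesis using s_step[OF step.hyps(1), of "space M"] by simp
    qed
    ultimately show ?case
      using step by (simp add: prob_space)
  qed (simp add: s_def)
  moreover have "(\<Sum>k\<in>{m..<n}. (c k)\<^sup>2) \<le> K m" for m n
  proof -
    have "(\<Sum>k\<in>{m..<n}. (c k)\<^sup>2) = (\<Sum>k\<in>{..<n-m}. (c (k + m))\<^sup>2)"
      by (rule sum.reindex_bij_witness[of _ "\<lambda>k. k + m" "\<lambda>k. k - m"]) auto
    also have "\<dots> \<le> K m"
      unfolding K_def using summable_ignore_initial_segment[OF summ, of m]
      by (rule sum_le_suminf) auto
    finally show ?thesis .
  qed
  ultimately have s2: "(\<integral>\<omega>. (s m n \<omega>)\<^sup>2 \<partial>M) \<le> K m" if "m \<le> n" for m n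
    using that order_trans by blast
  have K0: "K \<longlonglongrightarrow> 0"
    unfolding K_def by (rule suminf_exist_split2[OF summ])
  have "AE \<omega> in M. \<forall>i. \<exists>m. \<forall>k\<ge>m. (s m k \<omega>)\<^sup>2 < 1 / real (Suc i)"
  proof (rule AE_of_vanishing_bound[OF _ _ K0])
    show "(\<lambda>\<omega>. (s m k \<omega>)\<^sup>2) \<in> borel_measurable M" for m k
      using measurable_F_M[OF s_meas] by measurable
    show "l * prob {\<omega>\<in>space M. \<exists>k\<ge>m. l \<le> (s m k \<omega>)\<^sup>2} \<le> K m" for m l
      by (rule maximal_inequality) (use s_meas s_int submart s2 in auto)
  qed
  then show ?thesis
  proof eventually_elim
    case (elim \<omega>)
    \<comment> \<open>All partial sums from \<open>m\<close> on are compared with the one at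
      \<open>m\<close>; the level is taken below (e/2)^2 because the maximal inequality controls
      squares.\<close>
    have "Cauchy (\<lambda>n. \<Sum>k<n. d k \<omega>)"
    proof (rule metric_CauchyI)
      fix e :: real assume "0 < e"
      then obtain i where i: "1 / real (Suc i) < (e / 2)\<^sup>2"
        using nat_approx_posE[of "(e/2)\<^sup>2"] by auto
      obtain m where m: "\<forall>k\<ge>m. (s m k \<omega>)\<^sup>2 < 1 / real (Suc i)"
        using elim by blast
      have "dist (\<Sum>k<n. d k \<omega>) (\<Sum>k<m. d k \<omega>) < e / 2" if "n \<ge> m" for n
      proof -
        have "(s m n \<omega>)\<^sup>2 < (e / 2)\<^sup>2" using m that i by force
        then have "\<bar>s m n \<omega>\<bar> < e / 2"
          using power2_less_imp_less[of "\<bar>s m n \<omega>\<bar>" "e / 2"] \<open>0 < e\<close> by simp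
        moreover have "(\<Sum>k<n. d k \<omega>) = (\<Sum>k<m. d k \<omega>) + s m n \<omega>"
          unfolding s_def lessThan_atLeast0 using that by (subst sum.atLeastLessThan_concat) auto
        ultimately show ?thesis by (simp add: dist_real_def)
      qed
      then show "\<exists>m. \<forall>n\<ge>m. \<forall>k\<ge>m. dist (\<Sum>k<n. d k \<omega>) (\<Sum>j<k. d j \<omega>) < e"
        using dist_triangle_half_l by blast
    qed
    then show ?case by (rule Cauchy_convergent)
  qed
qed

text \<open>Dividing the k-th difference by k+1 makes the bounds square summable, so the weighted
  series converges; Kronecker's lemma turns this into averages.\<close>

lemma bounded_martingale_differences_slln:
  assumes meas: "\<And>k. d k \<in> borel_measurable (F (Suc k))"
    and bd: "\<And>k. AE \<omega> in M. \<bar>d k \<omega>\<bar> \<le> c"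
    and mart: "\<And>k. AE \<omega> in M. cexp k (d k) \<omega> = 0"
  shows "AE \<omega> in M. (\<lambda>n. (\<Sum>k<n. d k \<omega>) / real n) \<longlonglongrightarrow> 0"
proof -
  have "AE \<omega> in M. convergent (\<lambda>n. \<Sum>k<n. d k \<omega> / real (Suc k))"
  proof (rule martingale_sum_convergent)
    show "(\<lambda>\<omega>. d k \<omega> / real (Suc k)) \<in> borel_measurable (F (Suc k))" for k
      using meas[of k] by measurable
    show "AE \<omega> in M. \<bar>d k \<omega> / real (Suc k)\<bar> \<le> c / real (Suc k)" for k
      using bd[of k] by eventually_elim (auto simp: abs_divide intro!: divide_right_mono)
    show "summable (\<lambda>k. (c / real (Suc k))\<^sup>2)"
      by (rule summable_inverse_Suc_square)
    show "AE \<omega> in M. cexp k (\<lambda>\<omega>. d k \<omega> / real (Suc k)) \<omega> = 0" for k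
    proof -
      have "integrable M (d k)"
        using bd by (intro integrable_AE_bounded[where K=c] measurable_F_M[OF meas]) auto
      from sigma_finite_subalgebra.real_cond_exp_cdiv[OF sfs[of k] this, where c="real (Suc k)"] mart[of k]
      show ?thesis by eventually_elim simp
    qed
  qed
  then show ?thesis by eventually_elim (rule kronecker_lemma)
qed

lemma centered_measurable:
  assumes "Y \<in> borel_measurable (F (Suc k))"
  shows "(\<lambda>\<omega>. Y \<omega> - cexp k Y \<omega>) \<in> borel_measurable (F (Suc k))"
  using assms measurable_F_mono[OF borel_measurable_cond_exp, of k "Suc k" M Y] by simp

lemma cexp_centered:
  assumes int: "integrable M Y"
  shows "AE \<omega> in M. cexp k (\<lambda>\<omega>. Y \<omega> - cexp k Y \<omega>) \<omega> = 0"
proof -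
  have c: "cexp k Y \<in> borel_measurable (F k)" by (rule borel_measurable_cond_exp)
  have i: "integrable M (cexp k Y)" by (rule sigma_finite_subalgebra.real_cond_exp_int[OF sfs int])
  show "AE \<omega> in M. cexp k (\<lambda>\<omega>. Y \<omega> - cexp k Y \<omega>) \<omega> = 0"
    using sigma_finite_subalgebra.real_cond_exp_diff[OF sfs[of k] int i]
      sigma_finite_subalgebra.real_cond_exp_F_meas[OF sfs i c]
    by eventually_elim simp
qed

lemma abs_cexp_le:
  assumes "f \<in> borel_measurable M" "AE \<omega> in M. \<bar>f \<omega>\<bar> \<le> c"
  shows "AE \<omega> in M. \<bar>cexp k f \<omega>\<bar> \<le> c"
proof -
  have i: "integrable M f" using assms by (intro integrable_AE_bounded[where K=c]) auto
  have "AE \<omega> in M. cexp k f \<omega> \<le> c"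
    using assms i by (intro sigma_finite_subalgebra.real_cond_exp_le_c[OF sfs]) (auto elim: eventually_mono)
  moreover have "AE \<omega> in M. cexp k f \<omega> \<ge> - c"
    using assms i by (intro sigma_finite_subalgebra.real_cond_exp_ge_c[OF sfs]) (auto elim: eventually_mono)
  ultimately show ?thesis by eventually_elim auto
qed

text \<open>Doob decomposition: the centred increments form a convergent martingale series, and the
  conditional drifts are absolutely summable.\<close>

lemma quasi_martingale_convergent:
  assumes meas: "\<And>k. Z k \<in> borel_measurable (F k)"
    and bd: "\<And>k. AE \<omega> in M. \<bar>Z (Suc k) \<omega> - Z k \<omega>\<bar> \<le> c / real (Suc k)"
    and drift: "\<And>k. AE \<omega> in M. \<bar>cexp k (\<lambda>\<omega>. Z (Suc k) \<omega> - Z k \<omega>) \<omega>\<bar> \<le> c / (real (Suc k) * real (Suc (Suc k)))"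
  shows "AE \<omega> in M. convergent (\<lambda>n. Z n \<omega>)"
proof -
  define Y where "Y k \<omega> = Z (Suc k) \<omega> - Z k \<omega>" for k \<omega>
  define d where "d k \<omega> = Y k \<omega> - cexp k (Y k) \<omega>" for k \<omega>
  have Y_meas: "Y k \<in> borel_measurable (F (Suc k))" for k
    unfolding Y_def using meas[of "Suc k"] measurable_F_mono[OF meas[of k], of "Suc k"] by simp
  have Y_bd: "AE \<omega> in M. \<bar>Y k \<omega>\<bar> \<le> c / real (Suc k)" for k
    using bd by (simp add: Y_def)
  have Y_int: "integrable M (Y k)" for k
    using Y_bd by (intro integrable_AE_bounded[where K="c / real (Suc k)"] measurable_F_M[OF Y_meas]) auto
  have "AE \<omega> in M. convergent (\<lambda>n. \<Sum>k<n. d k \<omega>)"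
  proof (rule martingale_sum_convergent)
    show "d k \<in> borel_measurable (F (Suc k))" "AE \<omega> in M. cexp k (d k) \<omega> = 0" for k
      using centered_measurable[OF Y_meas] cexp_centered[OF Y_int] by (simp_all add: d_def[abs_def])
    show "AE \<omega> in M. \<bar>d k \<omega>\<bar> \<le> (2 * c) / real (Suc k)" for k
      using Y_bd[of k] abs_cexp_le[OF measurable_F_M[OF Y_meas] Y_bd[of k], of k]
      by eventually_elim (auto simp: d_def)
    show "summable (\<lambda>k. ((2 * c) / real (Suc k))\<^sup>2)"
      by (rule summable_inverse_Suc_square)
  qed
  moreover have "AE \<omega> in M. \<forall>k. \<bar>cexp k (Y k) \<omega>\<bar> \<le> c / (real (Suc k) * real (Suc (Suc k)))"
    using drift by (simp add: AE_all_countable Y_def[abs_def])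
  ultimately show ?thesis
  proof eventually_elim
    case (elim \<omega>)
    \<comment> \<open>Nonnegativity of \<open>c\<close> is read off the bound at k = 0. It is needed
      to write the majorant as the square of \<open>sqrt c\<close> / (k+1), the form of
      \<open>summable_inverse_Suc_square\<close>.\<close>
    have "0 \<le> c / (real (Suc 0) * real (Suc (Suc 0)))" using elim(2) abs_ge_zero order_trans by blast
    then have c: "0 \<le> c" by simp
    have "summable (\<lambda>k. cexp k (Y k) \<omega>)"
    proof (rule summable_comparison_test')
      show "summable (\<lambda>k. ((sqrt c) / real (Suc k))\<^sup>2)" by (rule summable_inverse_Suc_square)
      show "norm (cexp k (Y k) \<omega>) \<le> ((sqrt c) / real (Suc k))\<^sup>2" for k
      proof -
        have "norm (cexp k (Y k) \<omega>) \<le> c / (real (Suc k) * real (Suc (Suc k)))" using elim(2) by simp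
        also have "\<dots> \<le> c / (real (Suc k) * real (Suc k))"
        proof (rule divide_left_mono[OF _ c])
          show "real (Suc k) * real (Suc k) \<le> real (Suc k) * real (Suc (Suc k))"
            by (rule mult_left_mono) simp_all
          show "0 < real (Suc k) * real (Suc (Suc k)) * (real (Suc k) * real (Suc k))"
            by (simp only: zero_less_mult_iff of_nat_0_less_iff zero_less_Suc simp_thms)
        qed
        also have "\<dots> = ((sqrt c) / real (Suc k))\<^sup>2"
          unfolding power_divide real_sqrt_pow2[OF c] by (simp only: power2_eq_square)
        finally show ?thesis .
      qed
    qed
    then have "convergent (\<lambda>n. \<Sum>k<n. cexp k (Y k) \<omega>)"
      by (simp add: summable_iff_convergent)
    then have "convergent (\<lambda>n. (\<Sum>k<n. d k \<omega>) + (\<Sum>k<n. cexp k (Y k) \<omega>) + Z 0 \<omega>)"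
      using elim(1) by (intro convergent_add convergent_const)
    moreover have "(\<Sum>k<n. d k \<omega>) + (\<Sum>k<n. cexp k (Y k) \<omega>) + Z 0 \<omega> = Z n \<omega>" for n
      using sum_lessThan_telescope[of "\<lambda>k. Z k \<omega>" n] by (simp add: d_def Y_def flip: sum.distrib)
    ultimately show ?case by simp
  qed
qed

end

subsection \<open>The conditional characteristic function\<close>

text \<open>The upper bound on exp(-x) comes from the product (1 - x + x^2/2)(1 + x + x^2/2) = 1 +
  x^4/4 \<ge> 1, together with the quadratic lower bound on exp(x).\<close>

lemma exp_minus_approx:
  fixes x :: real
  assumes "0 \<le> x"
  shows "\<bar>1 - x - exp (- x)\<bar> \<le> x\<^sup>2 / 2"
proof -
  have "1 - x \<le> exp (- x)" using exp_ge_add_one_self[of "- x"] by simp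
  moreover have "exp (- x) \<le> 1 - x + x\<^sup>2 / 2"
  proof -
    have q: "1 + x + x\<^sup>2 / 2 \<le> exp x" by (rule exp_lower_Taylor_quadratic[OF assms])
    have pos: "0 \<le> 1 - x + x\<^sup>2 / 2"
    proof -
      have "0 \<le> (1 - x)\<^sup>2 + 1" by simp
      then show ?thesis by (simp add: power2_eq_square algebra_simps)
    qed
    have "1 \<le> 1 + x ^ 4 / 4" by simp
    also have "\<dots> = (1 - x + x\<^sup>2 / 2) * (1 + x + x\<^sup>2 / 2)"
      by (simp add: field_simps power2_eq_square power4_eq_xxxx)
    also have "\<dots> \<le> (1 - x + x\<^sup>2 / 2) * exp x"
      by (rule mult_left_mono[OF q pos])
    finally have "1 \<le> (1 - x + x\<^sup>2 / 2) * exp x" .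
    then show ?thesis by (simp add: exp_minus inverse_eq_divide divide_le_eq)
  qed
  ultimately show ?thesis by (auto simp: abs_le_iff)
qed

lemma iexp_quadratic_approx:
  "cmod (iexp a - (1 + \<i> * a - of_real (a\<^sup>2 / 2))) \<le> \<bar>a\<bar> ^ 3 / 6"
proof -
  have "(\<Sum>k\<le>2. (\<i> * complex_of_real a) ^ k / fact k) = 1 + \<i> * a - of_real (a\<^sup>2 / 2)"
    by (simp add: numeral_2_eq_2 power2_eq_square algebra_simps)
  with iexp_approx1[of a 2] show ?thesis
    by (simp add: fact_numeral numeral_3_eq_3)
qed

text \<open>The exact telescoping behind the normalisation of the conditional variances: no error
  term appears when the one-step bounds are summed from \<open>n\<close>.\<close>

lemma sum_inverse_consecutive:
  "n \<le> k \<Longrightarrow> (\<Sum>j\<in>{n..<k}. 1 / (real (Suc j) * real (Suc (Suc j)))) = 1 / real (Suc n) - 1 / real (Suc k)"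
proof (induction k rule: dec_induct)
  case (step k)
  have "1 / (real (Suc k) * real (Suc (Suc k))) = 1 / real (Suc k) - 1 / real (Suc (Suc k))"
    by (simp add: field_simps)
  with step show ?case by simp
qed simp

context filtered_prob_space
begin

lemma integral_complex_mult_centered:
  fixes g :: "'w \<Rightarrow> complex"
  assumes g: "g \<in> borel_measurable (F k)" and g1: "\<And>\<omega>. cmod (g \<omega>) \<le> K"
    and f: "f \<in> borel_measurable M" and fb: "AE \<omega> in M. \<bar>f \<omega>\<bar> \<le> c"
  shows "(\<integral>\<omega>. g \<omega> * of_real (f \<omega> - cexp k f \<omega>) \<partial>M) = 0"
proof -
  define d where "d \<omega> = f \<omega> - cexp k f \<omega>" for \<omega>
  have int_f: "integrable M f"
    by (rule integrable_AE_bounded[OF f, of c]) (use fb in auto)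
  have d0: "AE \<omega> in M. cexp k d \<omega> = 0"
    using cexp_centered[OF int_f] by (simp add: d_def[abs_def])
  have dM [measurable]: "d \<in> borel_measurable M"
    unfolding d_def using f by measurable
  have gM [measurable]: "g \<in> borel_measurable M"
    by (rule measurable_from_subalg[OF sub g])
  have db: "AE \<omega> in M. \<bar>d \<omega>\<bar> \<le> 2 * c"
    using fb abs_cexp_le[OF f fb, of k] by eventually_elim (auto simp: d_def)
  have int: "integrable M (\<lambda>\<omega>. g \<omega> * of_real (d \<omega>))"
  proof (rule integrable_AE_bounded)
    show "AE \<omega> in M. norm (g \<omega> * of_real (d \<omega>)) \<le> K * (2 * c)"
      using db
    proof eventually_elim
      case (elim \<omega>)
      have "0 \<le> K" using g1[of \<omega>] norm_ge_zero order_trans by blast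
      then show ?case using elim g1[of \<omega>] by (auto simp: norm_mult intro!: mult_mono)
    qed
  qed measurable
  \<comment> \<open>Conditional expectations are real here, so orthogonality is applied to real and
    imaginary parts separately; \<open>p\<close> stands for \<open>Re\<close> or
    \<open>Im\<close>.\<close>
  have part: "(\<integral>\<omega>. p (g \<omega>) * d \<omega> \<partial>M) = 0" if [measurable]: "p \<in> borel_measurable borel" and p: "\<And>z. \<bar>p z\<bar> \<le> cmod z" for p :: "complex \<Rightarrow> real"
  proof (rule integral_mult_cexp_zero[OF d0 _ dM])
    show "(\<lambda>\<omega>. p (g \<omega>)) \<in> borel_measurable (F k)" using g by measurable
    show "integrable M (\<lambda>\<omega>. p (g \<omega>) * d \<omega>)"
    proof (rule Bochner_Integration.integrable_bound[OF int])
      show "AE \<omega> in M. norm (p (g \<omega>) * d \<omega>) \<le> norm (g \<omega> * complex_of_real (d \<omega>))"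
        using p by (auto simp: norm_mult abs_mult intro!: mult_right_mono)
    qed measurable
  qed
  show ?thesis
    unfolding d_def[symmetric]
  proof (rule complex_eqI)
    show "Re (\<integral>\<omega>. g \<omega> * of_real (d \<omega>) \<partial>M) = Re 0"
      using part[of Re] abs_Re_le_cmod integral_Re[OF int] by simp
    show "Im (\<integral>\<omega>. g \<omega> * of_real (d \<omega>) \<partial>M) = Im 0"
      using part[of Im] abs_Im_le_cmod integral_Im[OF int] by simp
  qed
qed

text \<open>One step of the telescoping. \<open>G\<close> carries everything known at time
  \<open>k\<close>. The four terms required to lie below \<open>R\<close> are the cubic Taylor
  remainder, the drift, the mismatch between the prescribed and the true conditional variance, and
  the quadratic error of exp(-x). \<open>R\<close> may be random because the mismatch is.\<close>

lemma cond_char_step: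
  fixes G :: "'w \<Rightarrow> complex"
  assumes G: "G \<in> borel_measurable (F k)" and GD: "\<And>\<omega>. cmod (G \<omega>) \<le> indicator D \<omega>"
    and D: "D \<in> sets M"
    and Y: "Y \<in> borel_measurable M" and Yb: "AE \<omega> in M. \<bar>Y \<omega>\<bar> \<le> y"
    and x: "x \<in> borel_measurable (F k)" and x0: "\<And>\<omega>. 0 \<le> x \<omega>" and xb: "\<And>\<omega>. x \<omega> \<le> xm"
    and R: "integrable M R"
    and RB: "AE \<omega> in M. \<bar>u\<bar> ^ 3 * y ^ 3 / 6 + \<bar>u\<bar> * \<bar>cexp k Y \<omega>\<bar>
       + \<bar>x \<omega> - u\<^sup>2 / 2 * cexp k (\<lambda>\<omega>. (Y \<omega>)\<^sup>2) \<omega>\<bar> + (x \<omega>)\<^sup>2 / 2 \<le> R \<omega>"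
  shows "cmod (\<integral>\<omega>. G \<omega> * (iexp (u * Y \<omega>) - exp (- x \<omega>)) \<partial>M) \<le> (\<integral>\<omega>. indicator D \<omega> * R \<omega> \<partial>M)"
proof -
  define Y2 where "Y2 \<omega> = (Y \<omega>)\<^sup>2" for \<omega>
  note [measurable] = Y D measurable_from_subalg[OF sub G] measurable_from_subalg[OF sub x]
  have Y2 [measurable]: "Y2 \<in> borel_measurable M" unfolding Y2_def by measurable
  have Y2b: "AE \<omega> in M. \<bar>Y2 \<omega>\<bar> \<le> y\<^sup>2"
    using Yb
  proof eventually_elim
    case (elim \<omega>)
    then have "(Y \<omega>)\<^sup>2 \<le> y\<^sup>2" by (intro abs_le_square_iff[THEN iffD1]) simp
    then show ?case by (simp add: Y2_def)
  qed
  define \<Psi> where "\<Psi> \<omega> = iexp (u * Y \<omega>) - complex_of_real (exp (- x \<omega>))" for \<omega>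
  \<comment> \<open>\<open>E1\<close> and \<open>E2\<close> integrate to zero. Subtracting them
    replaces the first and second powers of \<open>Y\<close> in the Taylor expansion by their
    conditional expectations before absolute values are taken.\<close>
  define E1 where "E1 \<omega> = \<i> * u * G \<omega> * of_real (Y \<omega> - cexp k Y \<omega>)" for \<omega>
  define E2 where "E2 \<omega> = - (u\<^sup>2 / 2) * G \<omega> * of_real (Y2 \<omega> - cexp k Y2 \<omega>)" for \<omega>
  have G1: "cmod (G \<omega>) \<le> 1" for \<omega>
    using GD[of \<omega>] by (cases "\<omega> \<in> D") auto
  have [measurable]: "E1 \<in> borel_measurable M" "E2 \<in> borel_measurable M" "\<Psi> \<in> borel_measurable M"
    unfolding E1_def E2_def \<Psi>_def by measurable
  have c1: "AE \<omega> in M. \<bar>cexp k Y \<omega>\<bar> \<le> y" by (rule abs_cexp_le[OF Y Yb])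
  have c2: "AE \<omega> in M. \<bar>cexp k Y2 \<omega>\<bar> \<le> y\<^sup>2" by (rule abs_cexp_le[OF Y2 Y2b])
  have i1: "integrable M E1"
  proof (rule integrable_AE_bounded)
    show "AE \<omega> in M. norm (E1 \<omega>) \<le> \<bar>u\<bar> * 1 * (2 * y)"
      using Yb c1
    proof eventually_elim
      case (elim \<omega>)
      then have "\<bar>Y \<omega> - cexp k Y \<omega>\<bar> \<le> 2 * y" by linarith
      then show ?case unfolding E1_def norm_mult norm_ii norm_of_real mult_1_left
        using G1[of \<omega>] by (intro mult_mono) auto
    qed
  qed measurable
  have i2: "integrable M E2"
  proof (rule integrable_AE_bounded)
    show "AE \<omega> in M. norm (E2 \<omega>) \<le> \<bar>u\<^sup>2 / 2\<bar> * 1 * (2 * y\<^sup>2)"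
      using Y2b c2
    proof eventually_elim
      case (elim \<omega>)
      then have "\<bar>Y2 \<omega> - cexp k Y2 \<omega>\<bar> \<le> 2 * y\<^sup>2" by linarith
      then have "cmod (of_real (Y2 \<omega> - cexp k Y2 \<omega>)) \<le> 2 * y\<^sup>2" unfolding norm_of_real .
      moreover have "norm (complex_of_real (- (u\<^sup>2 / 2))) = \<bar>u\<^sup>2 / 2\<bar>" unfolding norm_of_real by simp
      ultimately show ?case unfolding E2_def norm_mult
        using G1[of \<omega>] by (intro mult_mono) (simp_all del: of_real_diff)
    qed
  qed measurable
  have i3: "integrable M (\<lambda>\<omega>. G \<omega> * \<Psi> \<omega>)"
  proof (rule integrable_AE_bounded)
    have "norm (G \<omega> * \<Psi> \<omega>) \<le> 1 * 2" for \<omega>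
    proof -
      have "cmod (\<Psi> \<omega>) \<le> cmod (iexp (u * Y \<omega>)) + cmod (of_real (exp (- x \<omega>)))"
        unfolding \<Psi>_def by (rule norm_triangle_ineq4)
      also have "\<dots> \<le> 1 + 1" using x0[of \<omega>] by (intro add_mono) (auto simp: norm_exp_i_times)
      finally show ?thesis unfolding norm_mult using G1[of \<omega>] by (intro mult_mono) auto
    qed
    then show "AE \<omega> in M. norm (G \<omega> * \<Psi> \<omega>) \<le> 1 * 2" by simp
  qed measurable
  have z1: "(\<integral>\<omega>. E1 \<omega> \<partial>M) = 0"
  proof -
    have "(\<integral>\<omega>. E1 \<omega> \<partial>M) = \<i> * u * (\<integral>\<omega>. G \<omega> * of_real (Y \<omega> - cexp k Y \<omega>) \<partial>M)"
      unfolding E1_def mult.assoc by (simp only: integral_mult_right_zero)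
    then show ?thesis using integral_complex_mult_centered[OF G G1 Y Yb] by simp
  qed
  have z2: "(\<integral>\<omega>. E2 \<omega> \<partial>M) = 0"
  proof -
    have "(\<integral>\<omega>. E2 \<omega> \<partial>M) = - (u\<^sup>2 / 2) * (\<integral>\<omega>. G \<omega> * of_real (Y2 \<omega> - cexp k Y2 \<omega>) \<partial>M)"
      unfolding E2_def mult.assoc by (simp only: integral_mult_right_zero)
    then show ?thesis using integral_complex_mult_centered[OF G G1 Y2 Y2b] by simp
  qed
  have iR: "integrable M (\<lambda>\<omega>. indicator D \<omega> * R \<omega>)"
    using integrable_mult_indicator[OF D R] by simp
  have "(\<integral>\<omega>. G \<omega> * \<Psi> \<omega> \<partial>M) = (\<integral>\<omega>. G \<omega> * \<Psi> \<omega> - E1 \<omega> - E2 \<omega> \<partial>M)"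
    using i1 i2 i3 z1 z2 by simp
  also have "cmod \<dots> \<le> (\<integral>\<omega>. indicator D \<omega> * R \<omega> \<partial>M)"
  proof (rule order_trans[OF integral_norm_bound integral_mono_AE])
    show "integrable M (\<lambda>\<omega>. cmod (G \<omega> * \<Psi> \<omega> - E1 \<omega> - E2 \<omega>))" using i1 i2 i3 by simp
    show "integrable M (\<lambda>\<omega>. indicator D \<omega> * R \<omega>)" by (rule iR)
    show "AE \<omega> in M. norm (G \<omega> * \<Psi> \<omega> - E1 \<omega> - E2 \<omega>) \<le> indicator D \<omega> * R \<omega>"
      using RB Yb
    proof eventually_elim
      case (elim \<omega>)
      define q where "q = cexp k Y \<omega>"
      define q2 where "q2 = cexp k Y2 \<omega>"
      define a where "a = u * Y \<omega>"
      let ?r1 = "iexp a - (1 + \<i> * a - of_real (a\<^sup>2 / 2))"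
      let ?r2 = "complex_of_real (1 - x \<omega> - exp (- x \<omega>))"
      let ?T = "?r1 + \<i> * of_real (u * q) + of_real (x \<omega> - u\<^sup>2 / 2 * q2) + ?r2"
      \<comment> \<open>In \<open>?T\<close> the constant terms of the two expansions cancel, and x
        minus half of u^2 times the conditional second moment is what remains at second
        order.\<close>
      have eq: "G \<omega> * \<Psi> \<omega> - E1 \<omega> - E2 \<omega> = G \<omega> * ?T"
        unfolding \<Psi>_def E1_def E2_def q_def[symmetric] q2_def[symmetric] a_def Y2_def
        by (simp add: field_simps power_mult_distrib)
      have "\<bar>a\<bar> ^ 3 \<le> \<bar>u\<bar> ^ 3 * y ^ 3"
        unfolding a_def abs_mult power_mult_distrib using elim(2) by (intro mult_left_mono power_mono) auto
      then have "cmod ?r1 \<le> \<bar>u\<bar> ^ 3 * y ^ 3 / 6"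
        using iexp_quadratic_approx[of a] by simp
      moreover have "cmod ?r2 \<le> (x \<omega>)\<^sup>2 / 2"
        unfolding norm_of_real by (rule exp_minus_approx[OF x0])
      moreover have "cmod (\<i> * of_real (u * q)) = \<bar>u\<bar> * \<bar>q\<bar>"
        by (simp add: norm_mult abs_mult)
      moreover have "cmod (of_real (x \<omega> - u\<^sup>2 / 2 * q2)) = \<bar>x \<omega> - u\<^sup>2 / 2 * q2\<bar>"
        by (rule norm_of_real)
      moreover have "cmod ?T \<le> cmod ?r1 + cmod (\<i> * of_real (u * q)) + cmod (of_real (x \<omega> - u\<^sup>2 / 2 * q2)) + cmod ?r2"
        by (intro norm_triangle_mono order_refl)
      ultimately have "cmod ?T \<le> R \<omega>"
        using elim(1) by (simp add: q_def q2_def Y2_def[abs_def])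
      then show ?case
        unfolding eq norm_mult using GD[of \<omega>] by (intro mult_mono) auto
    qed
  qed
  finally show ?thesis by (simp add: \<Psi>_def)
qed

text \<open>The estimate is integrated over an event \<open>D\<close> known at time \<open>n\<close>
  instead of being stated for conditional expectations: \<open>D\<close> will be an atom, and
  dividing by its probability gives a bound for a single \<omega>.\<close>

lemma cond_char_estimate:
  fixes t c :: real and n :: nat
  assumes Z: "\<And>k. Z k \<in> borel_measurable (F k)"
    and bd: "\<And>k. AE \<omega> in M. \<bar>Z (Suc k) \<omega> - Z k \<omega>\<bar> \<le> c / real (Suc k)"
    and drift: "\<And>k. AE \<omega> in M. \<bar>cexp k (\<lambda>\<omega>. Z (Suc k) \<omega> - Z k \<omega>) \<omega>\<bar> \<le> c / (real (Suc k) * real (Suc (Suc k)))"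
    and U: "\<And>k. U k \<in> borel_measurable (F k)"
    and U0: "\<And>k \<omega>. 0 \<le> U k \<omega>" and Uc: "\<And>k \<omega>. U k \<omega> \<le> c\<^sup>2"
    and var: "\<And>k. AE \<omega> in M. cexp k (\<lambda>\<omega>. (Z (Suc k) \<omega> - Z k \<omega>)\<^sup>2) \<omega> = U k \<omega> / (real (Suc k) * real (Suc (Suc k)))"
    and Zl [measurable]: "Zl \<in> borel_measurable M"
    and lim: "AE \<omega> in M. (\<lambda>k. Z k \<omega>) \<longlonglongrightarrow> Zl \<omega>"
    and W: "integrable M W"
    and UW: "\<And>j \<omega>. n \<le> j \<Longrightarrow> \<bar>U n \<omega> - U j \<omega>\<bar> \<le> W \<omega>"
    and D: "D \<in> sets (F n)" and n: "1 \<le> n" and c: "0 \<le> c"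
  shows "cmod (\<integral>\<omega>. indicator D \<omega> * (iexp (t * (sqrt n * (Zl \<omega> - Z n \<omega>)))
        - exp (- (t\<^sup>2 * (n / Suc n) * U n \<omega> / 2))) \<partial>M)
    \<le> (\<bar>t\<bar> ^ 3 * c ^ 3 / 6 + \<bar>t\<bar> * c + t ^ 4 * c ^ 4 / 8) / sqrt n * prob D
      + t\<^sup>2 / 2 * (\<integral>\<omega>. indicator D \<omega> * W \<omega> \<partial>M)"
proof -
  define u where "u = t * sqrt n"
  \<comment> \<open>The three summands come from the Taylor remainder, the drift and the error of
    exp(-x), in this order. With u = t sqrt n each contributes at most sqrt n times
    \<open>p j\<close> at step \<open>j\<close>, and the \<open>p j\<close> with \<open>j\<close>
    \<ge> \<open>n\<close> sum to at most 1/n, whence \<open>K\<close> / sqrt n.\<close>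
  define K where "K = \<bar>t\<bar> ^ 3 * c ^ 3 / 6 + \<bar>t\<bar> * c + t ^ 4 * c ^ 4 / 8"
  define w where "w j \<omega> = exp (- (u\<^sup>2 * U n \<omega> / (2 * real (Suc j))))" for j \<omega>
  define x where "x j \<omega> = u\<^sup>2 * U n \<omega> / (2 * (real (Suc j) * real (Suc (Suc j))))" for j \<omega>
  define \<Phi> where "\<Phi> j \<omega> = iexp (u * (Z j \<omega> - Z n \<omega>)) * complex_of_real (w j \<omega>)" for j \<omega>
  define Y where "Y j \<omega> = Z (Suc j) \<omega> - Z j \<omega>" for j \<omega>
  define p where "p j = 1 / (real (Suc j) * real (Suc (Suc j)))" for j
  define R where "R j \<omega> = (K * sqrt n + t\<^sup>2 * n / 2 * W \<omega>) * p j" for j \<omega>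
  have DM: "D \<in> sets M" by (rule sets_F_M[OF D])
  have ZM [measurable]: "Z k \<in> borel_measurable M" for k by (rule measurable_F_M[OF Z])
  have UM [measurable]: "U k \<in> borel_measurable M" for k by (rule measurable_F_M[OF U])
  have n0: "real n \<ge> 1" using n by simp
  have u2: "u\<^sup>2 = t\<^sup>2 * n" by (simp add: u_def power_mult_distrib)
  have p0: "0 \<le> p j" for j by (simp add: p_def)
  have w01: "0 \<le> w j \<omega>" "w j \<omega> \<le> 1" for j \<omega>
    using U0[of n \<omega>] by (auto simp: w_def)
  \<comment> \<open>Because 1/(j+1) = 1/(j+2) + 1/((j+1)(j+2)), going one step further spends
    exactly the factor exp(-x_j). The increment of \<open>\<Phi>\<close> is therefore iexp(u Y_j) -
    exp(-x_j) times a factor known at time \<open>j\<close>; even \<open>w (Suc j)\<close> is known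
    then, since it involves only \<open>U n\<close>.\<close>
  have ww: "w j \<omega> = w (Suc j) \<omega> * exp (- x j \<omega>)" for j \<omega>
  proof -
    have "q / (2 * a) = q / (2 * (a + 1)) + q / (2 * (a * (a + 1)))" if "a > 0" for a q :: real
      using that by (simp add: divide_simps) (simp add: algebra_simps)
    from this[of "real (Suc j)" "u\<^sup>2 * U n \<omega>"]
    have "u\<^sup>2 * U n \<omega> / (2 * real (Suc j)) = u\<^sup>2 * U n \<omega> / (2 * real (Suc (Suc j))) + x j \<omega>"
      by (simp add: x_def add.commute)
    then show ?thesis
      unfolding w_def by (simp only: exp_add[symmetric] minus_add_distrib)
  qed
  have \<Phi>1: "cmod (\<Phi> j \<omega>) \<le> 1" for j \<omega>
    using w01[of j \<omega>] by (simp add: \<Phi>_def norm_mult)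
  have \<Phi>M [measurable]: "\<Phi> j \<in> borel_measurable M" for j
    unfolding \<Phi>_def w_def by measurable
  have iR: "integrable M (R j)" for j
    unfolding R_def using W by simp
  have step: "cmod (\<integral>\<omega>. indicator D \<omega> * (\<Phi> (Suc j) \<omega> - \<Phi> j \<omega>) \<partial>M) \<le> (\<integral>\<omega>. indicator D \<omega> * R j \<omega> \<partial>M)"
    if j: "n \<le> j" for j
  proof -
    define G where "G \<omega> = complex_of_real (indicator D \<omega>) * iexp (u * (Z j \<omega> - Z n \<omega>)) * complex_of_real (w (Suc j) \<omega>)" for \<omega>
    have "indicator D \<omega> * (\<Phi> (Suc j) \<omega> - \<Phi> j \<omega>) = G \<omega> * (iexp (u * Y j \<omega>) - exp (- x j \<omega>))" for \<omega>
    proof -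
      have "iexp (u * (Z (Suc j) \<omega> - Z n \<omega>)) = iexp (u * (Z j \<omega> - Z n \<omega>)) * iexp (u * Y j \<omega>)"
        by (simp add: Y_def exp_add[symmetric] algebra_simps)
      then show ?thesis
        unfolding \<Phi>_def G_def ww[of j \<omega>] by (simp add: algebra_simps indicator_def)
    qed
    moreover have "cmod (\<integral>\<omega>. G \<omega> * (iexp (u * Y j \<omega>) - exp (- x j \<omega>)) \<partial>M) \<le> (\<integral>\<omega>. indicator D \<omega> * R j \<omega> \<partial>M)"
    proof (rule cond_char_step[where k=j and y="c / real (Suc j)" and xm="u\<^sup>2 * c\<^sup>2"])
      have [measurable]: "Z j \<in> borel_measurable (F j)" "Z n \<in> borel_measurable (F j)" "U n \<in> borel_measurable (F j)"
        "D \<in> sets (F j)"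
        using Z measurable_F_mono[OF Z j] measurable_F_mono[OF U j] D sets_F_mono[OF j] by auto
      show "G \<in> borel_measurable (F j)"
        unfolding G_def w_def by measurable
      show "x j \<in> borel_measurable (F j)"
        unfolding x_def by measurable
      show "cmod (G \<omega>) \<le> indicator D \<omega>" for \<omega>
        using w01[of "Suc j" \<omega>] by (simp add: G_def norm_mult indicator_def)
      show "Y j \<in> borel_measurable M" unfolding Y_def by measurable
      show "AE \<omega> in M. \<bar>Y j \<omega>\<bar> \<le> c / real (Suc j)" using bd by (simp add: Y_def)
      show x0: "0 \<le> x j \<omega>" for \<omega>
        using U0 by (simp add: x_def)
      have xb': "x j \<omega> \<le> u\<^sup>2 * c\<^sup>2 / 2 * p j" for \<omega>
      proof -
        have "u\<^sup>2 * U n \<omega> \<le> u\<^sup>2 * c\<^sup>2" using Uc by (intro mult_left_mono) auto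
        then have "u\<^sup>2 * U n \<omega> / 2 * p j \<le> u\<^sup>2 * c\<^sup>2 / 2 * p j"
          using p0 by (intro mult_right_mono divide_right_mono) auto
        then show ?thesis by (simp add: x_def p_def)
      qed
      have p1: "p j \<le> 1"
        unfolding p_def by (simp add: divide_le_eq field_simps)
      show "x j \<omega> \<le> u\<^sup>2 * c\<^sup>2" for \<omega>
      proof -
        have "u\<^sup>2 * c\<^sup>2 / 2 * p j \<le> u\<^sup>2 * c\<^sup>2 * 1" using p1 p0 by (intro mult_mono) auto
        then show ?thesis using xb'[of \<omega>] by simp
      qed
      show "AE \<omega> in M. \<bar>u\<bar> ^ 3 * (c / real (Suc j)) ^ 3 / 6 + \<bar>u\<bar> * \<bar>cexp j (Y j) \<omega>\<bar>
         + \<bar>x j \<omega> - u\<^sup>2 / 2 * cexp j (\<lambda>\<omega>. (Y j \<omega>)\<^sup>2) \<omega>\<bar> + (x j \<omega>)\<^sup>2 / 2 \<le> R j \<omega>"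
        using drift[of j] var[of j]
      proof eventually_elim
        case (elim \<omega>)
        have sq: "sqrt n ^ 2 = n" "sqrt n ^ 3 = n * sqrt n"
          by (simp_all add: power3_eq_cube)
        \<comment> \<open>For \<open>j\<close> \<ge> \<open>n\<close> this reduces to n(j+2) \<le>
          j(j+2) \<le> (j+1)^2. It leaves one factor sqrt n of the n^(3/2) in the cube of u.\<close>
        have "n * (1 / real (Suc j)) ^ 3 \<le> p j"
        proof -
          have "real n * real (Suc (Suc j)) \<le> real j * real (Suc (Suc j))"
            using j by (intro mult_right_mono) auto
          also have "\<dots> \<le> real (Suc j) * real (Suc j)" by (simp add: algebra_simps)
          finally have "real n * real (Suc (Suc j)) / (real (Suc j) ^ 3 * real (Suc (Suc j)))
              \<le> real (Suc j) * real (Suc j) / (real (Suc j) ^ 3 * real (Suc (Suc j)))"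
            by (intro divide_right_mono) auto
          then show ?thesis by (simp add: p_def power3_eq_cube power_divide)
        qed
        then have "\<bar>t\<bar> ^ 3 * c ^ 3 / 6 * sqrt n * (n * (1 / real (Suc j)) ^ 3) \<le> \<bar>t\<bar> ^ 3 * c ^ 3 / 6 * sqrt n * p j"
          using c by (intro mult_left_mono) auto
        then have 1: "\<bar>u\<bar> ^ 3 * (c / real (Suc j)) ^ 3 / 6 \<le> \<bar>t\<bar> ^ 3 * c ^ 3 / 6 * sqrt n * p j"
          by (simp add: u_def abs_mult power_mult_distrib sq power_divide mult_ac)
        have "\<bar>u\<bar> * \<bar>cexp j (Y j) \<omega>\<bar> \<le> \<bar>u\<bar> * (c / (real (Suc j) * real (Suc (Suc j))))"
          using elim(1) by (intro mult_left_mono) (auto simp: Y_def[abs_def])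
        then have 2: "\<bar>u\<bar> * \<bar>cexp j (Y j) \<omega>\<bar> \<le> \<bar>t\<bar> * c * sqrt n * p j"
          by (simp add: u_def abs_mult p_def mult_ac)
        have eq3: "x j \<omega> - u\<^sup>2 / 2 * cexp j (\<lambda>\<omega>. (Y j \<omega>)\<^sup>2) \<omega> = t\<^sup>2 * n / 2 * (U n \<omega> - U j \<omega>) * p j"
        proof -
          have "cexp j (\<lambda>\<omega>. (Y j \<omega>)\<^sup>2) \<omega> = U j \<omega> * p j" using elim(2) by (simp add: Y_def[abs_def] p_def)
          moreover have "x j \<omega> = u\<^sup>2 / 2 * U n \<omega> * p j" by (simp add: x_def p_def)
          ultimately show ?thesis by (simp add: u2 algebra_simps)
        qed
        have 3: "\<bar>x j \<omega> - u\<^sup>2 / 2 * cexp j (\<lambda>\<omega>. (Y j \<omega>)\<^sup>2) \<omega>\<bar> \<le> t\<^sup>2 * n / 2 * W \<omega> * p j"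
          unfolding eq3 abs_mult using UW[OF j, of \<omega>] p0[of j]
          by (intro mult_mono) auto
        have 4: "(x j \<omega>)\<^sup>2 / 2 \<le> t ^ 4 * c ^ 4 / 8 * sqrt n * p j"
        proof -
          have "(x j \<omega>)\<^sup>2 \<le> (u\<^sup>2 * c\<^sup>2 / 2 * p j)\<^sup>2"
            using x0 xb' by (intro power_mono) auto
          also have "\<dots> = t ^ 4 * c ^ 4 / 4 * ((n * n * p j) * p j)"
            unfolding u2 by (simp add: power2_eq_square power4_eq_xxxx)
          also have "\<dots> \<le> t ^ 4 * c ^ 4 / 4 * (sqrt n * p j)"
          proof -
            have "real n * real n \<le> real (Suc j) * real (Suc (Suc j))"
              using j by (intro mult_mono) auto
            then have "n * n * p j \<le> 1" by (simp add: p_def divide_le_eq)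
            also have "1 \<le> sqrt n" using n0 by simp
            finally show ?thesis using c p0[of j] by (intro mult_left_mono mult_right_mono) auto
          qed
          finally show ?thesis by simp
        qed
        show ?case
          using 1 2 3 4 unfolding R_def K_def by (simp add: algebra_simps)
      qed
    qed (use DM iR in auto)
    ultimately show ?thesis by simp
  qed
  have int_\<Phi>: "integrable M (\<lambda>\<omega>. indicator D \<omega> * \<Phi> j \<omega>)" for j
  proof (rule integrable_AE_bounded)
    show "AE \<omega> in M. norm (indicator D \<omega> * \<Phi> j \<omega>) \<le> 1"
      using \<Phi>1 by (auto simp: indicator_def)
  qed (use DM in measurable)
  define IW where "IW = (\<integral>\<omega>. indicator D \<omega> * W \<omega> \<partial>M)"
  have iDW: "integrable M (\<lambda>\<omega>. indicator D \<omega> * W \<omega>)"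
    using integrable_mult_indicator[OF DM W] by simp
  have iD: "integrable M (indicator D :: _ \<Rightarrow> real)"
    using DM by (auto simp: integrable_indicator_iff emeasure_eq_measure)
  have IR: "(\<integral>\<omega>. indicator D \<omega> * R j \<omega> \<partial>M) = (K * sqrt n * prob D + t\<^sup>2 * n / 2 * IW) * p j" for j
  proof -
    have "(\<integral>\<omega>. indicator D \<omega> * R j \<omega> \<partial>M)
        = (\<integral>\<omega>. (K * sqrt n * p j) * indicator D \<omega> + (t\<^sup>2 * n / 2 * p j) * (indicator D \<omega> * W \<omega>) \<partial>M)"
      by (intro Bochner_Integration.integral_cong) (auto simp: R_def algebra_simps)
    also have "\<dots> = (K * sqrt n * p j) * prob D + (t\<^sup>2 * n / 2 * p j) * IW"
      using iDW iD DM by (simp add: IW_def)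
    finally show ?thesis by (simp add: algebra_simps)
  qed
  have IW0: "0 \<le> IW"
    unfolding IW_def using UW[of n] by (intro Bochner_Integration.integral_nonneg) auto
  have K0: "0 \<le> K" using c by (simp add: K_def)
  have partial: "cmod (\<integral>\<omega>. indicator D \<omega> * (\<Phi> k \<omega> - \<Phi> n \<omega>) \<partial>M) \<le> K / sqrt n * prob D + t\<^sup>2 / 2 * IW" if k: "n \<le> k" for k
  proof -
    have "(\<integral>\<omega>. indicator D \<omega> * (\<Phi> k \<omega> - \<Phi> n \<omega>) \<partial>M)
        = (\<Sum>j\<in>{n..<k}. \<integral>\<omega>. indicator D \<omega> * (\<Phi> (Suc j) \<omega> - \<Phi> j \<omega>) \<partial>M)"
    proof -
      have "(\<integral>\<omega>. indicator D \<omega> * (\<Phi> k \<omega> - \<Phi> n \<omega>) \<partial>M)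
        = (\<integral>\<omega>. indicator D \<omega> * \<Phi> k \<omega> \<partial>M) - (\<integral>\<omega>. indicator D \<omega> * \<Phi> n \<omega> \<partial>M)"
        using int_\<Phi> by (simp add: right_diff_distrib)
      also have "\<dots> = (\<Sum>j\<in>{n..<k}. (\<integral>\<omega>. indicator D \<omega> * \<Phi> (Suc j) \<omega> \<partial>M) - (\<integral>\<omega>. indicator D \<omega> * \<Phi> j \<omega> \<partial>M))"
        using sum_Suc_diff'[OF k, of "\<lambda>j. \<integral>\<omega>. indicator D \<omega> * \<Phi> j \<omega> \<partial>M"] by simp
      also have "\<dots> = (\<Sum>j\<in>{n..<k}. \<integral>\<omega>. indicator D \<omega> * (\<Phi> (Suc j) \<omega> - \<Phi> j \<omega>) \<partial>M)"
        using int_\<Phi> by (simp add: right_diff_distrib)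
      finally show ?thesis .
    qed
    also have "cmod \<dots> \<le> (\<Sum>j\<in>{n..<k}. (K * sqrt n * prob D + t\<^sup>2 * n / 2 * IW) * p j)"
      using step unfolding IR by (intro sum_norm_le) auto
    also have "\<dots> = (K * sqrt n * prob D + t\<^sup>2 * n / 2 * IW) * (1 / real (Suc n) - 1 / real (Suc k))"
      unfolding sum_inverse_consecutive[OF k, symmetric] p_def by (simp only: sum_distrib_left)
    also have "\<dots> \<le> (K * sqrt n * prob D + t\<^sup>2 * n / 2 * IW) * (1 / n)"
    proof (rule mult_left_mono)
      have "1 / real (Suc n) \<le> 1 / n" using n by (intro divide_left_mono) auto
      then show "1 / real (Suc n) - 1 / real (Suc k) \<le> 1 / n"
        using divide_nonneg_nonneg[of 1 "real (Suc k)"] by linarith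
      show "0 \<le> K * sqrt n * prob D + t\<^sup>2 * n / 2 * IW"
        using K0 IW0 by simp
    qed
    also have "\<dots> = K / sqrt n * prob D + t\<^sup>2 / 2 * IW"
    proof -
      have "sqrt n / n = 1 / sqrt n" using n0 real_sqrt_mult_self[of "real n"] by (simp add: field_simps)
      moreover have "K * sqrt n * prob D * (1 / n) = K * prob D * (sqrt n / n)"
        by simp
      ultimately have "K * sqrt n * prob D * (1 / n) = K / sqrt n * prob D"
        by simp
      then show ?thesis using n0 by (simp add: add_divide_distrib)
    qed
    finally show ?thesis .
  qed
  \<comment> \<open>As \<open>k\<close> grows the unspent exponent tends to 0, so \<open>w k\<close>
    tends to 1 and only the characteristic exponential of the limit remains. The bound in
    \<open>partial\<close> is uniform in \<open>k\<close> and passes to the limit.\<close>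
  have "(\<lambda>k. \<integral>\<omega>. indicator D \<omega> * (\<Phi> k \<omega> - \<Phi> n \<omega>) \<partial>M)
    \<longlonglongrightarrow> (\<integral>\<omega>. indicator D \<omega> * (iexp (u * (Zl \<omega> - Z n \<omega>)) - \<Phi> n \<omega>) \<partial>M)"
  proof (rule integral_dominated_convergence[where w="\<lambda>_. 2"])
    show "AE \<omega> in M. (\<lambda>k. indicator D \<omega> * (\<Phi> k \<omega> - \<Phi> n \<omega>)) \<longlonglongrightarrow> indicator D \<omega> * (iexp (u * (Zl \<omega> - Z n \<omega>)) - \<Phi> n \<omega>)"
      using lim
    proof eventually_elim
      case (elim \<omega>)
      have "(\<lambda>k. (u\<^sup>2 * U n \<omega> / 2) * inverse (real (Suc k))) \<longlonglongrightarrow> (u\<^sup>2 * U n \<omega> / 2) * 0"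
        by (intro tendsto_mult tendsto_const LIMSEQ_inverse_real_of_nat)
      moreover have "(u\<^sup>2 * U n \<omega> / 2) * inverse (real (Suc k)) = u\<^sup>2 * U n \<omega> / (2 * real (Suc k))" for k
        by (simp only: divide_inverse inverse_mult_distrib mult_ac)
      ultimately have "(\<lambda>k. u\<^sup>2 * U n \<omega> / (2 * real (Suc k))) \<longlonglongrightarrow> 0"
        by (simp only: mult_zero_right)
      from tendsto_exp[OF tendsto_minus[OF this]] have "(\<lambda>k. w k \<omega>) \<longlonglongrightarrow> 1"
        unfolding w_def by simp
      then have "(\<lambda>k. \<Phi> k \<omega>) \<longlonglongrightarrow> iexp (u * (Zl \<omega> - Z n \<omega>)) * of_real 1"
        unfolding \<Phi>_def using elim by (intro tendsto_intros)
      then show ?case by (intro tendsto_intros) simp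
    qed
    show "AE \<omega> in M. norm (indicator D \<omega> * (\<Phi> k \<omega> - \<Phi> n \<omega>)) \<le> 2" for k
    proof (rule AE_I2)
      fix \<omega>
      have "cmod (\<Phi> k \<omega> - \<Phi> n \<omega>) \<le> 1 + 1"
        using norm_triangle_ineq4 add_mono[OF \<Phi>1 \<Phi>1] order_trans by blast
      then show "norm (indicator D \<omega> * (\<Phi> k \<omega> - \<Phi> n \<omega>)) \<le> 2" by (simp add: indicator_def)
    qed
  qed (use DM in measurable)
  then have "cmod (\<integral>\<omega>. indicator D \<omega> * (iexp (u * (Zl \<omega> - Z n \<omega>)) - \<Phi> n \<omega>) \<partial>M) \<le> K / sqrt n * prob D + t\<^sup>2 / 2 * IW"
    by (rule LIMSEQ_le_const2[OF tendsto_norm]) (use partial in \<open>intro exI[of _ n], simp\<close>)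
  moreover have "\<Phi> n \<omega> = exp (- (t\<^sup>2 * (n / Suc n) * U n \<omega> / 2))" for \<omega>
    by (simp add: \<Phi>_def w_def u2 mult_ac)
  moreover have "u * (Zl \<omega> - Z n \<omega>) = t * (sqrt n * (Zl \<omega> - Z n \<omega>))" for \<omega>
    by (simp add: u_def)
  ultimately show ?thesis by (simp add: K_def IW_def)
qed

end

subsection \<open>Centred normal kernels and countable filtrations\<close>

text \<open>Scaling one standard normal law covers the degenerate case as well. It also moves the
  dependence on \<open>v\<close> from the measure into the integrand, which gives measurability of
  the kernel and the characteristic function.\<close>

lemma centered_normal_eq_distr:
  "centered_normal v = distr std_normal_distribution borel (\<lambda>x. sqrt (max 0 v) * x)"
proof (cases "v > 0")
  case True
  interpret S: real_distribution std_normal_distribution by (rule real_dist_normal_dist)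
  have "distr std_normal_distribution lborel (\<lambda>x. x) = std_normal_distribution"
    by (rule distr_id2) simp
  then have "distributed std_normal_distribution lborel (\<lambda>x. (sqrt v * x - 0) / sqrt v) std_normal_density"
    using True by (simp add: distributed_def)
  then have "distributed std_normal_distribution lborel (\<lambda>x. sqrt v * x) (normal_density 0 (sqrt v))"
    using True S.normal_standard_normal_convert[of "sqrt v" "\<lambda>x. sqrt v * x" 0] by simp
  then have "distr std_normal_distribution lborel (\<lambda>x. sqrt v * x) = centered_normal v"
    using True by (simp add: distributed_def centered_normal_def)
  moreover have "distr std_normal_distribution lborel (\<lambda>x. sqrt v * x) = distr std_normal_distribution borel (\<lambda>x. sqrt v * x)"
    by (rule distr_cong) auto
  ultimately show ?thesis using True by simp
next
  case False
  interpret S: real_distribution std_normal_distribution by (rule real_dist_normal_dist)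
  have "distr std_normal_distribution borel (\<lambda>x. sqrt (max 0 v) * x) = return borel (0::real)"
    using False by (simp add: max_def S.distr_const)
  then show ?thesis using False by (simp add: centered_normal_def)
qed

lemma real_distribution_centered_normal: "real_distribution (centered_normal v)"
proof -
  interpret S: real_distribution std_normal_distribution by (rule real_dist_normal_dist)
  show ?thesis
    unfolding centered_normal_eq_distr by (intro S.real_distribution_distr) measurable
qed

lemma char_centered_normal:
  assumes "0 \<le> v"
  shows "char (centered_normal v) t = exp (- (t\<^sup>2 * v / 2))"
proof -
  have "char (centered_normal v) t = (CLINT x|std_normal_distribution. iexp (t * (sqrt v * x)))"
    unfolding centered_normal_eq_distr char_def using assms by (subst integral_distr) auto
  also have "\<dots> = char std_normal_distribution (t * sqrt v)"
    by (simp add: char_def mult_ac)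
  also have "\<dots> = exp (- (t\<^sup>2 * v / 2))"
    unfolding char_std_normal_distribution using assms by (simp add: power_mult_distrib exp_of_real)
  finally show ?thesis .
qed

lemma prob_kernel_centered_normal:
  assumes [measurable]: "V \<in> borel_measurable M"
  shows "prob_kernel M (\<lambda>\<omega>. centered_normal (V \<omega>))"
  unfolding prob_kernel_def
proof (intro conjI ballI allI impI)
  show "prob_space (centered_normal (V \<omega>))" "sets (centered_normal (V \<omega>)) = sets borel" for \<omega>
    using real_distribution_centered_normal[of "V \<omega>"]
    by (auto simp: real_distribution_def real_distribution_axioms_def)
  fix f :: "real \<Rightarrow> real" assume "f \<in> borel_measurable borel \<and> bounded (range f)"
  then have [measurable]: "f \<in> borel_measurable borel" by simp
  interpret S: real_distribution std_normal_distribution by (rule real_dist_normal_dist)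
  have "(\<lambda>\<omega>. \<integral>x. f (sqrt (max 0 (V \<omega>)) * x) \<partial>std_normal_distribution) \<in> borel_measurable M"
    by (rule S.borel_measurable_lebesgue_integral) measurable
  moreover have "(\<integral>x. f x \<partial>centered_normal v) = (\<integral>x. f (sqrt (max 0 v) * x) \<partial>std_normal_distribution)" for v
    unfolding centered_normal_eq_distr by (subst integral_distr) auto
  ultimately show "(\<lambda>\<omega>. \<integral>x. f x \<partial>centered_normal (V \<omega>)) \<in> borel_measurable M" by simp
qed

section \<open>Fields generated by discrete variables, and their atoms\<close>

lemma space_generated_field [simp]: "space (generated_field M Y) = space M"
  by (simp add: generated_field_def)

lemma sets_generated_field: "sets (generated_field M Y) = {Y -` A \<inter> space M | A. True}"
  unfolding generated_field_def by (subst sets_vimage_algebra2) auto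

lemma subalgebra_generated_field:
  assumes "Y \<in> measurable M (count_space UNIV)"
  shows "subalgebra M (generated_field M Y)"
  using measurable_sets[OF assms] by (auto simp: subalgebra_def sets_generated_field)

text \<open>Every subset of the range of \<open>Y\<close> is allowed, so a function that is constant
  on the fibres of \<open>Y\<close> is measurable whatever the target field.\<close>

lemma measurable_generated_field:
  assumes "\<And>\<omega> \<omega>'. \<omega> \<in> space M \<Longrightarrow> \<omega>' \<in> space M \<Longrightarrow> Y \<omega> = Y \<omega>' \<Longrightarrow> g \<omega> = g \<omega>'"
    and "\<And>\<omega>. \<omega> \<in> space M \<Longrightarrow> g \<omega> \<in> space L"
  shows "g \<in> measurable (generated_field M Y) L"
proof (rule measurableI)
  fix A
  have "g -` A \<inter> space M = Y -` (Y ` (g -` A \<inter> space M)) \<inter> space M"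
    using assms(1) by blast
  then show "g -` A \<inter> space (generated_field M Y) \<in> sets (generated_field M Y)"
    by (auto simp: sets_generated_field)
qed (use assms(2) in simp)

lemma subalgebra_generated_field_mono:
  assumes "\<And>\<omega> \<omega>'. \<omega> \<in> space M \<Longrightarrow> \<omega>' \<in> space M \<Longrightarrow> Y \<omega> = Y \<omega>' \<Longrightarrow> Y' \<omega> = Y' \<omega>'"
  shows "subalgebra (generated_field M Y) (generated_field M Y')"
proof -
  have "\<exists>B. Y' -` A \<inter> space M = Y -` B \<inter> space M" for A
  proof
    show "Y' -` A \<inter> space M = Y -` (Y ` (Y' -` A \<inter> space M)) \<inter> space M"
      using assms by blast
  qed
  then show ?thesis by (auto simp: subalgebra_def sets_generated_field)
qed

text \<open>Points are closed in a T1 space, so the fibre of \<open>g\<close> through \<omega> is a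
  preimage under \<open>Y\<close>. In particular any version of a conditional expectation is
  constant on atoms everywhere, not merely almost everywhere.\<close>

lemma generated_field_constant:
  fixes g :: "'w \<Rightarrow> 'b::t1_space"
  assumes g: "g \<in> borel_measurable (generated_field M Y)"
    and \<omega>: "\<omega> \<in> space M" "\<omega>' \<in> space M" "Y \<omega>' = Y \<omega>"
  shows "g \<omega>' = g \<omega>"
proof -
  have "g -` {g \<omega>} \<inter> space (generated_field M Y) \<in> sets (generated_field M Y)"
    by (rule measurable_sets[OF g]) simp
  then obtain A where "g -` {g \<omega>} \<inter> space M = Y -` A \<inter> space M"
    by (auto simp: sets_generated_field)
  then show ?thesis using \<omega> by blast
qed

text \<open>\<open>h n\<close> encodes the whole history up to time \<open>n\<close>. The refinement
  condition says that a later history determines the earlier one, so the atoms are nested and the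
  generated fields increase.\<close>

locale countable_filtration = prob_space M for M :: "'w measure" +
  fixes h :: "nat \<Rightarrow> 'w \<Rightarrow> 's::countable"
  assumes h_measurable: "\<And>n. h n \<in> measurable M (count_space UNIV)"
    and h_refine: "\<And>n \<omega> \<omega>'. \<omega> \<in> space M \<Longrightarrow> \<omega>' \<in> space M \<Longrightarrow> h (Suc n) \<omega> = h (Suc n) \<omega>' \<Longrightarrow> h n \<omega> = h n \<omega>'"
begin

sublocale filtered_prob_space M "\<lambda>n. generated_field M (h n)"
proof unfold_locales
  show "subalgebra M (generated_field M (h n))" for n
    by (rule subalgebra_generated_field[OF h_measurable])
  show "sets (generated_field M (h n)) \<subseteq> sets (generated_field M (h (Suc n)))" for n
    using subalgebra_generated_field_mono[OF h_refine] by (simp add: subalgebra_def)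
qed

definition atom :: "nat \<Rightarrow> 'w \<Rightarrow> 'w set" where
  "atom n \<omega> = h n -` {h n \<omega>} \<inter> space M"

lemma atom_sets: "atom n \<omega> \<in> sets (generated_field M (h n))"
  by (auto simp: atom_def sets_generated_field)

text \<open>The code takes countably many values, so the atoms of probability zero together form a
  null set.\<close>

lemma AE_atom_pos: "AE \<omega> in M. \<forall>n. 0 < prob (atom n \<omega>)"
  unfolding AE_all_countable
proof
  fix n
  have "AE \<omega> in M. \<forall>s. prob (h n -` {s} \<inter> space M) = 0 \<longrightarrow> h n \<omega> \<noteq> s"
    unfolding AE_all_countable
  proof
    fix s
    have m: "h n -` {s} \<inter> space M \<in> sets M"
      by (rule measurable_sets[OF h_measurable]) simp
    show "AE \<omega> in M. prob (h n -` {s} \<inter> space M) = 0 \<longrightarrow> h n \<omega> \<noteq> s"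
    proof (cases "prob (h n -` {s} \<inter> space M) = 0")
      case True
      then have "AE \<omega> in M. \<omega> \<notin> h n -` {s} \<inter> space M" using m prob_eq_0 by blast
      then show ?thesis using AE_space by eventually_elim auto
    qed simp
  qed
  then show "AE \<omega> in M. 0 < prob (atom n \<omega>)"
  proof eventually_elim
    case (elim \<omega>)
    then have "prob (atom n \<omega>) \<noteq> 0" by (auto simp: atom_def)
    then show ?case using measure_nonneg[of M "atom n \<omega>"] by linarith
  qed
qed

text \<open>In this multiplied form the identity holds for every \<omega> of the space, including
  those in null atoms, where both sides vanish.\<close>

lemma cexp_atom:
  assumes f: "integrable M f" and \<omega>: "\<omega> \<in> space M"
  shows "prob (atom n \<omega>) * cexp n f \<omega> = (\<integral>\<omega>'. indicator (atom n \<omega>) \<omega>' * f \<omega>' \<partial>M)"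
proof -
  have "(\<integral>\<omega>'. indicator (atom n \<omega>) \<omega>' * f \<omega>' \<partial>M) = (\<integral>\<omega>'. indicator (atom n \<omega>) \<omega>' * cexp n f \<omega>' \<partial>M)"
    by (rule integral_indicator_cexp[OF f atom_sets, symmetric])
  also have "\<dots> = (\<integral>\<omega>'. indicator (atom n \<omega>) \<omega>' * cexp n f \<omega> \<partial>M)"
  proof (rule Bochner_Integration.integral_cong)
    fix \<omega>'
    show "indicator (atom n \<omega>) \<omega>' * cexp n f \<omega>' = indicator (atom n \<omega>) \<omega>' * cexp n f \<omega>"
      using generated_field_constant[OF borel_measurable_cond_exp \<omega>, of \<omega>' "h n" M f]
      by (auto simp: indicator_def atom_def)
  qed simp
  also have "\<dots> = prob (atom n \<omega>) * cexp n f \<omega>"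
    using sets_F_M[OF atom_sets, of n \<omega>] by simp
  finally show ?thesis ..
qed

text \<open>The elementary conditional law of \<open>Y\<close> given the atom of \<omega>. On an
  atom of probability zero the quotient is 0 by the convention for division, so the result is the
  null measure; a probability law is claimed only for positive atoms.\<close>

definition cond_law :: "nat \<Rightarrow> ('w \<Rightarrow> real) \<Rightarrow> 'w \<Rightarrow> real measure" where
  "cond_law n Y \<omega> = distr (density M (\<lambda>\<omega>'. ennreal (indicator (atom n \<omega>) \<omega>' / prob (atom n \<omega>)))) borel Y"

lemma integral_cond_law:
  fixes f :: "real \<Rightarrow> 'b::{banach, second_countable_topology}"
  assumes Y [measurable]: "Y \<in> borel_measurable M" and f [measurable]: "f \<in> borel_measurable borel"
  shows "(\<integral>x. f x \<partial>cond_law n Y \<omega>) = (\<integral>\<omega>'. (indicator (atom n \<omega>) \<omega>' / prob (atom n \<omega>)) *\<^sub>R f (Y \<omega>') \<partial>M)"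
proof -
  note [measurable] = sets_F_M[OF atom_sets, of n \<omega>]
  show ?thesis
    unfolding cond_law_def by (simp add: integral_distr integral_density)
qed

lemma real_distribution_cond_law:
  assumes Y [measurable]: "Y \<in> borel_measurable M" and pos: "0 < prob (atom n \<omega>)"
  shows "real_distribution (cond_law n Y \<omega>)"
proof -
  note [measurable] = sets_F_M[OF atom_sets, of n \<omega>]
  let ?P = "density M (\<lambda>\<omega>'. ennreal (indicator (atom n \<omega>) \<omega>' / prob (atom n \<omega>)))"
  have "emeasure ?P (space ?P) = (\<integral>\<^sup>+\<omega>'. ennreal (1 / prob (atom n \<omega>)) * indicator (atom n \<omega>) \<omega>' \<partial>M)"
    by (subst emeasure_density) (auto intro!: nn_integral_cong simp: indicator_def)
  also have "\<dots> = ennreal (1 / prob (atom n \<omega>)) * ennreal (prob (atom n \<omega>))"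
    by (subst nn_integral_cmult_indicator) (auto simp: emeasure_eq_measure)
  also have "\<dots> = 1"
    using pos by (simp flip: ennreal_mult)
  finally interpret P: prob_space ?P by (rule prob_spaceI)
  show ?thesis
    unfolding cond_law_def by (rule P.real_distribution_distr) simp
qed

end

subsection \<open>Almost sure conditional convergence of quasi-martingales\<close>

context countable_filtration
begin

text \<open>The supremum of |U_n - U_j| over \<open>j\<close> \<ge> \<open>n\<close> need not
  decrease in \<open>n\<close>. Twice the largest later distance to the limit does, and it dominates
  that supremum by the triangle inequality, so \<open>cexp_decreasing_tendsto_zero\<close>
  applies.\<close>

lemma sup_deviation:
  fixes U :: "nat \<Rightarrow> 'w \<Rightarrow> real" and V :: "'w \<Rightarrow> real" and K :: real
  assumes [measurable]: "\<And>k. U k \<in> borel_measurable M" "V \<in> borel_measurable M"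
    and U: "\<And>k \<omega>. 0 \<le> U k \<omega>" "\<And>k \<omega>. U k \<omega> \<le> K"
    and lim: "AE \<omega> in M. (\<lambda>k. U k \<omega>) \<longlonglongrightarrow> V \<omega>"
  obtains W where "\<And>n. W n \<in> borel_measurable M" "\<And>n. integrable M (W n)"
    "\<And>n j \<omega>. n \<le> j \<Longrightarrow> \<bar>U n \<omega> - U j \<omega>\<bar> \<le> W n \<omega>"
    "AE \<omega> in M. (\<lambda>n. cexp n (W n) \<omega>) \<longlonglongrightarrow> 0"
proof
  have K: "0 \<le> K" using U order_trans by blast
  \<comment> \<open>Clamping makes the deviations bounded at every \<omega>, so the suprema are
    finite without an exceptional set; almost surely \<open>V'\<close> equals
    \<open>V\<close>.\<close>
  define V' where "V' \<omega> = max 0 (min K (V \<omega>))" for \<omega>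
  define W where "W n \<omega> = 2 * (SUP j\<in>{n..}. \<bar>U j \<omega> - V' \<omega>\<bar>)" for n \<omega>
  have V'01: "0 \<le> V' \<omega>" "V' \<omega> \<le> K" for \<omega> using K by (auto simp: V'_def)
  have V'M [measurable]: "V' \<in> borel_measurable M" unfolding V'_def by measurable
  have dev: "\<bar>U j \<omega> - V' \<omega>\<bar> \<le> K" for j \<omega>
    using U[of j \<omega>] V'01[of \<omega>] by linarith
  have bdd: "bdd_above ((\<lambda>j. \<bar>U j \<omega> - V' \<omega>\<bar>) ` I)" for I \<omega>
    using dev by (intro bdd_aboveI2)
  show WM: "W n \<in> borel_measurable M" for n
    unfolding W_def by (intro borel_measurable_times borel_measurable_const borel_measurable_cSUP bdd) auto
  have up: "\<bar>U j \<omega> - V' \<omega>\<bar> \<le> W n \<omega> / 2" if "n \<le> j" for n j \<omega>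
    unfolding W_def using that cSUP_upper[OF _ bdd, of j "{n..}" \<omega>] by simp
  have W0: "0 \<le> W n \<omega>" for n \<omega>
    using up[OF order_refl, of n \<omega>] by linarith
  have WK: "W n \<omega> \<le> 2 * K" for n \<omega>
    unfolding W_def using dev by (intro mult_left_mono cSUP_least) auto
  show "integrable M (W n)" for n
    by (rule integrable_AE_bounded[OF WM, of _ "2 * K"]) (use W0 WK in auto)
  show "\<bar>U n \<omega> - U j \<omega>\<bar> \<le> W n \<omega>" if "n \<le> j" for n j \<omega>
    using up[OF order_refl, of n \<omega>] up[OF that, of \<omega>] by linarith
  show "AE \<omega> in M. (\<lambda>n. cexp n (W n) \<omega>) \<longlonglongrightarrow> 0"
  proof (rule cexp_decreasing_tendsto_zero[OF WM W0 WK])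
    show "W n \<omega> \<le> W m \<omega>" if "m \<le> n" for m n \<omega>
    proof -
      have "(SUP j\<in>{n..}. \<bar>U j \<omega> - V' \<omega>\<bar>) \<le> (SUP j\<in>{m..}. \<bar>U j \<omega> - V' \<omega>\<bar>)"
        using that by (intro cSUP_subset_mono[OF _ bdd]) simp_all
      then show ?thesis by (simp add: W_def)
    qed
    show "AE \<omega> in M. (\<lambda>n. W n \<omega>) \<longlonglongrightarrow> 0"
      using lim
    proof eventually_elim
      case (elim \<omega>)
      have "0 \<le> V \<omega>" by (rule LIMSEQ_le_const[OF elim]) (simp add: U)
      moreover have "V \<omega> \<le> K" by (rule LIMSEQ_le_const2[OF elim]) (simp add: U)
      ultimately have V': "V' \<omega> = V \<omega>" by (simp add: V'_def)
      show ?case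
      proof (rule LIMSEQ_I)
        fix r :: real assume "0 < r"
        then obtain m where m: "\<And>j. m \<le> j \<Longrightarrow> norm (U j \<omega> - V \<omega>) < r / 4"
          using LIMSEQ_D[OF elim, of "r / 4"] by auto
        have "norm (W n \<omega> - 0) < r" if "m \<le> n" for n
        proof -
          have "(SUP j\<in>{n..}. \<bar>U j \<omega> - V' \<omega>\<bar>) \<le> r / 4"
            using m that unfolding V' by (intro cSUP_least) (auto intro: less_imp_le)
          then have "W n \<omega> \<le> r / 2" unfolding W_def by simp
          then show ?thesis using W0[of n \<omega>] \<open>0 < r\<close> by simp
        qed
        then show "\<exists>m. \<forall>n\<ge>m. norm (W n \<omega> - 0) < r" by blast
      qed
    qed
  qed
qed

theorem as_cond_converges_normal:
  fixes c :: real
  assumes Z: "\<And>k. Z k \<in> borel_measurable (generated_field M (h k))"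
    and bd: "\<And>k. AE \<omega> in M. \<bar>Z (Suc k) \<omega> - Z k \<omega>\<bar> \<le> c / real (Suc k)"
    and drift: "\<And>k. AE \<omega> in M. \<bar>cexp k (\<lambda>\<omega>. Z (Suc k) \<omega> - Z k \<omega>) \<omega>\<bar> \<le> c / (real (Suc k) * real (Suc (Suc k)))"
    and U: "\<And>k. U k \<in> borel_measurable (generated_field M (h k))"
    and U0: "\<And>k \<omega>. 0 \<le> U k \<omega>" and Uc: "\<And>k \<omega>. U k \<omega> \<le> c\<^sup>2"
    and var: "\<And>k. AE \<omega> in M. cexp k (\<lambda>\<omega>. (Z (Suc k) \<omega> - Z k \<omega>)\<^sup>2) \<omega> = U k \<omega> / (real (Suc k) * real (Suc (Suc k)))"
    and V [measurable]: "V \<in> borel_measurable M" and UV: "AE \<omega> in M. (\<lambda>k. U k \<omega>) \<longlonglongrightarrow> V \<omega>"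
    and Zl [measurable]: "Zl \<in> borel_measurable M"
    and lim: "AE \<omega> in M. (\<lambda>k. Z k \<omega>) \<longlonglongrightarrow> Zl \<omega>" and c: "0 \<le> c"
  shows "as_cond_converges M (\<lambda>n. generated_field M (h n)) (\<lambda>n \<omega>. sqrt (real n) * (Z n \<omega> - Zl \<omega>))
    (\<lambda>\<omega>. centered_normal (V \<omega>))"
  unfolding as_cond_converges_def
proof (intro conjI allI impI)
  define Y where "Y n \<omega> = sqrt (real n) * (Z n \<omega> - Zl \<omega>)" for n \<omega>
  have ZM [measurable]: "Z k \<in> borel_measurable M" for k by (rule measurable_F_M[OF Z])
  have UM [measurable]: "U k \<in> borel_measurable M" for k by (rule measurable_F_M[OF U])
  have YM [measurable]: "Y n \<in> borel_measurable M" for n unfolding Y_def by measurable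
  show "subalgebra M (generated_field M (h n))" for n by (rule sub)
  show "(\<lambda>\<omega>. sqrt (real n) * (Z n \<omega> - Zl \<omega>)) \<in> borel_measurable M" for n by measurable
  show "prob_kernel M (\<lambda>\<omega>. centered_normal (V \<omega>))" by (rule prob_kernel_centered_normal[OF V])
  obtain W where W: "\<And>n. W n \<in> borel_measurable M" "\<And>n. integrable M (W n)"
    "\<And>n j \<omega>. n \<le> j \<Longrightarrow> \<bar>U n \<omega> - U j \<omega>\<bar> \<le> W n \<omega>"
    "AE \<omega> in M. (\<lambda>n. cexp n (W n) \<omega>) \<longlonglongrightarrow> 0"
    using sup_deviation[OF UM V U0 Uc UV] by blast
  define K where "K t = \<bar>t\<bar> ^ 3 * c ^ 3 / 6 + \<bar>t\<bar> * c + t ^ 4 * c ^ 4 / 8" for t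
  \<comment> \<open>The estimate concerns the limit minus Z_n while \<open>Y n\<close> has the
    opposite sign, hence the argument -t. It is used with the atom of \<omega> as event and then
    divided by the probability of that atom.\<close>
  have char_bound: "cmod (char (cond_law n (Y n) \<omega>) t - exp (- (t\<^sup>2 * (n / Suc n) * U n \<omega> / 2)))
      \<le> K (- t) / sqrt n + t\<^sup>2 / 2 * cexp n (W n) \<omega>"
    if \<omega>: "\<omega> \<in> space M" and pos: "0 < prob (atom n \<omega>)" and n: "1 \<le> n" for \<omega> n t
  proof -
    let ?D = "atom n \<omega>"
    note DM [measurable] = sets_F_M[OF atom_sets, of n \<omega>]
    let ?e = "complex_of_real (exp (- (t\<^sup>2 * (n / Suc n) * U n \<omega> / 2)))"
    have iI: "integrable M (\<lambda>\<omega>'. indicator ?D \<omega>' * iexp (t * Y n \<omega>'))"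
      by (rule integrable_AE_bounded[where K=1]) (auto simp: indicator_def)
    have iE: "integrable M (\<lambda>\<omega>'. indicator ?D \<omega>' * ?e)"
      by (rule integrable_AE_bounded[where K="cmod ?e"]) (auto simp: indicator_def)
    have "prob ?D * (char (cond_law n (Y n) \<omega>) t - ?e)
        = (\<integral>\<omega>'. indicator ?D \<omega>' * iexp (t * Y n \<omega>') \<partial>M) - (\<integral>\<omega>'. indicator ?D \<omega>' * ?e \<partial>M)"
    proof -
      have "(indicator ?D \<omega>' / prob ?D) *\<^sub>R iexp (t * Y n \<omega>') = (indicator ?D \<omega>' * iexp (t * Y n \<omega>')) / prob ?D" for \<omega>'
        by (simp add: indicator_def scaleR_conv_of_real)
      then have "char (cond_law n (Y n) \<omega>) t = (\<integral>\<omega>'. indicator ?D \<omega>' * iexp (t * Y n \<omega>') \<partial>M) / prob ?D"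
        unfolding char_def by (subst integral_cond_law) simp_all
      moreover have "(\<integral>\<omega>'. indicator ?D \<omega>' * ?e \<partial>M) = prob ?D * ?e"
      proof -
        have "(\<integral>\<omega>'. indicator ?D \<omega>' * ?e \<partial>M) = (\<integral>\<omega>'. complex_of_real (indicator ?D \<omega>') * ?e \<partial>M)"
          by (intro Bochner_Integration.integral_cong) (auto simp: indicator_def)
        also have "\<dots> = (\<integral>\<omega>'. complex_of_real (indicator ?D \<omega>') \<partial>M) * ?e"
          by (rule integral_mult_left_zero)
        also have "(\<integral>\<omega>'. complex_of_real (indicator ?D \<omega>') \<partial>M) = prob ?D"
          by (subst integral_complex_of_real) simp
        finally show ?thesis .
      qed
      moreover have "complex_of_real (prob ?D) \<noteq> 0" using pos by simp
      moreover have "p * (J / p - e) = J - p * e" if "p \<noteq> 0" for p J e :: complex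
        using that by (simp add: right_diff_distrib)
      ultimately show ?thesis
        by (simp only:)
    qed
    also have "\<dots> = (\<integral>\<omega>'. indicator ?D \<omega>' * (iexp (- t * (sqrt n * (Zl \<omega>' - Z n \<omega>')))
        - exp (- ((- t)\<^sup>2 * (n / Suc n) * U n \<omega>' / 2))) \<partial>M)"
      unfolding Bochner_Integration.integral_diff[OF iI iE, symmetric]
    proof (rule Bochner_Integration.integral_cong)
      fix \<omega>'
      have "U n \<omega>' = U n \<omega>" if "\<omega>' \<in> ?D"
        using generated_field_constant[OF U \<omega>, of \<omega>' n] that by (auto simp: atom_def)
      moreover have "- t * (sqrt n * (Zl \<omega>' - Z n \<omega>')) = t * Y n \<omega>'"
        by (simp add: Y_def algebra_simps)
      ultimately show "indicator ?D \<omega>' * iexp (t * Y n \<omega>') - indicator ?D \<omega>' * ?e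
        = indicator ?D \<omega>' * (iexp (- t * (sqrt n * (Zl \<omega>' - Z n \<omega>')))
        - exp (- ((- t)\<^sup>2 * (n / Suc n) * U n \<omega>' / 2)))"
        by (cases "\<omega>' \<in> ?D") (simp_all only: indicator_simps power2_minus, simp_all)
    qed simp
    also have "cmod \<dots> \<le> K (- t) / sqrt n * prob ?D + (- t)\<^sup>2 / 2 * (\<integral>\<omega>'. indicator ?D \<omega>' * W n \<omega>' \<partial>M)"
      unfolding K_def
      by (rule cond_char_estimate[OF Z bd drift U U0 Uc var Zl lim W(2) W(3) atom_sets n c])
    also have "(\<integral>\<omega>'. indicator ?D \<omega>' * W n \<omega>' \<partial>M) = prob ?D * cexp n (W n) \<omega>"
      by (rule cexp_atom[OF W(2) \<omega>, symmetric])
    also have "K (- t) / sqrt n * prob ?D + (- t)\<^sup>2 / 2 * (prob ?D * cexp n (W n) \<omega>)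
        = prob ?D * (K (- t) / sqrt n + t\<^sup>2 / 2 * cexp n (W n) \<omega>)"
      by (simp add: distrib_left mult_ac)
    finally have "prob ?D * cmod (char (cond_law n (Y n) \<omega>) t - ?e)
        \<le> prob ?D * (K (- t) / sqrt n + t\<^sup>2 / 2 * cexp n (W n) \<omega>)"
      using pos by (simp only: norm_mult norm_of_real abs_of_pos)
    then show ?thesis by (rule mult_left_le_imp_le[OF _ pos])
  qed
  \<comment> \<open>The exceptional set is fixed before any t or test function appears: it consists
    of null atoms and of the points where the conditional deviations or the variances fail to
    converge. Outside it Levy's theorem applies to one fixed sequence of laws.\<close>
  have weak: "AE \<omega> in M. (\<forall>n. 0 < prob (atom n \<omega>)) \<and> weak_conv_m (\<lambda>n. cond_law n (Y n) \<omega>) (centered_normal (V \<omega>))"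
    using AE_atom_pos W(4) UV AE_space
  proof eventually_elim
    case (elim \<omega>)
    have V0: "0 \<le> V \<omega>" by (rule LIMSEQ_le_const[OF elim(3)]) (simp add: U0)
    have "weak_conv_m (\<lambda>n. cond_law n (Y n) \<omega>) (centered_normal (V \<omega>))"
    proof (rule levy_continuity)
      show "real_distribution (cond_law n (Y n) \<omega>)" for n
        using elim(1) by (intro real_distribution_cond_law) auto
      show "real_distribution (centered_normal (V \<omega>))" by (rule real_distribution_centered_normal)
      fix t
      let ?g = "\<lambda>n. complex_of_real (exp (- (t\<^sup>2 * (n / Suc n) * U n \<omega> / 2)))"
      have bound_lim: "(\<lambda>n. K (- t) / sqrt n + t\<^sup>2 / 2 * cexp n (W n) \<omega>) \<longlonglongrightarrow> 0 + t\<^sup>2 / 2 * 0"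
      proof (intro tendsto_add tendsto_mult tendsto_const elim(2))
        show "(\<lambda>n. K (- t) / sqrt n) \<longlonglongrightarrow> 0" by real_asymp
      qed
      have bound: "\<forall>\<^sub>F n in sequentially. norm (char (cond_law n (Y n) \<omega>) t - ?g n) \<le> K (- t) / sqrt n + t\<^sup>2 / 2 * cexp n (W n) \<omega>"
      proof (rule eventually_sequentiallyI[of 1])
        fix n :: nat assume "1 \<le> n"
        then show "norm (char (cond_law n (Y n) \<omega>) t - ?g n) \<le> K (- t) / sqrt n + t\<^sup>2 / 2 * cexp n (W n) \<omega>"
          by (rule char_bound[OF elim(4) elim(1)[rule_format]])
      qed
      have "(\<lambda>n. char (cond_law n (Y n) \<omega>) t - ?g n) \<longlonglongrightarrow> 0"
        using bound_lim unfolding mult_zero_right add_0 by (rule Lim_null_comparison[OF bound])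
      moreover have "?g \<longlonglongrightarrow> complex_of_real (exp (- (t\<^sup>2 * 1 * V \<omega> / 2)))"
        by (intro tendsto_of_real tendsto_exp tendsto_minus tendsto_divide tendsto_mult tendsto_const
            elim(3) LIMSEQ_n_over_Suc_n) simp
      ultimately have "(\<lambda>n. (char (cond_law n (Y n) \<omega>) t - ?g n) + ?g n) \<longlonglongrightarrow> 0 + complex_of_real (exp (- (t\<^sup>2 * 1 * V \<omega> / 2)))"
        by (rule tendsto_add)
      then show "(\<lambda>n. char (cond_law n (Y n) \<omega>) t) \<longlonglongrightarrow> char (centered_normal (V \<omega>)) t"
        unfolding char_centered_normal[OF V0] by simp
    qed
    with elim(1) show ?case by blast
  qed
  fix f :: "real \<Rightarrow> real" assume f: "continuous_on UNIV f \<and> bounded (range f)"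
  then obtain L where L: "\<And>x. norm (f x) \<le> L" by (auto simp: bounded_iff)
  have fc: "isCont f x" for x using f by (auto simp: continuous_on_eq_continuous_at)
  have fm [measurable]: "f \<in> borel_measurable borel" using f by (intro borel_measurable_continuous_onI) auto
  have int: "integrable M (\<lambda>\<omega>. f (Y n \<omega>))" for n
    by (rule integrable_AE_bounded[where K=L]) (use L in auto)
  show "AE \<omega> in M. (\<lambda>n. cexp n (\<lambda>\<omega>'. f (sqrt (real n) * (Z n \<omega>' - Zl \<omega>'))) \<omega>) \<longlonglongrightarrow> (\<integral>x. f x \<partial>centered_normal (V \<omega>))"
    unfolding Y_def[symmetric] using weak AE_space
  proof eventually_elim
    case (elim \<omega>)
    have "(\<lambda>n. \<integral>x. f x \<partial>cond_law n (Y n) \<omega>) \<longlonglongrightarrow> (\<integral>x. f x \<partial>centered_normal (V \<omega>))"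
      using elim by (intro weak_conv_imp_integral_bdd_continuous_conv[where B=L] real_distribution_cond_law
          real_distribution_centered_normal fc L) auto
    moreover have "(\<integral>x. f x \<partial>cond_law n (Y n) \<omega>) = cexp n (\<lambda>\<omega>'. f (Y n \<omega>')) \<omega>" for n
    proof -
      have "(\<integral>x. f x \<partial>cond_law n (Y n) \<omega>) = (\<integral>\<omega>'. (indicator (atom n \<omega>) \<omega>' * f (Y n \<omega>')) / prob (atom n \<omega>) \<partial>M)"
        by (subst integral_cond_law) simp_all
      also have "\<dots> = prob (atom n \<omega>) * cexp n (\<lambda>\<omega>'. f (Y n \<omega>')) \<omega> / prob (atom n \<omega>)"
        using cexp_atom[OF int elim(2), of n n] by simp
      also have "\<dots> = cexp n (\<lambda>\<omega>'. f (Y n \<omega>')) \<omega>"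
        using elim(1) by (metis less_irrefl nonzero_mult_div_cancel_left)
      finally show ?thesis .
    qed
    ultimately show ?case by simp
  qed
qed

end

subsection \<open>Hypergeometric moments and conditional expectations\<close>

text \<open>Absorption, k C(h,k) = h C(h-1,k-1), reduces the sum to Vandermonde's identity. The
  upper limit is a successor so that the index shift involves no truncation; for h = 0 both sides
  vanish.\<close>

lemma binomial_convolution_first_moment:
  "(\<Sum>k\<le>Suc n. k * (h choose k) * (t choose (Suc n - k))) = h * ((h - 1 + t) choose n)"
proof (cases h)
  case (Suc h')
  have "(\<Sum>k\<le>Suc n. k * (h choose k) * (t choose (Suc n - k)))
      = (\<Sum>k\<le>n. Suc k * (h choose Suc k) * (t choose (n - k)))"
    by (subst sum.atMost_Suc_shift) simp
  also have "\<dots> = (\<Sum>k\<le>n. h * ((h' choose k) * (t choose (n - k))))"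
    unfolding Suc Suc_times_binomial_eq[symmetric] by (simp only: Suc_times_binomial mult.assoc)
  also have "\<dots> = h * ((h' + t) choose n)"
    by (simp only: sum_distrib_left[symmetric] vandermonde)
  finally show ?thesis by (simp add: Suc)
next
  case 0
  have "k * (h choose k) = 0" for k by (cases k) (auto simp: 0)
  then show ?thesis by (simp add: 0)
qed

text \<open>One absorption turns k(k-1) into a first moment for h-1. The truncated h-2 is harmless
  for h = 1, since the factor h-1 is then zero.\<close>

lemma binomial_convolution_second_moment:
  "(\<Sum>k\<le>Suc (Suc n). k * (k - 1) * (h choose k) * (t choose (Suc (Suc n) - k)))
    = h * (h - 1) * ((h - 2 + t) choose n)"
proof (cases h)
  case (Suc h')
  have "(\<Sum>k\<le>Suc (Suc n). k * (k - 1) * (h choose k) * (t choose (Suc (Suc n) - k)))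
      = (\<Sum>k\<le>Suc n. Suc k * k * (h choose Suc k) * (t choose (Suc n - k)))"
    by (subst sum.atMost_Suc_shift) simp
  also have "\<dots> = (\<Sum>k\<le>Suc n. h * (k * (h' choose k) * (t choose (Suc n - k))))"
  proof (rule sum.cong)
    fix k
    have "Suc k * k * (h choose Suc k) = k * (Suc k * (Suc h' choose Suc k))"
      unfolding Suc by (simp only: mult_ac)
    also have "\<dots> = k * (Suc h' * (h' choose k))"
      by (simp only: Suc_times_binomial)
    finally show "Suc k * k * (h choose Suc k) * (t choose (Suc n - k)) = h * (k * (h' choose k) * (t choose (Suc n - k)))"
      unfolding Suc by (simp only: mult_ac)
  qed simp
  also have "\<dots> = h * (h' * ((h' - 1 + t) choose n))"
    by (simp only: sum_distrib_left[symmetric] binomial_convolution_first_moment)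
  also have "\<dots> = h * (h - 1) * ((h - 2 + t) choose n)"
    by (simp add: Suc algebra_simps)
  finally show ?thesis .
next
  case 0
  have "k * (k - 1) * (h choose k) = 0" for k by (cases k) (auto simp: 0)
  then show ?thesis by (simp add: 0)
qed

lemma hypergeometric_first_moment:
  assumes "1 \<le> n" "n \<le> s" "h \<le> s"
  shows "(\<Sum>k\<le>n. real k * hypergeometric_mass n s h k) = real n * real h / real s"
proof -
  obtain n' where n: "n = Suc n'" using assms by (cases n) auto
  obtain s' where s: "s = Suc s'" using assms by (cases s) auto
  have pos: "0 < s choose n" using assms by simp
  have "(\<Sum>k\<le>n. real k * hypergeometric_mass n s h k)
      = real (\<Sum>k\<le>n. k * (h choose k) * ((s - h) choose (n - k))) / real (s choose n)"
    unfolding hypergeometric_mass_def of_nat_sum sum_divide_distrib by (intro sum.cong) auto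
  also have "(\<Sum>k\<le>n. k * (h choose k) * ((s - h) choose (n - k))) = h * ((h - 1 + (s - h)) choose n')"
    unfolding n by (rule binomial_convolution_first_moment)
  also have "\<dots> = h * (s' choose n')"
    using assms s by (cases h) auto
  also have "real (h * (s' choose n')) / real (s choose n) = real n * real h / real s"
  proof -
    have "real n * real (s choose n) = real s * real (s' choose n')"
      using Suc_times_binomial[of n' s'] unfolding n s by (simp only: of_nat_mult[symmetric])
    then show ?thesis using pos s by (simp add: field_simps)
  qed
  finally show ?thesis .
qed

lemma hypergeometric_second_factorial_moment:
  assumes "1 \<le> n" "n \<le> s" "h \<le> s"
  shows "(\<Sum>k\<le>n. real k * (real k - 1) * hypergeometric_mass n s h k)
    = real n * (real n - 1) * (real h * (real h - 1) / (real s * (real s - 1)))"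
\<comment> \<open>A sample of size one has no pairs and both sides vanish; the case is separate
  because s may then be 1. Otherwise s \<ge> 2 and the denominator s(s-1) is nonzero.\<close>
proof (cases "n = 1")
  case True
  then show ?thesis by (simp add: sum.atMost_Suc)
next
  case False
  then obtain n' where n: "n = Suc (Suc n')" using assms by (cases n; cases "n - 1") auto
  then obtain s' where s: "s = Suc (Suc s')" using assms by (cases s; cases "s - 1") auto
  have pos: "0 < s choose n" using assms by simp
  have kk: "real (k * (k - 1)) = real k * (real k - 1)" for k :: nat by (cases k) (auto simp: algebra_simps)
  have "(\<Sum>k\<le>n. real k * (real k - 1) * hypergeometric_mass n s h k)
      = real (\<Sum>k\<le>n. k * (k - 1) * (h choose k) * ((s - h) choose (n - k))) / real (s choose n)"
    unfolding hypergeometric_mass_def of_nat_sum sum_divide_distrib kk[symmetric] by (intro sum.cong) auto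
  also have "(\<Sum>k\<le>n. k * (k - 1) * (h choose k) * ((s - h) choose (n - k)))
      = h * (h - 1) * ((h - 2 + (s - h)) choose n')"
    unfolding n by (rule binomial_convolution_second_moment)
  also have "\<dots> = h * (h - 1) * (s' choose n')"
  proof (cases "h \<le> 1")
    case False
    then have "h - 2 + (s - h) = s'" using assms s by simp
    then show ?thesis by simp
  qed (cases h, auto)
  also have "real (h * (h - 1) * (s' choose n')) / real (s choose n)
      = real n * (real n - 1) * (real h * (real h - 1) / (real s * (real s - 1)))"
  proof -
    have "n * (n - 1) * (s choose n) = s * (s - 1) * (s' choose n')"
    proof -
      have "n * (s choose n) = s * (Suc s' choose Suc n')"
        unfolding n s by (rule Suc_times_binomial)
      moreover have "(n - 1) * (Suc s' choose Suc n') = (s - 1) * (s' choose n')"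
        unfolding n s using Suc_times_binomial[of n' s'] by simp
      ultimately show ?thesis
        by (metis (no_types) mult.assoc mult.commute)
    qed
    then have "real n * (real n - 1) * real (s choose n) = real s * (real s - 1) * real (s' choose n')"
      unfolding kk[symmetric] of_nat_mult[symmetric] by simp
    moreover have "real s * (real s - 1) \<noteq> 0" by (simp add: s)
    moreover have "real (h * (h - 1) * (s' choose n')) = (real h * (real h - 1)) * real (s' choose n')"
      unfolding kk[symmetric] by simp
    moreover have "p * d / c = x * (p / q)" if "x * c = q * d" "q \<noteq> 0" "c \<noteq> 0" for p d c x q :: real
    proof -
      have d: "d = x * c / q" using that by (simp add: field_simps)
      show ?thesis unfolding d using that(3) by simp
    qed
    moreover have "real (s choose n) \<noteq> 0" using pos by simp
    ultimately show ?thesis by (simp only: not_False_eq_True)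
  qed
  finally show ?thesis .
qed

text \<open>The target is the discrete field on pairs. Since both components are countable, it is
  enough to check preimages of single pairs.\<close>

lemma measurable_pair_count_space_countable:
  fixes f :: "'w \<Rightarrow> 'a::countable" and g :: "'w \<Rightarrow> 'b::countable"
  assumes "f \<in> measurable M (count_space UNIV)" "g \<in> measurable M (count_space UNIV)"
  shows "(\<lambda>\<omega>. (f \<omega>, g \<omega>)) \<in> measurable M (count_space UNIV)"
proof (subst measurable_count_space_eq2_countable)
  have "(\<lambda>\<omega>. (f \<omega>, g \<omega>)) -` {(x, y)} \<inter> space M = (f -` {x} \<inter> space M) \<inter> (g -` {y} \<inter> space M)" for x y
    by auto
  moreover have "f -` {x} \<inter> space M \<in> sets M" "g -` {y} \<inter> space M \<in> sets M" for x y
    using assms by (auto intro: measurable_sets)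
  ultimately show "(\<lambda>\<omega>. (f \<omega>, g \<omega>)) \<in> space M \<rightarrow> UNIV
      \<and> (\<forall>a\<in>UNIV. (\<lambda>\<omega>. (f \<omega>, g \<omega>)) -` {a} \<inter> space M \<in> sets M)"
    by auto
qed

section \<open>A calculus of conditional expectations of bounded variables\<close>

context prob_space
begin

text \<open>Integrating the conditional probability over \<open>E\<close> gives the probability of
  the intersection. This is how support properties of conditional laws become almost sure statements
  about the variables.\<close>

lemma AE_notin_of_cond_prob_zero:
  assumes G: "subalgebra M G" and E: "E \<in> sets G" and D: "D \<in> sets M"
    and zero: "AE \<omega> in M. \<omega> \<in> E \<longrightarrow> real_cond_exp M G (indicat_real D) \<omega> = 0"
  shows "AE \<omega> in M. \<omega> \<in> E \<longrightarrow> \<omega> \<notin> D"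
proof -
  have EM: "E \<in> sets M" using E G by (auto simp: subalgebra_def)
  have int: "integrable M (indicat_real D)"
    using D by (auto simp: integrable_indicator_iff emeasure_eq_measure)
  have "prob (E \<inter> D) = (\<integral>\<omega>. indicator (E \<inter> D) \<omega> \<partial>M)" using EM D by simp
  also have "\<dots> = (\<integral>\<omega>\<in>E. indicator D \<omega> \<partial>M)"
    by (simp add: set_lebesgue_integral_def indicator_inter_arith)
  also have "\<dots> = (\<integral>\<omega>\<in>E. real_cond_exp M G (indicat_real D) \<omega> \<partial>M)"
    by (rule sigma_finite_subalgebra.real_cond_exp_intA[OF sigma_finite_subalgebraI[OF G] int E])
  also have "\<dots> = (\<integral>\<omega>. 0 \<partial>M)"
    unfolding set_lebesgue_integral_def
  proof (rule integral_cong_AE)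
    show "AE \<omega> in M. indicat_real E \<omega> *\<^sub>R real_cond_exp M G (indicat_real D) \<omega> = 0"
      using zero by eventually_elim (auto simp: indicator_def)
  qed (use EM in measurable)
  finally have "AE \<omega> in M. \<omega> \<notin> E \<inter> D"
    using prob_eq_0[of "E \<inter> D"] EM D by simp
  then show ?thesis by eventually_elim auto
qed

text \<open>Over an event of \<open>G\<close> the integral of \<open>f\<close> factorises by
  independence, exactly as the integral of the constant \<open>expectation f\<close> does.\<close>

lemma cond_exp_indep:
  assumes G: "subalgebra M G" and indep: "indep_set (sets I) (sets G)" and I: "subalgebra M I"
    and f: "f \<in> borel_measurable I" and int: "integrable M f"
  shows "AE \<omega> in M. real_cond_exp M G f \<omega> = expectation f"
proof (rule sigma_finite_subalgebra.real_cond_exp_charact[OF sigma_finite_subalgebraI[OF G]])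
  fix D assume D: "D \<in> sets G"
  have DM: "D \<in> sets M" using D G by (auto simp: subalgebra_def)
  have fM: "f \<in> borel_measurable M" by (rule measurable_from_subalg[OF I f])
  have iD: "integrable M (indicat_real D)"
    using DM by (auto simp: integrable_indicator_iff emeasure_eq_measure)
  have sI: "space I = space M" and sG: "space G = space M" using I G by (auto simp: subalgebra_def)
  have "indep_var borel f borel (indicat_real D)"
    unfolding indep_var_eq
  proof (intro conjI)
    show "indep_set (sigma_sets (space M) {f -` A \<inter> space M |A. A \<in> sets borel})
      (sigma_sets (space M) {indicat_real D -` A \<inter> space M |A. A \<in> sets borel})"
      unfolding indep_set_def
    proof (rule indep_sets_mono_sets[OF indep[unfolded indep_set_def]])
      have "sigma_sets (space M) {f -` A \<inter> space M |A. A \<in> sets borel} \<subseteq> sets I"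
        using measurable_sets[OF f] unfolding sI[symmetric] by (intro sets.sigma_sets_subset) auto
      moreover have "sigma_sets (space M) {indicat_real D -` A \<inter> space M |A. A \<in> sets borel} \<subseteq> sets G"
        using measurable_sets[OF borel_measurable_indicator[OF D]] unfolding sG[symmetric]
        by (intro sets.sigma_sets_subset) auto
      ultimately show "(case i of True \<Rightarrow> sigma_sets (space M) {f -` A \<inter> space M |A. A \<in> sets borel}
          | False \<Rightarrow> sigma_sets (space M) {indicat_real D -` A \<inter> space M |A. A \<in> sets borel})
        \<subseteq> (case i of True \<Rightarrow> sets I | False \<Rightarrow> sets G)" for i
        by (cases i) auto
    qed
  qed (use fM DM in measurable)
  from indep_var_lebesgue_integral[OF this int iD]
  show "(\<integral>\<omega>\<in>D. f \<omega> \<partial>M) = (\<integral>\<omega>\<in>D. expectation f \<partial>M)"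
    using DM by (simp add: set_lebesgue_integral_def mult.commute)
qed (use int in auto)

text \<open>Measurability, essential boundedness and the value of the conditional expectation are
  carried together: boundedness survives products, which integrability does not. The value
  \<open>g\<close> is any almost sure version, so it need not be measurable for \<open>G\<close>
  itself.\<close>

definition bounded_cexp :: "'a measure \<Rightarrow> ('a \<Rightarrow> real) \<Rightarrow> ('a \<Rightarrow> real) \<Rightarrow> bool" where
  "bounded_cexp G f g \<longleftrightarrow> f \<in> borel_measurable M \<and> (\<exists>K. AE \<omega> in M. \<bar>f \<omega>\<bar> \<le> K)
    \<and> (AE \<omega> in M. real_cond_exp M G f \<omega> = g \<omega>)"

lemma bounded_cexpD:
  assumes "bounded_cexp G f g"
  shows "f \<in> borel_measurable M" "integrable M f" "AE \<omega> in M. real_cond_exp M G f \<omega> = g \<omega>"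
proof -
  obtain K where "AE \<omega> in M. norm (f \<omega>) \<le> K" using assms by (auto simp: bounded_cexp_def)
  with assms show "integrable M f"
    by (intro integrable_const_bound[where B=K]) (simp_all add: bounded_cexp_def)
qed (use assms in \<open>auto simp: bounded_cexp_def\<close>)

lemma bounded_cexpI:
  assumes "f \<in> borel_measurable M" "AE \<omega> in M. \<bar>f \<omega>\<bar> \<le> K" "AE \<omega> in M. real_cond_exp M G f \<omega> = g \<omega>"
  shows "bounded_cexp G f g"
  using assms by (auto simp: bounded_cexp_def)

lemma bounded_cexp_refl:
  assumes "f \<in> borel_measurable M" "AE \<omega> in M. \<bar>f \<omega>\<bar> \<le> K"
  shows "bounded_cexp G f (real_cond_exp M G f)"
  using assms by (auto simp: bounded_cexp_def)

lemma bounded_cexp_cong: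
  assumes "bounded_cexp G f g" "AE \<omega> in M. f \<omega> = f' \<omega>" "AE \<omega> in M. g \<omega> = g' \<omega>"
    "f' \<in> borel_measurable M" "subalgebra M G"
  shows "bounded_cexp G f' g'"
proof -
  obtain K where "AE \<omega> in M. \<bar>f \<omega>\<bar> \<le> K" using assms by (auto simp: bounded_cexp_def)
  then have "AE \<omega> in M. \<bar>f' \<omega>\<bar> \<le> K" using assms(2) by eventually_elim auto
  moreover have "AE \<omega> in M. real_cond_exp M G f \<omega> = real_cond_exp M G f' \<omega>"
    by (rule sigma_finite_subalgebra.real_cond_exp_cong[OF sigma_finite_subalgebraI[OF assms(5)] assms(2)])
      (use assms bounded_cexpD in auto)
  then have "AE \<omega> in M. real_cond_exp M G f' \<omega> = g' \<omega>"
    using assms(3) bounded_cexpD(3)[OF assms(1)] by eventually_elim auto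
  ultimately show ?thesis using assms(4) by (auto simp: bounded_cexp_def)
qed

lemma bounded_cexp_add:
  assumes "bounded_cexp G f g" "bounded_cexp G f' g'" "subalgebra M G"
  shows "bounded_cexp G (\<lambda>\<omega>. f \<omega> + f' \<omega>) (\<lambda>\<omega>. g \<omega> + g' \<omega>)"
proof -
  obtain K K' where "AE \<omega> in M. \<bar>f \<omega>\<bar> \<le> K" "AE \<omega> in M. \<bar>f' \<omega>\<bar> \<le> K'"
    using assms by (auto simp: bounded_cexp_def)
  then have "AE \<omega> in M. \<bar>f \<omega> + f' \<omega>\<bar> \<le> K + K'" by eventually_elim auto
  moreover have "AE \<omega> in M. real_cond_exp M G (\<lambda>\<omega>. f \<omega> + f' \<omega>) \<omega> = g \<omega> + g' \<omega>"
    using sigma_finite_subalgebra.real_cond_exp_add[OF sigma_finite_subalgebraI[OF assms(3)]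
        bounded_cexpD(2)[OF assms(1)] bounded_cexpD(2)[OF assms(2)]]
      bounded_cexpD(3)[OF assms(1)] bounded_cexpD(3)[OF assms(2)]
    by eventually_elim auto
  ultimately show ?thesis
    using assms by (intro bounded_cexpI[where K="K + K'"]) (auto simp: bounded_cexp_def)
qed

lemma bounded_cexp_mult:
  assumes fg: "bounded_cexp G f g" and G: "subalgebra M G"
    and u: "u \<in> borel_measurable G" and ub: "AE \<omega> in M. \<bar>u \<omega>\<bar> \<le> L"
  shows "bounded_cexp G (\<lambda>\<omega>. u \<omega> * f \<omega>) (\<lambda>\<omega>. u \<omega> * g \<omega>)"
proof -
  obtain K where "AE \<omega> in M. \<bar>f \<omega>\<bar> \<le> K"
    using fg by (auto simp: bounded_cexp_def)
  with ub have b: "AE \<omega> in M. \<bar>u \<omega> * f \<omega>\<bar> \<le> L * K"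
  proof eventually_elim
    case (elim \<omega>)
    then have "0 \<le> L" "0 \<le> K" by linarith+
    with elim show ?case by (auto simp: abs_mult intro!: mult_mono)
  qed
  note fM [measurable] = bounded_cexpD(1)[OF fg] and uM [measurable] = measurable_from_subalg[OF G u]
  have "integrable M (\<lambda>\<omega>. u \<omega> * f \<omega>)"
    by (rule integrable_const_bound[where B="L * K"]) (use b in auto)
  from sigma_finite_subalgebra.real_cond_exp_mult[OF sigma_finite_subalgebraI[OF G] u fM this]
    bounded_cexpD(3)[OF fg]
  have "AE \<omega> in M. real_cond_exp M G (\<lambda>\<omega>. u \<omega> * f \<omega>) \<omega> = u \<omega> * g \<omega>"
    by eventually_elim auto
  then show ?thesis using b by (intro bounded_cexpI) auto
qed

lemma bounded_cexp_cmult: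
  assumes "bounded_cexp G f g" "subalgebra M G"
  shows "bounded_cexp G (\<lambda>\<omega>. c * f \<omega>) (\<lambda>\<omega>. c * g \<omega>)"
  using assms by (rule bounded_cexp_mult[where L="\<bar>c\<bar>"]) auto

lemma bounded_cexp_diff:
  assumes "bounded_cexp G f g" "bounded_cexp G f' g'" "subalgebra M G"
  shows "bounded_cexp G (\<lambda>\<omega>. f \<omega> - f' \<omega>) (\<lambda>\<omega>. g \<omega> - g' \<omega>)"
  using bounded_cexp_add[OF assms(1) bounded_cexp_cmult[OF assms(2), where c="-1"]] assms by simp

lemma bounded_cexp_sum:
  assumes "finite I" "\<And>i. i \<in> I \<Longrightarrow> bounded_cexp G (f i) (g i)" "subalgebra M G"
  shows "bounded_cexp G (\<lambda>\<omega>. \<Sum>i\<in>I. f i \<omega>) (\<lambda>\<omega>. \<Sum>i\<in>I. g i \<omega>)"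
  using assms(1,2)
proof (induction I)
  case empty
  have "AE \<omega> in M. real_cond_exp M G (\<lambda>_. 0) \<omega> = 0"
    by (rule sigma_finite_subalgebra.real_cond_exp_F_meas[OF sigma_finite_subalgebraI[OF assms(3)]]) auto
  then show ?case by (auto intro!: bounded_cexpI[where K=0])
next
  case (insert i I)
  then show ?case using bounded_cexp_add[OF _ _ assms(3)] by simp
qed

lemma AE_notin_of_cond_distribution:
  assumes cd: "cond_distribution M G (count_space UNIV) Y \<kappa>"
    and G: "subalgebra M G" and E: "E \<in> sets G" and Y: "Y \<in> measurable M (count_space UNIV)"
    and zero: "AE \<omega> in M. \<omega> \<in> E \<longrightarrow> measure (\<kappa> \<omega>) D = 0"
  shows "AE \<omega> in M. \<omega> \<in> E \<longrightarrow> Y \<omega> \<notin> D"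
proof -
  have DM: "Y -` D \<inter> space M \<in> sets M" by (rule measurable_sets[OF Y]) simp
  have "AE \<omega> in M. real_cond_exp M G (indicat_real (Y -` D \<inter> space M)) \<omega>
      = real_cond_exp M G (\<lambda>\<omega>. indicat_real D (Y \<omega>)) \<omega>"
  proof (rule sigma_finite_subalgebra.real_cond_exp_cong[OF sigma_finite_subalgebraI[OF G]])
    show "(\<lambda>\<omega>. indicat_real D (Y \<omega>)) \<in> borel_measurable M"
      by (rule measurable_compose[OF Y]) simp
  qed (use DM in \<open>auto simp: indicator_def\<close>)
  moreover have "AE \<omega> in M. measure (\<kappa> \<omega>) D = real_cond_exp M G (\<lambda>\<omega>. indicat_real D (Y \<omega>)) \<omega>"
    using cd by (auto simp: cond_distribution_def)
  ultimately have "AE \<omega> in M. \<omega> \<in> E \<longrightarrow> real_cond_exp M G (indicat_real (Y -` D \<inter> space M)) \<omega> = 0"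
    using zero by eventually_elim auto
  from AE_notin_of_cond_prob_zero[OF G E DM this] AE_space show ?thesis
    by eventually_elim auto
qed

lemma bounded_cexp_tower:
  assumes fg: "bounded_cexp G f g" and gk: "bounded_cexp G' g k"
    and G: "subalgebra M G" "subalgebra G G'"
  shows "bounded_cexp G' f k"
proof -
  have G': "subalgebra M G'" using G by (auto simp: subalgebra_def)
  obtain K where "AE \<omega> in M. \<bar>f \<omega>\<bar> \<le> K" using fg by (auto simp: bounded_cexp_def)
  moreover have "AE \<omega> in M. real_cond_exp M G' (real_cond_exp M G f) \<omega> = real_cond_exp M G' g \<omega>"
    using bounded_cexpD[OF fg] bounded_cexpD(1)[OF gk]
    by (intro sigma_finite_subalgebra.real_cond_exp_cong[OF sigma_finite_subalgebraI[OF G']]) auto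
  moreover have "AE \<omega> in M. real_cond_exp M G' (real_cond_exp M G f) \<omega> = real_cond_exp M G' f \<omega>"
    by (rule sigma_finite_subalgebra.real_cond_exp_nested_subalg[OF sigma_finite_subalgebraI[OF G'] G bounded_cexpD(2)[OF fg]])
  then have "AE \<omega> in M. real_cond_exp M G' f \<omega> = k \<omega>"
    using calculation(2) bounded_cexpD(3)[OF gk] by eventually_elim simp
  ultimately show ?thesis
    using bounded_cexpD(1)[OF fg] by (intro bounded_cexpI[where K=K])
qed

end

subsection \<open>Conditional moments of a draw\<close>

context urn_model
begin

lemma urn_history_Suc:
  "urn_history N X A B (Suc n) \<omega> = urn_history N X A B n \<omega> @ [(N (Suc n) \<omega>, X (Suc n) \<omega>, A (Suc n) \<omega>, B (Suc n) \<omega>)]"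
  by (simp add: urn_history_def)

lemma urn_history_measurable: "urn_history N X A B n \<in> measurable M (count_space UNIV)"
proof (induction n)
  case 0
  then show ?case by (simp add: urn_history_def[abs_def])
next
  case (Suc n)
  let ?p = "\<lambda>\<omega>. (urn_history N X A B n \<omega>, N (Suc n) \<omega>, X (Suc n) \<omega>, A (Suc n) \<omega>, B (Suc n) \<omega>)"
  have p: "?p \<in> measurable M (count_space UNIV)"
    by (intro measurable_pair_count_space_countable Suc random_variables) auto
  have eq: "urn_history N X A B (Suc n) = (\<lambda>\<omega>. (case ?p \<omega> of (l, x) \<Rightarrow> l @ [x]))"
    by (rule ext) (simp add: urn_history_Suc)
  show ?case
    unfolding eq by (rule measurable_compose[OF p]) simp
qed

sublocale countable_filtration M "urn_history N X A B"
  by unfold_locales (use urn_history_measurable urn_history_Suc in auto)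

text \<open>Step n+1 is resolved through two intermediate fields. The law of \<open>X\<close> is
  hypergeometric once the sample size is known, and the reinforcements are independent of everything
  up to and including the draw; the tower property then returns to \<open>past\<close>.\<close>

abbreviation before_draw :: "nat \<Rightarrow> 'w measure" where
  "before_draw n \<equiv> generated_field M (\<lambda>\<omega>. (urn_history N X A B n \<omega>, N (Suc n) \<omega>))"

abbreviation after_draw :: "nat \<Rightarrow> 'w measure" where
  "after_draw n \<equiv> generated_field M (\<lambda>\<omega>. (urn_history N X A B n \<omega>, N (Suc n) \<omega>, X (Suc n) \<omega>))"

abbreviation past :: "nat \<Rightarrow> 'w measure" where
  "past n \<equiv> generated_field M (urn_history N X A B n)"

abbreviation H :: "nat \<Rightarrow> 'w \<Rightarrow> real" where "H n \<omega> \<equiv> real (urn_H a X A n \<omega>)"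
abbreviation S :: "nat \<Rightarrow> 'w \<Rightarrow> real" where "S n \<omega> \<equiv> real (urn_S a b N X A B n \<omega>)"
abbreviation Z :: "nat \<Rightarrow> 'w \<Rightarrow> real" where "Z n \<omega> \<equiv> urn_Z a b N X A B n \<omega>"

lemma subalgebra_before_draw: "subalgebra M (before_draw n)"
  by (intro subalgebra_generated_field measurable_pair_count_space_countable
      urn_history_measurable random_variables) auto

lemma subalgebra_after_draw: "subalgebra M (after_draw n)"
  by (intro subalgebra_generated_field measurable_pair_count_space_countable
      urn_history_measurable random_variables) auto

lemma subalgebra_past_before: "subalgebra (before_draw n) (past n)"
  by (rule subalgebra_generated_field_mono) auto

lemma subalgebra_past_after: "subalgebra (after_draw n) (past n)"
  by (rule subalgebra_generated_field_mono) auto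

lemma real_random_variables [measurable]:
  "(\<lambda>\<omega>. real (N (Suc n) \<omega>)) \<in> borel_measurable M" "(\<lambda>\<omega>. real (X (Suc n) \<omega>)) \<in> borel_measurable M"
  "(\<lambda>\<omega>. real (A (Suc n) \<omega>)) \<in> borel_measurable M" "(\<lambda>\<omega>. real (B (Suc n) \<omega>)) \<in> borel_measurable M"
  using random_variables[of "Suc n"] by (auto intro: measurable_compose)

lemma urn_counts_cong:
  assumes "urn_history N X A B n \<omega> = urn_history N X A B n \<omega>'"
  shows "urn_H a X A n \<omega> = urn_H a X A n \<omega>'" "urn_S a b N X A B n \<omega> = urn_S a b N X A B n \<omega>'"
    "urn_Z a b N X A B n \<omega> = urn_Z a b N X A B n \<omega>'"
proof -
  have "N j \<omega> = N j \<omega>' \<and> X j \<omega> = X j \<omega>' \<and> A j \<omega> = A j \<omega>' \<and> B j \<omega> = B j \<omega>'" if "j \<in> {1..n}" for j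
  proof -
    have "j \<in> {1..<Suc n}" using that by auto
    then show ?thesis
      using assms unfolding urn_history_def map_eq_conv set_upt by blast
  qed
  then show 1: "urn_H a X A n \<omega> = urn_H a X A n \<omega>'" and "urn_S a b N X A B n \<omega> = urn_S a b N X A B n \<omega>'"
    by (auto simp: urn_H_def urn_S_def urn_K_def intro!: sum.cong)
  then show "urn_Z a b N X A B n \<omega> = urn_Z a b N X A B n \<omega>'"
    by (simp add: urn_Z_def)
qed

lemma past_measurable [measurable]:
  "H n \<in> borel_measurable (past n)" "S n \<in> borel_measurable (past n)" "Z n \<in> borel_measurable (past n)"
  "urn_S a b N X A B n \<in> measurable (past n) (count_space UNIV)"
proof -
  show "H n \<in> borel_measurable (past n)" "S n \<in> borel_measurable (past n)"
    by (rule measurable_generated_field, rule arg_cong[of _ _ real], erule urn_counts_cong, simp)+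
  show "Z n \<in> borel_measurable (past n)"
    "urn_S a b N X A B n \<in> measurable (past n) (count_space UNIV)"
    by (rule measurable_generated_field, erule urn_counts_cong, simp)+
qed

lemma urn_counts:
  "1 \<le> H n \<omega>" "H n \<omega> + 1 \<le> S n \<omega>" "0 \<le> Z n \<omega>" "Z n \<omega> \<le> 1" "urn_H a X A n \<omega> \<le> urn_S a b N X A B n \<omega>"
proof -
  have h: "1 \<le> urn_H a X A n \<omega>" "1 \<le> urn_K b N X B n \<omega>"
    using initial by (auto simp: urn_H_def urn_K_def)
  then show "1 \<le> H n \<omega>" "H n \<omega> + 1 \<le> S n \<omega>" "urn_H a X A n \<omega> \<le> urn_S a b N X A B n \<omega>"
    by (simp_all add: urn_S_def)
  then show "0 \<le> Z n \<omega>" "Z n \<omega> \<le> 1"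
    unfolding urn_Z_def by (auto simp: divide_le_eq_1)
qed

lemma sample_size_range: "AE \<omega> in M. 1 \<le> N (Suc n) \<omega> \<and> N (Suc n) \<omega> \<le> urn_S a b N X A B n \<omega>"
proof -
  obtain \<kappa> where cd: "cond_distribution M (past n) (count_space UNIV) (N (Suc n)) \<kappa>"
    and \<kappa>: "AE \<omega> in M. measure (\<kappa> \<omega>) {1..urn_S a b N X A B n \<omega>} = 1"
    using sample_size[of "Suc n"] by (auto simp: urn_filtration_def)
  have prob: "prob_space (\<kappa> \<omega>)" "sets (\<kappa> \<omega>) = UNIV" if "\<omega> \<in> space M" for \<omega>
  proof -
    have "\<kappa> \<in> measurable (past n) (prob_algebra (count_space UNIV))"
      using cd by (simp add: cond_distribution_def)
    from measurable_space[OF this, of \<omega>] that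
    show "prob_space (\<kappa> \<omega>)" "sets (\<kappa> \<omega>) = UNIV" by (auto simp: space_prob_algebra)
  qed
  \<comment> \<open>The range of the sample size is random, while a conditional distribution is
    evaluated at fixed sets. Splitting over the countably many values \<open>s\<close> of the urn
    size makes the set fixed on each piece.\<close>
  have "AE \<omega> in M. \<forall>s. \<omega> \<in> {\<omega>\<in>space M. urn_S a b N X A B n \<omega> = s} \<longrightarrow> N (Suc n) \<omega> \<notin> - {1..s}"
    unfolding AE_all_countable
  proof
    fix s
    show "AE \<omega> in M. \<omega> \<in> {\<omega>\<in>space M. urn_S a b N X A B n \<omega> = s} \<longrightarrow> N (Suc n) \<omega> \<notin> - {1..s}"
    proof (rule AE_notin_of_cond_distribution[OF cd sub])
      have "{\<omega>\<in>space (past n). urn_S a b N X A B n \<omega> = s} \<in> sets (past n)" by measurable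
      then show "{\<omega>\<in>space M. urn_S a b N X A B n \<omega> = s} \<in> sets (past n)" by simp
      show "N (Suc n) \<in> measurable M (count_space UNIV)" by (rule random_variables) simp
      show "AE \<omega> in M. \<omega> \<in> {\<omega>\<in>space M. urn_S a b N X A B n \<omega> = s} \<longrightarrow> measure (\<kappa> \<omega>) (- {1..s}) = 0"
        using \<kappa> AE_space
      proof eventually_elim
        case (elim \<omega>)
        interpret K: prob_space "\<kappa> \<omega>" using prob elim by auto
        have "space (\<kappa> \<omega>) = UNIV" using prob(2)[OF elim(2)] by (metis sets.sets_into_space UNIV_I top.extremum_uniqueI)
        then have "measure (\<kappa> \<omega>) (- {1..s}) = 1 - measure (\<kappa> \<omega>) {1..s}"
          using K.prob_compl[of "{1..s}"] prob(2)[OF elim(2)] by (simp add: Compl_eq_Diff_UNIV)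
        then show ?case using elim by auto
      qed
    qed
  qed
  then show ?thesis using AE_space by eventually_elim auto
qed

lemma sample_cond_distribution:
  obtains \<kappa> where "cond_distribution M (before_draw n) (count_space UNIV) (X (Suc n)) \<kappa>"
    "AE \<omega> in M. \<forall>k. measure (\<kappa> \<omega>) {k} =
      hypergeometric_mass (N (Suc n) \<omega>) (urn_S a b N X A B n \<omega>) (urn_H a X A n \<omega>) k"
  using sample[of "Suc n"] by auto

lemma sample_le: "AE \<omega> in M. X (Suc n) \<omega> \<le> N (Suc n) \<omega>"
proof -
  obtain \<kappa> where cd: "cond_distribution M (before_draw n) (count_space UNIV) (X (Suc n)) \<kappa>"
    and \<kappa>: "AE \<omega> in M. \<forall>k. measure (\<kappa> \<omega>) {k} =
      hypergeometric_mass (N (Suc n) \<omega>) (urn_S a b N X A B n \<omega>) (urn_H a X A n \<omega>) k"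
    by (rule sample_cond_distribution)
  have [measurable]: "N (Suc n) \<in> measurable (before_draw n) (count_space UNIV)"
    by (rule measurable_generated_field) auto
  \<comment> \<open>On the event that the sample size is below \<open>k\<close> the mass at
    \<open>k\<close> is zero by the guard in \<open>hypergeometric_mass\<close>; countably many
    \<open>k\<close> suffice.\<close>
  have "AE \<omega> in M. \<forall>k. \<omega> \<in> {\<omega>\<in>space M. N (Suc n) \<omega> < k} \<longrightarrow> X (Suc n) \<omega> \<notin> {k}"
    unfolding AE_all_countable
  proof
    fix k
    show "AE \<omega> in M. \<omega> \<in> {\<omega>\<in>space M. N (Suc n) \<omega> < k} \<longrightarrow> X (Suc n) \<omega> \<notin> {k}"
    proof (rule AE_notin_of_cond_distribution[OF cd subalgebra_before_draw])
      have "{\<omega>\<in>space (before_draw n). N (Suc n) \<omega> < k} \<in> sets (before_draw n)" by measurable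
      then show "{\<omega>\<in>space M. N (Suc n) \<omega> < k} \<in> sets (before_draw n)" by simp
      show "X (Suc n) \<in> measurable M (count_space UNIV)" by (rule random_variables) simp
      show "AE \<omega> in M. \<omega> \<in> {\<omega>\<in>space M. N (Suc n) \<omega> < k} \<longrightarrow> measure (\<kappa> \<omega>) {k} = 0"
        using \<kappa> by eventually_elim (auto simp: hypergeometric_mass_def)
    qed
  qed
  then show ?thesis using AE_space by eventually_elim (auto simp: not_le[symmetric])
qed

end

section \<open>Urns with bounded draws and equal mean reinforcements\<close>

locale bounded_urn = urn_model M a b N X A B
  for M :: "'w measure" and a b :: nat and N X A B :: "nat \<Rightarrow> 'w \<Rightarrow> nat" +
  fixes c :: nat and m :: "nat \<Rightarrow> real"
  assumes bounded: "\<And>n. n \<ge> 1 \<Longrightarrow> AE \<omega> in M. A n \<omega> \<le> c \<and> B n \<omega> \<le> c \<and> N n \<omega> \<le> c"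
    and mean_A: "\<And>n. n \<ge> 1 \<Longrightarrow> (\<integral>\<omega>. real (A n \<omega>) \<partial>M) = m n"
    and mean_B: "\<And>n. n \<ge> 1 \<Longrightarrow> (\<integral>\<omega>. real (B n \<omega>) \<partial>M) = m n"
begin

lemma AE_draws: "AE \<omega> in M. \<forall>n. 1 \<le> A (Suc n) \<omega> \<and> A (Suc n) \<omega> \<le> c \<and> 1 \<le> B (Suc n) \<omega> \<and> B (Suc n) \<omega> \<le> c
    \<and> 1 \<le> N (Suc n) \<omega> \<and> N (Suc n) \<omega> \<le> c \<and> X (Suc n) \<omega> \<le> N (Suc n) \<omega> \<and> N (Suc n) \<omega> \<le> urn_S a b N X A B n \<omega>"
  unfolding AE_all_countable
proof
  fix n
  show "AE \<omega> in M. 1 \<le> A (Suc n) \<omega> \<and> A (Suc n) \<omega> \<le> c \<and> 1 \<le> B (Suc n) \<omega> \<and> B (Suc n) \<omega> \<le> c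
    \<and> 1 \<le> N (Suc n) \<omega> \<and> N (Suc n) \<omega> \<le> c \<and> X (Suc n) \<omega> \<le> N (Suc n) \<omega> \<and> N (Suc n) \<omega> \<le> urn_S a b N X A B n \<omega>"
    using sample_size_range[of n] sample_le[of n] bounded[of "Suc n", OF le_add1[of 1 n, unfolded plus_1_eq_Suc]] AE_space
  proof eventually_elim
    case (elim \<omega>)
    then show ?case using reinforcement_positive[of "Suc n" \<omega>] by simp
  qed
qed

lemma AE_draw: "AE \<omega> in M. 1 \<le> A (Suc n) \<omega> \<and> A (Suc n) \<omega> \<le> c \<and> 1 \<le> B (Suc n) \<omega> \<and> B (Suc n) \<omega> \<le> c
    \<and> 1 \<le> N (Suc n) \<omega> \<and> N (Suc n) \<omega> \<le> c \<and> X (Suc n) \<omega> \<le> N (Suc n) \<omega> \<and> N (Suc n) \<omega> \<le> urn_S a b N X A B n \<omega>"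
  using AE_draws by eventually_elim blast

abbreviation q1 :: "nat \<Rightarrow> 'w \<Rightarrow> real" where
  "q1 n \<equiv> cexp n (\<lambda>\<omega>. real (N (Suc n) \<omega>))"
abbreviation q2 :: "nat \<Rightarrow> 'w \<Rightarrow> real" where
  "q2 n \<equiv> cexp n (\<lambda>\<omega>. (real (N (Suc n) \<omega>))\<^sup>2)"

text \<open>The probability that two balls drawn without replacement are both of color A; the limit
  of \<open>Z\<close> squared will take its place.\<close>

definition \<rho> :: "nat \<Rightarrow> 'w \<Rightarrow> real" where
  "\<rho> n \<omega> = H n \<omega> * (H n \<omega> - 1) / (S n \<omega> * (S n \<omega> - 1))"

lemma rho_measurable [measurable]: "\<rho> n \<in> borel_measurable (past n)"
  unfolding \<rho>_def by measurable

lemma rho_bounds: "0 \<le> \<rho> n \<omega>" "\<rho> n \<omega> \<le> 1"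
proof -
  note u = urn_counts[of n \<omega>]
  have "0 \<le> H n \<omega> * (H n \<omega> - 1)" using u by (intro mult_nonneg_nonneg) auto
  moreover have "H n \<omega> * (H n \<omega> - 1) \<le> S n \<omega> * (S n \<omega> - 1)" using u by (intro mult_mono) auto
  moreover have "0 < S n \<omega> * (S n \<omega> - 1)" using u by (intro mult_pos_pos) auto
  ultimately show "0 \<le> \<rho> n \<omega>" "\<rho> n \<omega> \<le> 1"
    unfolding \<rho>_def by (auto simp: divide_le_eq_1)
qed

text \<open>\<open>f (X (Suc n))\<close> is a combination of indicators of single values. The sum
  first runs to the deterministic bound \<open>c\<close>, so that linearity applies, and is then cut
  at the random sample size, beyond which the mass is zero.\<close>

lemma bounded_cexp_sample:
  fixes f :: "nat \<Rightarrow> real"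
  shows "bounded_cexp (before_draw n) (\<lambda>\<omega>. f (X (Suc n) \<omega>))
    (\<lambda>\<omega>. \<Sum>k\<le>N (Suc n) \<omega>. f k * hypergeometric_mass (N (Suc n) \<omega>) (urn_S a b N X A B n \<omega>) (urn_H a X A n \<omega>) k)"
proof -
  let ?g = "\<lambda>k \<omega>. hypergeometric_mass (N (Suc n) \<omega>) (urn_S a b N X A B n \<omega>) (urn_H a X A n \<omega>) k"
  have XM: "X (Suc n) \<in> measurable M (count_space UNIV)" by (rule random_variables) simp
  obtain \<kappa> where cd: "cond_distribution M (before_draw n) (count_space UNIV) (X (Suc n)) \<kappa>"
    and \<kappa>: "AE \<omega> in M. \<forall>k. measure (\<kappa> \<omega>) {k} = ?g k \<omega>"
    by (rule sample_cond_distribution)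
  have "bounded_cexp (before_draw n) (\<lambda>\<omega>. indicat_real {k} (X (Suc n) \<omega>)) (?g k)" for k
  proof (rule bounded_cexpI)
    show "(\<lambda>\<omega>. indicat_real {k} (X (Suc n) \<omega>)) \<in> borel_measurable M"
      by (rule measurable_compose[OF XM]) simp
    show "AE \<omega> in M. \<bar>indicat_real {k} (X (Suc n) \<omega>)\<bar> \<le> 1" by (simp add: indicator_def)
    have "AE \<omega> in M. measure (\<kappa> \<omega>) {k} = real_cond_exp M (before_draw n) (\<lambda>\<omega>. indicat_real {k} (X (Suc n) \<omega>)) \<omega>"
      using cd by (auto simp: cond_distribution_def)
    with \<kappa> show "AE \<omega> in M. real_cond_exp M (before_draw n) (\<lambda>\<omega>. indicat_real {k} (X (Suc n) \<omega>)) \<omega> = ?g k \<omega>"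
      by eventually_elim auto
  qed
  then have "bounded_cexp (before_draw n) (\<lambda>\<omega>. \<Sum>k\<le>c. f k * indicat_real {k} (X (Suc n) \<omega>)) (\<lambda>\<omega>. \<Sum>k\<le>c. f k * ?g k \<omega>)"
    by (intro bounded_cexp_sum bounded_cexp_cmult subalgebra_before_draw) auto
  then show ?thesis
  proof (rule bounded_cexp_cong)
    show "AE \<omega> in M. (\<Sum>k\<le>c. f k * indicat_real {k} (X (Suc n) \<omega>)) = f (X (Suc n) \<omega>)"
      using AE_draw[of n]
    proof eventually_elim
      case (elim \<omega>)
      have "(\<Sum>k\<le>c. f k * indicat_real {k} (X (Suc n) \<omega>)) = (\<Sum>k\<le>c. if k = X (Suc n) \<omega> then f k else 0)"
        by (intro sum.cong) (auto simp: indicator_def)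
      then show ?case using elim by simp
    qed
    show "AE \<omega> in M. (\<Sum>k\<le>c. f k * ?g k \<omega>) = (\<Sum>k\<le>N (Suc n) \<omega>. f k * ?g k \<omega>)"
      using AE_draw[of n]
      by eventually_elim (intro sum.mono_neutral_right, auto simp: hypergeometric_mass_def)
    show "(\<lambda>\<omega>. f (X (Suc n) \<omega>)) \<in> borel_measurable M"
      by (rule measurable_compose[OF XM]) simp
  qed (rule subalgebra_before_draw)
qed

lemma cexp_X_before: "bounded_cexp (before_draw n) (\<lambda>\<omega>. real (X (Suc n) \<omega>)) (\<lambda>\<omega>. Z n \<omega> * real (N (Suc n) \<omega>))"
proof (rule bounded_cexp_cong[OF bounded_cexp_sample _ _ _ subalgebra_before_draw])
  show "AE \<omega> in M. (\<Sum>k\<le>N (Suc n) \<omega>. real k * hypergeometric_mass (N (Suc n) \<omega>) (urn_S a b N X A B n \<omega>) (urn_H a X A n \<omega>) k)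
      = Z n \<omega> * real (N (Suc n) \<omega>)"
    using AE_draw[of n]
  proof eventually_elim
    case (elim \<omega>)
    show ?case
      by (subst hypergeometric_first_moment) (use elim urn_counts in \<open>auto simp: urn_Z_def\<close>)
  qed
qed auto

text \<open>X^2 = X + X(X-1): the first part gives \<open>Z n\<close> times the sample size, the
  second the factorial moment with \<open>\<rho> n\<close>.\<close>

lemma cexp_X2_before: "bounded_cexp (before_draw n) (\<lambda>\<omega>. (real (X (Suc n) \<omega>))\<^sup>2)
   (\<lambda>\<omega>. Z n \<omega> * real (N (Suc n) \<omega>) + \<rho> n \<omega> * ((real (N (Suc n) \<omega>))\<^sup>2 - real (N (Suc n) \<omega>)))"
proof (rule bounded_cexp_cong[OF bounded_cexp_sample[of n "\<lambda>k. (real k)\<^sup>2"] _ _ _ subalgebra_before_draw])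
  show "AE \<omega> in M. (\<Sum>k\<le>N (Suc n) \<omega>. (real k)\<^sup>2 * hypergeometric_mass (N (Suc n) \<omega>) (urn_S a b N X A B n \<omega>) (urn_H a X A n \<omega>) k)
      = Z n \<omega> * real (N (Suc n) \<omega>) + \<rho> n \<omega> * ((real (N (Suc n) \<omega>))\<^sup>2 - real (N (Suc n) \<omega>))"
    using AE_draw[of n]
  proof eventually_elim
    case (elim \<omega>)
    let ?g = "hypergeometric_mass (N (Suc n) \<omega>) (urn_S a b N X A B n \<omega>) (urn_H a X A n \<omega>)"
    have "(\<Sum>k\<le>N (Suc n) \<omega>. (real k)\<^sup>2 * ?g k)
      = (\<Sum>k\<le>N (Suc n) \<omega>. real k * ?g k) + (\<Sum>k\<le>N (Suc n) \<omega>. real k * (real k - 1) * ?g k)"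
      unfolding sum.distrib[symmetric] by (intro sum.cong) (auto simp: power2_eq_square algebra_simps)
    also have "(\<Sum>k\<le>N (Suc n) \<omega>. real k * ?g k) = Z n \<omega> * real (N (Suc n) \<omega>)"
      by (subst hypergeometric_first_moment) (use elim urn_counts in \<open>auto simp: urn_Z_def\<close>)
    also have "(\<Sum>k\<le>N (Suc n) \<omega>. real k * (real k - 1) * ?g k) = \<rho> n \<omega> * ((real (N (Suc n) \<omega>))\<^sup>2 - real (N (Suc n) \<omega>))"
      by (subst hypergeometric_second_factorial_moment)
        (use elim urn_counts in \<open>auto simp: \<rho>_def power2_eq_square algebra_simps\<close>)
    finally show ?case .
  qed
qed auto

lemma abs_Z_le: "AE \<omega> in M. \<bar>Z n \<omega>\<bar> \<le> 1"
  using urn_counts(3,4) by simp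

lemma abs_rho_le: "AE \<omega> in M. \<bar>\<rho> n \<omega>\<bar> \<le> 1"
  using rho_bounds by simp

lemma abs_N_le: "AE \<omega> in M. \<bar>real (N (Suc n) \<omega>)\<bar> \<le> real c"
  using AE_draw[of n] by eventually_elim simp

lemma abs_N2_le: "AE \<omega> in M. \<bar>(real (N (Suc n) \<omega>))\<^sup>2\<bar> \<le> (real c)\<^sup>2"
  using AE_draw[of n] by eventually_elim (simp add: power_mono)

lemma cexp_N: "bounded_cexp (past n) (\<lambda>\<omega>. real (N (Suc n) \<omega>)) (q1 n)"
  by (rule bounded_cexp_refl[OF _ abs_N_le]) simp

lemma cexp_N2: "bounded_cexp (past n) (\<lambda>\<omega>. (real (N (Suc n) \<omega>))\<^sup>2) (q2 n)"
  by (rule bounded_cexp_refl[OF _ abs_N2_le]) measurable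

lemma cexp_X: "bounded_cexp (past n) (\<lambda>\<omega>. real (X (Suc n) \<omega>)) (\<lambda>\<omega>. Z n \<omega> * q1 n \<omega>)"
  by (rule bounded_cexp_tower[OF cexp_X_before _ subalgebra_before_draw subalgebra_past_before])
    (rule bounded_cexp_mult[OF cexp_N sub _ abs_Z_le], measurable)

lemma cexp_X2: "bounded_cexp (past n) (\<lambda>\<omega>. (real (X (Suc n) \<omega>))\<^sup>2)
    (\<lambda>\<omega>. Z n \<omega> * q1 n \<omega> + \<rho> n \<omega> * (q2 n \<omega> - q1 n \<omega>))"
  by (rule bounded_cexp_tower[OF cexp_X2_before _ subalgebra_before_draw subalgebra_past_before],
      rule bounded_cexp_add[OF bounded_cexp_mult[OF cexp_N sub _ abs_Z_le]
        bounded_cexp_mult[OF bounded_cexp_diff[OF cexp_N2 cexp_N sub] sub _ abs_rho_le] sub]) measurable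

lemma cexp_NX: "bounded_cexp (past n) (\<lambda>\<omega>. real (N (Suc n) \<omega>) * real (X (Suc n) \<omega>)) (\<lambda>\<omega>. Z n \<omega> * q2 n \<omega>)"
proof -
  have [measurable]: "(\<lambda>\<omega>. real (N (Suc n) \<omega>)) \<in> borel_measurable (before_draw n)"
    by (rule measurable_generated_field) auto
  have "bounded_cexp (before_draw n) (\<lambda>\<omega>. real (N (Suc n) \<omega>) * real (X (Suc n) \<omega>))
      (\<lambda>\<omega>. real (N (Suc n) \<omega>) * (Z n \<omega> * real (N (Suc n) \<omega>)))"
    by (rule bounded_cexp_mult[OF cexp_X_before subalgebra_before_draw _ abs_N_le]) measurable
  moreover have "bounded_cexp (past n) (\<lambda>\<omega>. real (N (Suc n) \<omega>) * (Z n \<omega> * real (N (Suc n) \<omega>))) (\<lambda>\<omega>. Z n \<omega> * q2 n \<omega>)"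
  proof (rule bounded_cexp_cong[OF bounded_cexp_mult[OF cexp_N2 sub _ abs_Z_le] _ _ _ sub])
    have "Z n \<in> borel_measurable M" by (rule measurable_F_M) measurable
    then show "(\<lambda>\<omega>. real (N (Suc n) \<omega>) * (Z n \<omega> * real (N (Suc n) \<omega>))) \<in> borel_measurable M" by measurable
  qed (auto simp: power2_eq_square)
  ultimately show ?thesis
    by (rule bounded_cexp_tower[OF _ _ subalgebra_before_draw subalgebra_past_before])
qed

text \<open>Conditioning on \<open>after_draw\<close> replaces the reinforcement factor by its mean,
  because \<open>q\<close> is already known there; the tower property then leaves only the
  conditional mean of \<open>q\<close>.\<close>

lemma reinforcement_factor:
  fixes f :: "nat \<Rightarrow> nat \<Rightarrow> real"
  assumes f: "AE \<omega> in M. \<bar>f (A (Suc n) \<omega>) (B (Suc n) \<omega>)\<bar> \<le> K"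
    and q: "q \<in> borel_measurable (after_draw n)" and qb: "AE \<omega> in M. \<bar>q \<omega>\<bar> \<le> K'"
    and qg: "bounded_cexp (past n) q g"
  shows "bounded_cexp (past n) (\<lambda>\<omega>. q \<omega> * f (A (Suc n) \<omega>) (B (Suc n) \<omega>))
    (\<lambda>\<omega>. (\<integral>\<omega>. f (A (Suc n) \<omega>) (B (Suc n) \<omega>) \<partial>M) * g \<omega>)"
proof -
  let ?I = "generated_field M (\<lambda>\<omega>. (A (Suc n) \<omega>, B (Suc n) \<omega>))"
  let ?f = "\<lambda>\<omega>. f (A (Suc n) \<omega>) (B (Suc n) \<omega>)"
  have I: "subalgebra M ?I"
    by (intro subalgebra_generated_field measurable_pair_count_space_countable random_variables) auto
  have fI: "?f \<in> borel_measurable ?I" by (rule measurable_generated_field) auto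
  have fM: "?f \<in> borel_measurable M" by (rule measurable_from_subalg[OF I fI])
  have int: "integrable M ?f" by (rule integrable_AE_bounded[OF fM, of K]) (use f in simp)
  have "AE \<omega> in M. real_cond_exp M (after_draw n) ?f \<omega> = expectation ?f"
    using reinforcement_indep[of "Suc n"] by (intro cond_exp_indep[OF subalgebra_after_draw _ I fI int]) simp
  then have "bounded_cexp (after_draw n) ?f (\<lambda>_. expectation ?f)"
    using f fM by (intro bounded_cexpI) auto
  from bounded_cexp_mult[OF this subalgebra_after_draw q qb]
  have "bounded_cexp (after_draw n) (\<lambda>\<omega>. q \<omega> * ?f \<omega>) (\<lambda>\<omega>. q \<omega> * expectation ?f)" .
  moreover have "bounded_cexp (past n) (\<lambda>\<omega>. q \<omega> * expectation ?f) (\<lambda>\<omega>. expectation ?f * g \<omega>)"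
    using bounded_cexp_cmult[OF qg sub, of "expectation ?f"] by (simp add: mult.commute)
  ultimately show ?thesis
    by (rule bounded_cexp_tower[OF _ _ subalgebra_after_draw subalgebra_past_after])
qed

end

subsection \<open>Asymptotics of the urn\<close>

lemma urn_proportion_step:
  fixes h s u v :: real
  assumes "0 < s" "0 \<le> u" "0 \<le> v"
  shows "(h + u) / (s + (u + v)) - h / s = (u * (1 - h / s) - h / s * v) / (s + (u + v))"
proof -
  have "0 < s + (u + v)" using assms by linarith
  then have "(h + u) / (s + (u + v)) - h / s = (h + u - h / s * (s + (u + v))) / (s + (u + v))"
    by (simp add: diff_divide_distrib)
  also have "h + u - h / s * (s + (u + v)) = u * (1 - h / s) - h / s * v"
    using assms(1) by (simp add: field_simps)
  finally show ?thesis .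
qed

lemma urn_numerator_bound:
  fixes u v z K :: real
  assumes "0 \<le> u" "0 \<le> v" "u + v \<le> K" "0 \<le> z" "z \<le> 1"
  shows "\<bar>u * (1 - z) - z * v\<bar> \<le> K"
proof -
  have "0 \<le> u * (1 - z)" "0 \<le> z * v" using assms by auto
  moreover have "u * (1 - z) \<le> u" using assms by (simp add: mult_left_le)
  moreover have "z * v \<le> v" using assms by (simp add: mult_left_le_one_le)
  ultimately show ?thesis using assms by linarith
qed

text \<open>Used with r = n+1, s = S_n and d the number of added balls. The new total s + d is
  correlated with the numerator p, so it is replaced by s, which is known in advance. The cost is
  O(1/n^2) for the increment and O(1/n) for its square scaled by r(r+1).\<close>

lemma urn_increment_bounds:
  fixes p s d K r :: real
  assumes p: "\<bar>p\<bar> \<le> K" and d: "0 \<le> d" "d \<le> K" and r: "0 < r" and s: "r + 1 \<le> s"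
  shows "\<bar>p / (s + d)\<bar> \<le> K / r"
    and "\<bar>p / (s + d) - p / s\<bar> \<le> K\<^sup>2 / (r * (r + 1))"
    and "r * (r + 1) * (p / (s + d))\<^sup>2 \<le> K\<^sup>2"
    and "\<bar>r * (r + 1) * ((p / (s + d))\<^sup>2 - (p / s)\<^sup>2)\<bar> \<le> 2 * K ^ 3 / (r + 1)"
proof -
  have s0: "0 < s" "0 < s + d" "r + 1 \<le> s + d" using assms by linarith+
  have K0: "0 \<le> K" using d by linarith
  show "\<bar>p / (s + d)\<bar> \<le> K / r"
    unfolding abs_divide using p s0 r K0 by (intro frac_le) auto
  have "p / (s + d) - p / s = - (p * d) / (s * (s + d))"
    using s0 by (simp add: field_simps)
  then have "\<bar>p / (s + d) - p / s\<bar> = \<bar>p\<bar> * d / (s * (s + d))"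
    using s0 d by (simp add: abs_mult)
  also have "\<dots> \<le> K\<^sup>2 / (r * (r + 1))"
    unfolding power2_eq_square using p d s0 s r K0 by (intro frac_le mult_mono mult_pos_pos mult_nonneg_nonneg) auto
  finally show "\<bar>p / (s + d) - p / s\<bar> \<le> K\<^sup>2 / (r * (r + 1))" .
  have p2: "p\<^sup>2 \<le> K\<^sup>2" using p by (intro abs_le_square_iff[THEN iffD1]) simp
  have rr: "r * (r + 1) \<le> (s + d)\<^sup>2"
    unfolding power2_eq_square using s0 r by (intro mult_mono) auto
  have "r * (r + 1) * p\<^sup>2 \<le> (s + d)\<^sup>2 * K\<^sup>2"
    using rr p2 r by (intro mult_mono) auto
  then show "r * (r + 1) * (p / (s + d))\<^sup>2 \<le> K\<^sup>2"
    using s0 by (simp add: power_divide divide_le_eq mult.commute)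
  \<comment> \<open>The bound uses 2s + d \<le> 2(s + d): one factor s + d cancels, and r(r+1) \<le>
    s^2 absorbs the remaining s^2.\<close>
  have "(p / s)\<^sup>2 - (p / (s + d))\<^sup>2 = p\<^sup>2 * (d * (2 * s + d)) / (s\<^sup>2 * (s + d)\<^sup>2)"
  proof -
    have "(p / s)\<^sup>2 - (p / (s + d))\<^sup>2 = (p\<^sup>2 * (s + d)\<^sup>2 - p\<^sup>2 * s\<^sup>2) / (s\<^sup>2 * (s + d)\<^sup>2)"
      unfolding power_divide using s0 by (intro diff_frac_eq) auto
    also have "p\<^sup>2 * (s + d)\<^sup>2 - p\<^sup>2 * s\<^sup>2 = p\<^sup>2 * (d * (2 * s + d))"
      by (simp add: power2_eq_square algebra_simps)
    finally show ?thesis .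
  qed
  also have "\<dots> \<le> K\<^sup>2 * (K * (2 * (s + d))) / (s\<^sup>2 * (s + d)\<^sup>2)"
    using p2 d s0 K0 by (intro divide_right_mono mult_mono) auto
  also have "\<dots> = 2 * K ^ 3 / (s\<^sup>2 * (s + d))"
  proof -
    have "K\<^sup>2 * (K * (2 * t)) / (s\<^sup>2 * t\<^sup>2) = 2 * K ^ 3 / (s\<^sup>2 * t)" if "t \<noteq> 0" for t
    proof -
      have "K\<^sup>2 * (K * (2 * t)) / (s\<^sup>2 * t\<^sup>2) = (2 * K ^ 3) * t / ((s\<^sup>2 * t) * t)"
        by (simp add: power2_eq_square power3_eq_cube mult_ac)
      also have "\<dots> = 2 * K ^ 3 / (s\<^sup>2 * t)"
        using that by (rule nonzero_mult_divide_mult_cancel_right)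
      finally show ?thesis .
    qed
    from this[of "s + d"] s0(2) show ?thesis by simp
  qed
  finally have upper: "(p / s)\<^sup>2 - (p / (s + d))\<^sup>2 \<le> 2 * K ^ 3 / (s\<^sup>2 * (s + d))" .
  have lower: "(p / (s + d))\<^sup>2 \<le> (p / s)\<^sup>2"
    unfolding power_divide using s0 d by (intro divide_left_mono power_mono) auto
  have "\<bar>r * (r + 1) * ((p / (s + d))\<^sup>2 - (p / s)\<^sup>2)\<bar> = r * (r + 1) * ((p / s)\<^sup>2 - (p / (s + d))\<^sup>2)"
    using lower r by (simp add: abs_mult)
  also have "\<dots> \<le> r * (r + 1) * (2 * K ^ 3 / (s\<^sup>2 * (s + d)))"
    using upper r by (intro mult_left_mono) auto
  also have "\<dots> = 2 * K ^ 3 * (r * (r + 1)) / (s\<^sup>2 * (s + d))" by simp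
  also have "\<dots> \<le> 2 * K ^ 3 * s\<^sup>2 / (s\<^sup>2 * (s + d))"
    unfolding power2_eq_square using s0 s r K0 by (intro divide_right_mono mult_left_mono mult_mono) auto
  also have "\<dots> = 2 * K ^ 3 / (s + d)" using s0 by simp
  also have "\<dots> \<le> 2 * K ^ 3 / (r + 1)"
    using s0 r K0 by (intro divide_left_mono) auto
  finally show "\<bar>r * (r + 1) * ((p / (s + d))\<^sup>2 - (p / s)\<^sup>2)\<bar> \<le> 2 * K ^ 3 / (r + 1)" .
qed

section \<open>First and second conditional moments of the increments of the proportion\<close>

context bounded_urn
begin

definition added :: "nat \<Rightarrow> 'w \<Rightarrow> real" where
  "added n \<omega> = real (X (Suc n) \<omega>) * real (A (Suc n) \<omega>)
    + (real (N (Suc n) \<omega>) - real (X (Suc n) \<omega>)) * real (B (Suc n) \<omega>)"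

text \<open>The numerator of Z_{n+1} - Z_n over the common denominator S_{n+1}. The difference of
  sample size and \<open>X\<close> is taken in the reals, which agrees almost surely with the
  truncated one.\<close>

definition num :: "nat \<Rightarrow> 'w \<Rightarrow> real" where
  "num n \<omega> = (1 - Z n \<omega>) * (real (X (Suc n) \<omega>) * real (A (Suc n) \<omega>))
    - Z n \<omega> * ((real (N (Suc n) \<omega>) - real (X (Suc n) \<omega>)) * real (B (Suc n) \<omega>))"

text \<open>The conditional second moment of \<open>num n\<close>. The recurring bracket with
  \<open>\<rho> n\<close> is E[X^2 | F_n]; the brackets beside the second moment of \<open>B\<close>
  and the mixed moment are E[(N-X)^2 | F_n] and E[X(N-X) | F_n].\<close>

definition num_var :: "nat \<Rightarrow> 'w \<Rightarrow> real" where
  "num_var n \<omega> =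
    (1 - Z n \<omega>)\<^sup>2 * ((\<integral>\<omega>. (real (A (Suc n) \<omega>))\<^sup>2 \<partial>M) * (Z n \<omega> * q1 n \<omega> + \<rho> n \<omega> * (q2 n \<omega> - q1 n \<omega>)))
    + (Z n \<omega>)\<^sup>2 * ((\<integral>\<omega>. (real (B (Suc n) \<omega>))\<^sup>2 \<partial>M) * (q2 n \<omega> - 2 * (Z n \<omega> * q2 n \<omega>) + (Z n \<omega> * q1 n \<omega> + \<rho> n \<omega> * (q2 n \<omega> - q1 n \<omega>))))
    - (2 * Z n \<omega> * (1 - Z n \<omega>)) * ((\<integral>\<omega>. real (A (Suc n) \<omega>) * real (B (Suc n) \<omega>) \<partial>M)
        * (Z n \<omega> * q2 n \<omega> - (Z n \<omega> * q1 n \<omega> + \<rho> n \<omega> * (q2 n \<omega> - q1 n \<omega>))))"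

lemma Z_measurable_M [measurable]: "Z n \<in> borel_measurable M" "S n \<in> borel_measurable M"
  by (rule measurable_F_M[OF past_measurable(3)], rule measurable_F_M[OF past_measurable(2)])

lemma added_measurable [measurable]: "added n \<in> borel_measurable M"
  unfolding added_def by measurable

lemma num_measurable [measurable]: "num n \<in> borel_measurable M"
  unfolding num_def by measurable

lemma after_draw_measurable [measurable]:
  "(\<lambda>\<omega>. real (N (Suc n) \<omega>)) \<in> borel_measurable (after_draw n)"
  "(\<lambda>\<omega>. real (X (Suc n) \<omega>)) \<in> borel_measurable (after_draw n)"
  by (rule measurable_generated_field; simp)+

text \<open>At least one ball is added since the sample is nonempty and reinforcements are at least
  1; at most c^2 since c bounds both the sample and the reinforcements. The numerator obeys the same
  bound because its two terms have weights in [0,1] and opposite signs.\<close>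

lemma AE_step: "AE \<omega> in M. \<forall>n. S (Suc n) \<omega> = S n \<omega> + added n \<omega>
    \<and> 1 \<le> added n \<omega> \<and> added n \<omega> \<le> (real c)\<^sup>2 \<and> \<bar>num n \<omega>\<bar> \<le> (real c)\<^sup>2
    \<and> Z (Suc n) \<omega> - Z n \<omega> = num n \<omega> / (S n \<omega> + added n \<omega>)"
  using AE_draws
proof eventually_elim
  case (elim \<omega>)
  show ?case
  proof
    fix n
    define x y where "x = real (X (Suc n) \<omega>)" and "y = real (N (Suc n) \<omega>) - real (X (Suc n) \<omega>)"
    define u v where "u = x * real (A (Suc n) \<omega>)" and "v = y * real (B (Suc n) \<omega>)"
    have el: "1 \<le> A (Suc n) \<omega>" "A (Suc n) \<omega> \<le> c" "1 \<le> B (Suc n) \<omega>" "B (Suc n) \<omega> \<le> c"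
      "1 \<le> N (Suc n) \<omega>" "N (Suc n) \<omega> \<le> c" "X (Suc n) \<omega> \<le> N (Suc n) \<omega>" using elim by auto
    have xy: "0 \<le> x" "0 \<le> y" "x + y = real (N (Suc n) \<omega>)" using el by (auto simp: x_def y_def)
    have uv: "0 \<le> u" "0 \<le> v" using xy by (auto simp: u_def v_def)
    have uxvy: "x * 1 \<le> u" "y * 1 \<le> v"
      unfolding u_def v_def using xy el by (intro mult_left_mono; simp)+
    have "u \<le> x * real c" "v \<le> y * real c"
      unfolding u_def v_def using xy el by (intro mult_left_mono; simp)+
    then have "u + v \<le> (x + y) * real c" by (simp add: algebra_simps)
    also have "\<dots> \<le> real c * real c" unfolding xy(3) using el by (intro mult_right_mono) auto
    finally have uvc: "u + v \<le> (real c)\<^sup>2" by (simp add: power2_eq_square)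
    have added: "added n \<omega> = u + v" by (simp add: added_def u_def v_def x_def y_def)
    have num: "num n \<omega> = u * (1 - Z n \<omega>) - Z n \<omega> * v"
      by (simp add: num_def u_def v_def x_def y_def mult_ac)
    have H: "H (Suc n) \<omega> = H n \<omega> + u"
      by (simp add: urn_H_def u_def x_def mult.commute)
    have SS: "S (Suc n) \<omega> = S n \<omega> + (u + v)"
      using el by (simp add: urn_S_def urn_H_def urn_K_def u_def v_def x_def y_def mult.commute of_nat_diff)
    have "Z (Suc n) \<omega> - Z n \<omega> = (H n \<omega> + u) / (S n \<omega> + (u + v)) - H n \<omega> / S n \<omega>"
      unfolding urn_Z_def H SS ..
    also have "\<dots> = num n \<omega> / (S n \<omega> + (u + v))"
      unfolding num urn_Z_def using urn_counts[of n \<omega>] uv by (intro urn_proportion_step) auto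
    finally have ZZ: "Z (Suc n) \<omega> - Z n \<omega> = num n \<omega> / (S n \<omega> + (u + v))" .
    have "\<bar>num n \<omega>\<bar> \<le> (real c)\<^sup>2"
      unfolding num using uv uvc urn_counts by (intro urn_numerator_bound) auto
    moreover have "1 \<le> u + v" using uxvy xy el by linarith
    ultimately show "S (Suc n) \<omega> = S n \<omega> + added n \<omega>
      \<and> 1 \<le> added n \<omega> \<and> added n \<omega> \<le> (real c)\<^sup>2 \<and> \<bar>num n \<omega>\<bar> \<le> (real c)\<^sup>2
      \<and> Z (Suc n) \<omega> - Z n \<omega> = num n \<omega> / (S n \<omega> + added n \<omega>)"
      using SS ZZ uvc unfolding added by blast
  qed
qed

text \<open>The urn starts with at least two balls and gains at least one per draw. The extra 1 is
  the margin required by \<open>urn_increment_bounds\<close>.\<close>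

lemma AE_S_ge: "AE \<omega> in M. \<forall>n. real (Suc n) + 1 \<le> S n \<omega>"
  using AE_step
proof eventually_elim
  case (elim \<omega>)
  show ?case
  proof
    fix n
    show "real (Suc n) + 1 \<le> S n \<omega>"
    proof (induction n)
      case 0
      then show ?case using urn_counts(1,2)[of 0 \<omega>] by linarith
    next
      case (Suc n)
      then show ?case using elim[rule_format, of n] by linarith
    qed
  qed
qed

lemma AE_abs_le: "AE \<omega> in M. \<bar>real (X (Suc n) \<omega>)\<bar> \<le> real c"
  "AE \<omega> in M. \<bar>real (N (Suc n) \<omega>) - real (X (Suc n) \<omega>)\<bar> \<le> real c"
  "AE \<omega> in M. \<bar>real (A (Suc n) \<omega>)\<bar> \<le> real c"
  "AE \<omega> in M. \<bar>real (B (Suc n) \<omega>)\<bar> \<le> real c"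
  using AE_draw[of n] by (eventually_elim; simp)+

lemma AE_abs_mult_le:
  assumes "AE \<omega> in M. \<bar>f \<omega>\<bar> \<le> (K::real)" "AE \<omega> in M. \<bar>g \<omega>\<bar> \<le> L"
  shows "AE \<omega> in M. \<bar>f \<omega> * g \<omega>\<bar> \<le> K * L"
  using assms
proof eventually_elim
  case (elim \<omega>)
  then have "0 \<le> K" by linarith
  with elim show ?case unfolding abs_mult by (intro mult_mono) auto
qed

lemma cexp_XA: "bounded_cexp (past n) (\<lambda>\<omega>. real (X (Suc n) \<omega>) * real (A (Suc n) \<omega>)) (\<lambda>\<omega>. m (Suc n) * (Z n \<omega> * q1 n \<omega>))"
  using reinforcement_factor[where f="\<lambda>i j. real i", OF AE_abs_le(3)[of n] after_draw_measurable(2) AE_abs_le(1) cexp_X]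
    mean_A[of "Suc n"] by simp

lemma cexp_NXB: "bounded_cexp (past n) (\<lambda>\<omega>. (real (N (Suc n) \<omega>) - real (X (Suc n) \<omega>)) * real (B (Suc n) \<omega>))
    (\<lambda>\<omega>. m (Suc n) * (q1 n \<omega> - Z n \<omega> * q1 n \<omega>))"
proof -
  have "bounded_cexp (past n) (\<lambda>\<omega>. (real (N (Suc n) \<omega>) - real (X (Suc n) \<omega>)) * real (B (Suc n) \<omega>))
    (\<lambda>\<omega>. (\<integral>\<omega>. real (B (Suc n) \<omega>) \<partial>M) * (q1 n \<omega> - Z n \<omega> * q1 n \<omega>))"
    by (rule reinforcement_factor[where f="\<lambda>i j. real j", OF AE_abs_le(4) _ AE_abs_le(2)
        bounded_cexp_diff[OF cexp_N cexp_X sub]]) measurable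
  then show ?thesis using mean_B[of "Suc n"] by simp
qed

lemma cexp_added: "bounded_cexp (past n) (added n) (\<lambda>\<omega>. m (Suc n) * q1 n \<omega>)"
  by (rule bounded_cexp_cong[OF bounded_cexp_add[OF cexp_XA cexp_NXB sub] _ _ _ sub])
    (auto simp: added_def algebra_simps)

text \<open>Here the equality of the two mean reinforcements is decisive: (1-Z) m Z q1 and Z m (1-Z)
  q1 cancel.\<close>

lemma cexp_num: "bounded_cexp (past n) (num n) (\<lambda>\<omega>. 0)"
proof (rule bounded_cexp_cong[OF bounded_cexp_diff[OF bounded_cexp_mult[OF cexp_XA sub, where u="\<lambda>\<omega>. 1 - Z n \<omega>" and L=1]
        bounded_cexp_mult[OF cexp_NXB sub _ abs_Z_le] sub] _ _ _ sub])
  show "AE \<omega> in M. \<bar>1 - Z n \<omega>\<bar> \<le> 1" using urn_counts(3,4) by simp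
qed (auto simp: num_def algebra_simps)

text \<open>Each term of the expanded square is a product of a draw moment and an independent
  reinforcement moment. The draw moments of \<open>X\<close> and of the complement all reduce to
  E[X^2], E[NX] and E[N^2] given the past.\<close>

lemma cexp_num2: "bounded_cexp (past n) (\<lambda>\<omega>. (num n \<omega>)\<^sup>2) (num_var n)"
proof -
  define x where "x \<omega> = real (X (Suc n) \<omega>)" for \<omega>
  define y where "y \<omega> = real (N (Suc n) \<omega>) - real (X (Suc n) \<omega>)" for \<omega>
  define ex2 where "ex2 \<omega> = Z n \<omega> * q1 n \<omega> + \<rho> n \<omega> * (q2 n \<omega> - q1 n \<omega>)" for \<omega>
  have [measurable]: "x \<in> borel_measurable (after_draw n)" "y \<in> borel_measurable (after_draw n)"
    unfolding x_def y_def by measurable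
  have xb: "AE \<omega> in M. \<bar>x \<omega>\<bar> \<le> real c" and yb: "AE \<omega> in M. \<bar>y \<omega>\<bar> \<le> real c"
    unfolding x_def y_def by (rule AE_abs_le)+
  have cx2: "bounded_cexp (past n) (\<lambda>\<omega>. x \<omega> * x \<omega>) ex2"
    using cexp_X2[of n] by (simp add: x_def ex2_def[abs_def] power2_eq_square)
  have cxy: "bounded_cexp (past n) (\<lambda>\<omega>. x \<omega> * y \<omega>) (\<lambda>\<omega>. Z n \<omega> * q2 n \<omega> - ex2 \<omega>)"
    using bounded_cexp_diff[OF cexp_NX cx2 sub] by (simp add: x_def y_def algebra_simps)
  have cy2: "bounded_cexp (past n) (\<lambda>\<omega>. y \<omega> * y \<omega>) (\<lambda>\<omega>. q2 n \<omega> - 2 * (Z n \<omega> * q2 n \<omega>) + ex2 \<omega>)"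
    using bounded_cexp_add[OF bounded_cexp_diff[OF cexp_N2 bounded_cexp_cmult[OF cexp_NX sub, where c=2] sub] cx2 sub]
    by (simp add: x_def y_def power2_eq_square algebra_simps)
  note A = AE_abs_le(3)[of n] and B = AE_abs_le(4)[of n]
  have 1: "bounded_cexp (past n) (\<lambda>\<omega>. (x \<omega> * x \<omega>) * (real (A (Suc n) \<omega>) * real (A (Suc n) \<omega>)))
      (\<lambda>\<omega>. (\<integral>\<omega>. real (A (Suc n) \<omega>) * real (A (Suc n) \<omega>) \<partial>M) * ex2 \<omega>)"
    by (rule reinforcement_factor[where f="\<lambda>i j. real i * real i", OF AE_abs_mult_le[OF A A] _ AE_abs_mult_le[OF xb xb] cx2]) measurable
  have 2: "bounded_cexp (past n) (\<lambda>\<omega>. (y \<omega> * y \<omega>) * (real (B (Suc n) \<omega>) * real (B (Suc n) \<omega>)))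
      (\<lambda>\<omega>. (\<integral>\<omega>. real (B (Suc n) \<omega>) * real (B (Suc n) \<omega>) \<partial>M) * (q2 n \<omega> - 2 * (Z n \<omega> * q2 n \<omega>) + ex2 \<omega>))"
    by (rule reinforcement_factor[where f="\<lambda>i j. real j * real j", OF AE_abs_mult_le[OF B B] _ AE_abs_mult_le[OF yb yb] cy2]) measurable
  have 3: "bounded_cexp (past n) (\<lambda>\<omega>. (x \<omega> * y \<omega>) * (real (A (Suc n) \<omega>) * real (B (Suc n) \<omega>)))
      (\<lambda>\<omega>. (\<integral>\<omega>. real (A (Suc n) \<omega>) * real (B (Suc n) \<omega>) \<partial>M) * (Z n \<omega> * q2 n \<omega> - ex2 \<omega>))"
    by (rule reinforcement_factor[where f="\<lambda>i j. real i * real j", OF AE_abs_mult_le[OF A B] _ AE_abs_mult_le[OF xb yb] cxy]) measurable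
  have z: "\<bar>(1 - Z n \<omega>)\<^sup>2\<bar> \<le> 1" "\<bar>(Z n \<omega>)\<^sup>2\<bar> \<le> 1" "\<bar>2 * Z n \<omega> * (1 - Z n \<omega>)\<bar> \<le> 2 * 1 * 1" for \<omega>
  proof -
    show "\<bar>2 * Z n \<omega> * (1 - Z n \<omega>)\<bar> \<le> 2 * 1 * 1"
      unfolding abs_mult using urn_counts(3,4)[of n \<omega>] by (intro mult_mono) auto
  qed (use urn_counts(3,4)[of n \<omega>] in \<open>auto simp: power_le_one\<close>)
  have "bounded_cexp (past n) (\<lambda>\<omega>. (1 - Z n \<omega>)\<^sup>2 * ((x \<omega> * x \<omega>) * (real (A (Suc n) \<omega>) * real (A (Suc n) \<omega>)))
      + (Z n \<omega>)\<^sup>2 * ((y \<omega> * y \<omega>) * (real (B (Suc n) \<omega>) * real (B (Suc n) \<omega>)))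
      - (2 * Z n \<omega> * (1 - Z n \<omega>)) * ((x \<omega> * y \<omega>) * (real (A (Suc n) \<omega>) * real (B (Suc n) \<omega>)))) (num_var n)"
    unfolding num_var_def[abs_def] power2_eq_square[of "real (A _ _)"] power2_eq_square[of "real (B _ _)"] ex2_def[symmetric]
    by (rule bounded_cexp_diff[OF bounded_cexp_add[OF bounded_cexp_mult[OF 1 sub _ AE_I2] bounded_cexp_mult[OF 2 sub _ AE_I2] sub]
          bounded_cexp_mult[OF 3 sub _ AE_I2] sub], measurable) (use z in auto)
  then show ?thesis
    by (rule bounded_cexp_cong[OF _ _ _ _ sub])
      (auto simp: num_def x_def y_def power2_eq_square algebra_simps)
qed

text \<open>The conditional mean of the number of added balls converges, so its averages do; the
  centred increments average to zero by the strong law.\<close>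

lemma urn_size_growth:
  assumes m: "m \<longlonglongrightarrow> m_lim"
    and q1: "AE \<omega> in M. (\<lambda>n. q1 n \<omega>) \<longlonglongrightarrow> N_lim \<omega>"
  shows "AE \<omega> in M. (\<lambda>n. S n \<omega> / real n) \<longlonglongrightarrow> m_lim * N_lim \<omega>"
proof -
  \<comment> \<open>Almost surely this is \<open>added n\<close>, but as a difference of urn sizes
    it is visibly measurable at time n+1 and telescopes exactly.\<close>
  define D where "D n \<omega> = S (Suc n) \<omega> - S n \<omega>" for n \<omega>
  define d where "d n \<omega> = D n \<omega> - cexp n (D n) \<omega>" for n \<omega>
  have D_past: "D n \<in> borel_measurable (past (Suc n))" for n
    unfolding D_def using measurable_F_mono[OF past_measurable(2), of n "Suc n"] by measurable
  have DM: "D n \<in> borel_measurable M" for n by (rule measurable_F_M[OF D_past])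
  have D_added: "AE \<omega> in M. added n \<omega> = D n \<omega>" for n
    using AE_step by eventually_elim (simp add: D_def)
  have cD: "bounded_cexp (past n) (D n) (\<lambda>\<omega>. m (Suc n) * q1 n \<omega>)" for n
    by (rule bounded_cexp_cong[OF cexp_added D_added _ DM sub]) simp
  have Db: "AE \<omega> in M. \<bar>D n \<omega>\<bar> \<le> (real c)\<^sup>2" for n
    using AE_step
  proof eventually_elim
    case (elim \<omega>)
    then show ?case using elim[rule_format, of n] unfolding D_def by linarith
  qed
  have "AE \<omega> in M. (\<lambda>n. (\<Sum>k<n. d k \<omega>) / real n) \<longlonglongrightarrow> 0"
  proof (rule bounded_martingale_differences_slln)
    show "d k \<in> borel_measurable (past (Suc k))" for k
      unfolding d_def by (rule centered_measurable[OF D_past])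
    show "AE \<omega> in M. cexp k (d k) \<omega> = 0" for k
      unfolding d_def by (rule cexp_centered[OF bounded_cexpD(2)[OF cD]])
    show "AE \<omega> in M. \<bar>d k \<omega>\<bar> \<le> (real c)\<^sup>2 + (real c)\<^sup>2" for k
      using Db[of k] abs_cexp_le[OF DM Db, of k k] by eventually_elim (auto simp: d_def)
  qed
  moreover have "AE \<omega> in M. \<forall>n. cexp n (D n) \<omega> = m (Suc n) * q1 n \<omega>"
    unfolding AE_all_countable using bounded_cexpD(3)[OF cD] by blast
  ultimately show ?thesis
    using q1
  proof eventually_elim
    case (elim \<omega>)
    have "(\<lambda>n. cexp n (D n) \<omega>) \<longlonglongrightarrow> m_lim * N_lim \<omega>"
      unfolding elim(2)[rule_format] by (intro tendsto_mult elim(3) LIMSEQ_Suc m)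
    then have "(\<lambda>n. (\<Sum>k<n. cexp k (D k) \<omega>) / real n) \<longlonglongrightarrow> m_lim * N_lim \<omega>"
      by (rule cesaro_tendsto)
    then have "(\<lambda>n. S 0 \<omega> / real n + (\<Sum>k<n. d k \<omega>) / real n + (\<Sum>k<n. cexp k (D k) \<omega>) / real n)
        \<longlonglongrightarrow> 0 + 0 + m_lim * N_lim \<omega>"
      by (intro tendsto_add elim(1) lim_const_over_n)
    moreover have "S 0 \<omega> / real n + (\<Sum>k<n. d k \<omega>) / real n + (\<Sum>k<n. cexp k (D k) \<omega>) / real n = S n \<omega> / real n" for n
    proof -
      have "S 0 \<omega> + (\<Sum>k<n. d k \<omega>) + (\<Sum>k<n. cexp k (D k) \<omega>) = S n \<omega>"
        using sum_lessThan_telescope[of "\<lambda>k. S k \<omega>" n]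
        by (simp add: d_def[of _ \<omega>] D_def[of _ \<omega>] sum_subtractf)
      then show ?thesis by (simp add: add_divide_distrib[symmetric])
    qed
    ultimately show ?case by simp
  qed
qed

definition K :: real where "K = (real c)\<^sup>2"

text \<open>The general theorem takes one constant for all its bounds: \<open>cz\<close> dominates
  \<open>K\<close> for the increments and \<open>K\<close> squared for the drift, and its square
  dominates \<open>K\<close> squared for the scaled second moment.\<close>

definition cz :: real where "cz = K + K\<^sup>2"

lemma K_nonneg: "0 \<le> K" "0 \<le> cz"
  by (simp_all add: K_def cz_def)

lemma AE_increment: "AE \<omega> in M. \<forall>n.
    \<bar>Z (Suc n) \<omega> - Z n \<omega>\<bar> \<le> cz / real (Suc n)
    \<and> \<bar>(Z (Suc n) \<omega> - Z n \<omega>) - num n \<omega> / S n \<omega>\<bar> \<le> cz / (real (Suc n) * real (Suc (Suc n)))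
    \<and> real (Suc n) * real (Suc (Suc n)) * (Z (Suc n) \<omega> - Z n \<omega>)\<^sup>2 \<le> cz\<^sup>2
    \<and> \<bar>real (Suc n) * real (Suc (Suc n)) * ((Z (Suc n) \<omega> - Z n \<omega>)\<^sup>2 - (num n \<omega> / S n \<omega>)\<^sup>2)\<bar> \<le> 2 * K ^ 3 / real (Suc (Suc n))"
  using AE_step AE_S_ge
proof eventually_elim
  case (elim \<omega>)
  show ?case
  proof
    fix n
    have st: "\<bar>num n \<omega>\<bar> \<le> K" "0 \<le> added n \<omega>" "added n \<omega> \<le> K"
      "Z (Suc n) \<omega> - Z n \<omega> = num n \<omega> / (S n \<omega> + added n \<omega>)"
      using elim(1)[rule_format, of n] by (auto simp: K_def)
    have Suc2: "real (Suc (Suc n)) = real (Suc n) + 1" by simp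
    note b = urn_increment_bounds[OF st(1-3), of "real (Suc n)" "S n \<omega>"]
    have le: "K \<le> cz" "K\<^sup>2 \<le> cz" using K_nonneg by (simp_all add: cz_def)
    have le2: "K\<^sup>2 \<le> cz\<^sup>2" using le K_nonneg by (intro power_mono) auto
    have r: "0 < real (Suc n)" "real (Suc n) + 1 \<le> S n \<omega>" using elim(2) by auto
    have "\<bar>num n \<omega> / (S n \<omega> + added n \<omega>)\<bar> \<le> cz / real (Suc n)"
      using b(1)[OF r] divide_right_mono[OF le(1), of "real (Suc n)"] by simp
    moreover have "\<bar>num n \<omega> / (S n \<omega> + added n \<omega>) - num n \<omega> / S n \<omega>\<bar> \<le> cz / (real (Suc n) * (real (Suc n) + 1))"
      using b(2)[OF r] divide_right_mono[OF le(2), of "real (Suc n) * (real (Suc n) + 1)"] by simp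
    ultimately show "\<bar>Z (Suc n) \<omega> - Z n \<omega>\<bar> \<le> cz / real (Suc n)
      \<and> \<bar>(Z (Suc n) \<omega> - Z n \<omega>) - num n \<omega> / S n \<omega>\<bar> \<le> cz / (real (Suc n) * real (Suc (Suc n)))
      \<and> real (Suc n) * real (Suc (Suc n)) * (Z (Suc n) \<omega> - Z n \<omega>)\<^sup>2 \<le> cz\<^sup>2
      \<and> \<bar>real (Suc n) * real (Suc (Suc n)) * ((Z (Suc n) \<omega> - Z n \<omega>)\<^sup>2 - (num n \<omega> / S n \<omega>)\<^sup>2)\<bar> \<le> 2 * K ^ 3 / real (Suc (Suc n))"
      unfolding st(4) Suc2 using b(3)[OF r] b(4)[OF r] le2 by (intro conjI) (assumption | linarith)+
  qed
qed

lemma Z_increment_le: "AE \<omega> in M. \<bar>Z (Suc n) \<omega> - Z n \<omega>\<bar> \<le> cz / real (Suc n)"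
  using AE_increment by eventually_elim blast

lemma inverse_S_bound: "\<bar>1 / S n \<omega>\<bar> \<le> 1"
  using urn_counts(1,2)[of n \<omega>] by (simp add: divide_le_eq_1)

text \<open>With the denominator known in advance the increment has conditional mean zero, so only
  the error of replacing S_{n+1} by S_n contributes.\<close>

lemma Z_drift_le: "AE \<omega> in M. \<bar>cexp n (\<lambda>\<omega>. Z (Suc n) \<omega> - Z n \<omega>) \<omega>\<bar> \<le> cz / (real (Suc n) * real (Suc (Suc n)))"
proof -
  define e where "e \<omega> = (Z (Suc n) \<omega> - Z n \<omega>) - num n \<omega> / S n \<omega>" for \<omega>
  have em: "e \<in> borel_measurable M" unfolding e_def by measurable
  have eb: "AE \<omega> in M. \<bar>e \<omega>\<bar> \<le> cz / (real (Suc n) * real (Suc (Suc n)))"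
    using AE_increment unfolding e_def by eventually_elim blast
  have "bounded_cexp (past n) (\<lambda>\<omega>. 1 / S n \<omega> * num n \<omega>) (\<lambda>\<omega>. 1 / S n \<omega> * 0)"
    by (rule bounded_cexp_mult[OF cexp_num sub _ AE_I2[OF inverse_S_bound]]) measurable
  from bounded_cexpD(3)[OF bounded_cexp_add[OF this bounded_cexp_refl[OF em eb] sub]]
  have "AE \<omega> in M. cexp n (\<lambda>\<omega>. 1 / S n \<omega> * num n \<omega> + e \<omega>) \<omega> = 1 / S n \<omega> * 0 + cexp n e \<omega>" .
  moreover have "(\<lambda>\<omega>. 1 / S n \<omega> * num n \<omega> + e \<omega>) = (\<lambda>\<omega>. Z (Suc n) \<omega> - Z n \<omega>)"
    by (simp add: e_def)
  ultimately have "AE \<omega> in M. cexp n (\<lambda>\<omega>. Z (Suc n) \<omega> - Z n \<omega>) \<omega> = cexp n e \<omega>"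
    by simp
  with abs_cexp_le[OF em eb, of n] show ?thesis
    by eventually_elim simp
qed

lemma Z_convergent: "AE \<omega> in M. convergent (\<lambda>n. Z n \<omega>)"
  by (rule quasi_martingale_convergent[OF past_measurable(3) Z_increment_le Z_drift_le])

text \<open>The truncation makes the bounds hold everywhere; almost surely it has no effect.\<close>
definition U :: "nat \<Rightarrow> 'w \<Rightarrow> real" where
  "U n \<omega> = max 0 (min (cz\<^sup>2) (real (Suc n) * real (Suc (Suc n)) * cexp n (\<lambda>\<omega>. (Z (Suc n) \<omega> - Z n \<omega>)\<^sup>2) \<omega>))"

lemma U_eq: "AE \<omega> in M. U n \<omega> = real (Suc n) * real (Suc (Suc n)) * cexp n (\<lambda>\<omega>. (Z (Suc n) \<omega> - Z n \<omega>)\<^sup>2) \<omega>"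
proof -
  define r where "r = real (Suc n) * real (Suc (Suc n))"
  have r: "0 < r" unfolding r_def by (simp only: zero_less_mult_iff of_nat_0_less_iff zero_less_Suc simp_thms)
  have b: "AE \<omega> in M. (Z (Suc n) \<omega> - Z n \<omega>)\<^sup>2 \<le> cz\<^sup>2 / r"
    using AE_increment
  proof eventually_elim
    case (elim \<omega>)
    then have "r * (Z (Suc n) \<omega> - Z n \<omega>)\<^sup>2 \<le> cz\<^sup>2" unfolding r_def by blast
    then show ?case using r by (simp add: pos_le_divide_eq mult.commute)
  qed
  have "AE \<omega> in M. \<bar>cexp n (\<lambda>\<omega>. (Z (Suc n) \<omega> - Z n \<omega>)\<^sup>2) \<omega>\<bar> \<le> cz\<^sup>2 / r"
    by (rule abs_cexp_le) (use b in auto)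
  moreover have "AE \<omega> in M. 0 \<le> cexp n (\<lambda>\<omega>. (Z (Suc n) \<omega> - Z n \<omega>)\<^sup>2) \<omega>"
    by (rule sigma_finite_subalgebra.real_cond_exp_pos[OF sfs]) auto
  ultimately show ?thesis
  proof eventually_elim
    case (elim \<omega>)
    let ?x = "cexp n (\<lambda>\<omega>. (Z (Suc n) \<omega> - Z n \<omega>)\<^sup>2) \<omega>"
    have "r * ?x \<le> cz\<^sup>2" using elim r by (simp add: pos_le_divide_eq mult.commute)
    moreover have "0 \<le> r * ?x" using elim r by simp
    ultimately show ?case unfolding U_def r_def[symmetric] by simp
  qed
qed

text \<open>The same replacement of the denominator at second order: \<open>S n\<close> leaves the
  conditional expectation, and what remains is \<open>num_var\<close> plus an error that vanishes
  like 1/n.\<close>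

lemma U_approx: "AE \<omega> in M. \<forall>n. \<bar>U n \<omega> - real (Suc n) * real (Suc (Suc n)) / (S n \<omega>)\<^sup>2 * num_var n \<omega>\<bar> \<le> 2 * K ^ 3 / real (Suc (Suc n))"
  unfolding AE_all_countable
proof
  fix n
  define r where "r = real (Suc n) * real (Suc (Suc n))"
  define e where "e \<omega> = r * ((Z (Suc n) \<omega> - Z n \<omega>)\<^sup>2 - (num n \<omega> / S n \<omega>)\<^sup>2)" for \<omega>
  have em: "e \<in> borel_measurable M" unfolding e_def by measurable
  have eb: "AE \<omega> in M. \<bar>e \<omega>\<bar> \<le> 2 * K ^ 3 / real (Suc (Suc n))"
    using AE_increment unfolding e_def r_def by eventually_elim blast
  have sb: "AE \<omega> in M. \<bar>1 / (S n \<omega>)\<^sup>2\<bar> \<le> 1"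
  proof (rule AE_I2)
    fix \<omega>
    have "1 \<le> S n \<omega>" using urn_counts(1,2)[of n \<omega>] by linarith
    then show "\<bar>1 / (S n \<omega>)\<^sup>2\<bar> \<le> 1" using one_le_power[of "S n \<omega>" 2] by (simp add: divide_le_eq_1)
  qed
  have "bounded_cexp (past n) (\<lambda>\<omega>. 1 / (S n \<omega>)\<^sup>2 * (num n \<omega>)\<^sup>2) (\<lambda>\<omega>. 1 / (S n \<omega>)\<^sup>2 * num_var n \<omega>)"
    by (rule bounded_cexp_mult[OF cexp_num2 sub _ sb]) measurable
  from bounded_cexpD(3)[OF bounded_cexp_add[OF bounded_cexp_cmult[OF this sub, where c=r] bounded_cexp_refl[OF em eb] sub]]
  have "AE \<omega> in M. cexp n (\<lambda>\<omega>. r * (1 / (S n \<omega>)\<^sup>2 * (num n \<omega>)\<^sup>2) + e \<omega>) \<omega>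
      = r * (1 / (S n \<omega>)\<^sup>2 * num_var n \<omega>) + cexp n e \<omega>" .
  moreover have "(\<lambda>\<omega>. r * (1 / (S n \<omega>)\<^sup>2 * (num n \<omega>)\<^sup>2) + e \<omega>) = (\<lambda>\<omega>. r * (Z (Suc n) \<omega> - Z n \<omega>)\<^sup>2)"
    by (rule ext) (simp add: e_def power_divide right_diff_distrib)
  ultimately have "AE \<omega> in M. cexp n (\<lambda>\<omega>. r * (Z (Suc n) \<omega> - Z n \<omega>)\<^sup>2) \<omega>
      = r * (1 / (S n \<omega>)\<^sup>2 * num_var n \<omega>) + cexp n e \<omega>" by simp
  moreover have "AE \<omega> in M. cexp n (\<lambda>\<omega>. r * (Z (Suc n) \<omega> - Z n \<omega>)\<^sup>2) \<omega> = r * cexp n (\<lambda>\<omega>. (Z (Suc n) \<omega> - Z n \<omega>)\<^sup>2) \<omega>"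
  proof (rule sigma_finite_subalgebra.real_cond_exp_cmult[OF sfs])
    show "integrable M (\<lambda>\<omega>. (Z (Suc n) \<omega> - Z n \<omega>)\<^sup>2)"
    proof (rule integrable_AE_bounded[where K=1])
      have "\<bar>Z (Suc n) \<omega> - Z n \<omega>\<bar> \<le> 1" for \<omega>
        using urn_counts(3,4)[of n \<omega>] urn_counts(3,4)[of "Suc n" \<omega>] by linarith
      then show "AE \<omega> in M. norm ((Z (Suc n) \<omega> - Z n \<omega>)\<^sup>2) \<le> 1" by (simp add: abs_square_le_1)
    qed measurable
  qed
  ultimately show "AE \<omega> in M. \<bar>U n \<omega> - real (Suc n) * real (Suc (Suc n)) / (S n \<omega>)\<^sup>2 * num_var n \<omega>\<bar> \<le> 2 * K ^ 3 / real (Suc (Suc n))"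
    using U_eq[of n] abs_cexp_le[OF em eb, of n]
    unfolding r_def[symmetric] by eventually_elim simp
qed

lemma U_tendsto:
  assumes m: "m \<longlonglongrightarrow> m_lim" and m_pos: "m_lim > 0"
    and q1: "AE \<omega> in M. (\<lambda>n. q1 n \<omega>) \<longlonglongrightarrow> N_lim \<omega>" and N_pos: "AE \<omega> in M. N_lim \<omega> > 0"
    and q2: "AE \<omega> in M. (\<lambda>n. q2 n \<omega>) \<longlonglongrightarrow> Q_lim \<omega>"
    and qA: "(\<lambda>n. \<integral>\<omega>. (real (A n \<omega>))\<^sup>2 \<partial>M) \<longlonglongrightarrow> qA"
    and qB: "(\<lambda>n. \<integral>\<omega>. (real (B n \<omega>))\<^sup>2 \<partial>M) \<longlonglongrightarrow> qB"
    and qAB: "(\<lambda>n. \<integral>\<omega>. real (A n \<omega>) * real (B n \<omega>) \<partial>M) \<longlonglongrightarrow> qAB"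
    and Zl: "AE \<omega> in M. (\<lambda>n. Z n \<omega>) \<longlonglongrightarrow> Zl \<omega>"
  shows "AE \<omega> in M. (\<lambda>n. U n \<omega>) \<longlonglongrightarrow> Zl \<omega> * (1 - Zl \<omega>) *
              ((1 - Zl \<omega>) * qA * ((1 - Zl \<omega>) * N_lim \<omega> + Zl \<omega> * Q_lim \<omega>)
                + Zl \<omega> * qB * (Zl \<omega> * N_lim \<omega> + (1 - Zl \<omega>) * Q_lim \<omega>)
                - 2 * Zl \<omega> * (1 - Zl \<omega>) * qAB * (Q_lim \<omega> - N_lim \<omega>))
              / (m_lim * N_lim \<omega>)\<^sup>2"
  using urn_size_growth[OF m q1] U_approx AE_S_ge q1 N_pos q2 Zl
proof eventually_elim
  case (elim \<omega>)
  note growth = elim(1) and approx = elim(2)[rule_format] and S_ge = elim(3)[rule_format]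
  let ?z = "Zl \<omega>" and ?N = "N_lim \<omega>" and ?Q = "Q_lim \<omega>"
  have S_inv: "(\<lambda>n. 1 / S n \<omega>) \<longlonglongrightarrow> 0"
  proof (rule tendsto_sandwich[of "\<lambda>_. 0" _ _ "\<lambda>n. inverse (real (Suc n))"])
    show "\<forall>\<^sub>F n in sequentially. 0 \<le> 1 / S n \<omega>" by simp
    have "1 / S n \<omega> \<le> inverse (real (Suc n))" for n
      using S_ge[of n] unfolding inverse_eq_divide by (intro divide_left_mono mult_pos_pos; linarith)
    then show "\<forall>\<^sub>F n in sequentially. 1 / S n \<omega> \<le> inverse (real (Suc n))" by simp
  qed (use LIMSEQ_inverse_real_of_nat in auto)
  have rho: "(\<lambda>n. \<rho> n \<omega>) \<longlonglongrightarrow> ?z * ?z"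
  proof -
    \<comment> \<open>Dividing by the urn size expresses \<open>\<rho> n\<close> through quantities
      that converge: drawing with and without replacement agree asymptotically.\<close>
    have "\<rho> n \<omega> = Z n \<omega> * (Z n \<omega> - 1 / S n \<omega>) / (1 - 1 / S n \<omega>)" for n
    proof -
      have s: "S n \<omega> > 1" using urn_counts(1,2)[of n \<omega>] by linarith
      have "\<rho> n \<omega> = H n \<omega> / S n \<omega> * ((H n \<omega> - 1) / (S n \<omega> - 1))"
        by (simp add: \<rho>_def)
      also have "(H n \<omega> - 1) / (S n \<omega> - 1) = ((H n \<omega> - 1) / S n \<omega>) / ((S n \<omega> - 1) / S n \<omega>)"
        using s by simp
      also have "\<dots> = (Z n \<omega> - 1 / S n \<omega>) / (1 - 1 / S n \<omega>)"
        using s by (simp add: urn_Z_def diff_divide_distrib)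
      finally show ?thesis by (simp add: urn_Z_def)
    qed
    moreover have "(\<lambda>n. Z n \<omega> * (Z n \<omega> - 1 / S n \<omega>) / (1 - 1 / S n \<omega>)) \<longlonglongrightarrow> ?z * (?z - 0) / (1 - 0)"
      by (intro tendsto_divide tendsto_mult tendsto_diff tendsto_const elim(7) S_inv) simp
    ultimately show ?thesis by simp
  qed
  define W where "W = (1 - ?z)\<^sup>2 * (qA * (?z * ?N + ?z * ?z * (?Q - ?N)))
    + ?z\<^sup>2 * (qB * (?Q - 2 * (?z * ?Q) + (?z * ?N + ?z * ?z * (?Q - ?N))))
    - (2 * ?z * (1 - ?z)) * (qAB * (?z * ?Q - (?z * ?N + ?z * ?z * (?Q - ?N))))"
  have num_var: "(\<lambda>n. num_var n \<omega>) \<longlonglongrightarrow> W"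
    unfolding num_var_def W_def
    by (intro tendsto_add tendsto_diff tendsto_mult tendsto_power tendsto_const
        LIMSEQ_Suc[OF qA] LIMSEQ_Suc[OF qB] LIMSEQ_Suc[OF qAB] elim rho)
  have scale: "(\<lambda>n. real (Suc n) * real (Suc (Suc n)) / (S n \<omega>)\<^sup>2) \<longlonglongrightarrow> 1 / (m_lim * ?N)\<^sup>2"
  proof -
    \<comment> \<open>Both parts are scaled by n^2 so that the growth of the urn can be inserted;
      the identity with the unscaled quotient holds from n = 1 on, which is enough for the
      limit.\<close>
    have "(\<lambda>n. (real (Suc n) * real (Suc (Suc n)) / (real n)\<^sup>2) / (S n \<omega> / real n)\<^sup>2) \<longlonglongrightarrow> 1 / (m_lim * ?N)\<^sup>2"
    proof (intro tendsto_divide tendsto_power growth)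
      show "(\<lambda>n. real (Suc n) * real (Suc (Suc n)) / (real n)\<^sup>2) \<longlonglongrightarrow> 1" by real_asymp
      show "(m_lim * ?N)\<^sup>2 \<noteq> 0" using m_pos elim(5) by simp
    qed
    moreover have "\<forall>\<^sub>F n in sequentially. (real (Suc n) * real (Suc (Suc n)) / (real n)\<^sup>2) / (S n \<omega> / real n)\<^sup>2
        = real (Suc n) * real (Suc (Suc n)) / (S n \<omega>)\<^sup>2"
      by (rule eventually_sequentiallyI[of 1]) (simp add: power_divide)
    ultimately show ?thesis by (rule Lim_transform_eventually)
  qed
  have "(\<lambda>n. U n \<omega> - real (Suc n) * real (Suc (Suc n)) / (S n \<omega>)\<^sup>2 * num_var n \<omega>) \<longlonglongrightarrow> 0"
  proof (rule Lim_null_comparison)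
    show "\<forall>\<^sub>F n in sequentially. norm (U n \<omega> - real (Suc n) * real (Suc (Suc n)) / (S n \<omega>)\<^sup>2 * num_var n \<omega>)
        \<le> 2 * K ^ 3 / real (Suc (Suc n))"
      by (rule always_eventually) (use approx in \<open>simp only: real_norm_def simp_thms\<close>)
    show "(\<lambda>n. 2 * K ^ 3 / real (Suc (Suc n))) \<longlonglongrightarrow> 0" by real_asymp
  qed
  from tendsto_add[OF this tendsto_mult[OF scale num_var]]
  have "(\<lambda>n. U n \<omega>) \<longlonglongrightarrow> W / (m_lim * ?N)\<^sup>2" by simp
  \<comment> \<open>Each of the three draw moments in \<open>W\<close> contains the factor z(1-z)
    once combined with its weight; for instance zN + z^2(Q-N) = z((1-z)N + zQ).\<close>
  moreover have "W = ?z * (1 - ?z) *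
              ((1 - ?z) * qA * ((1 - ?z) * ?N + ?z * ?Q)
                + ?z * qB * (?z * ?N + (1 - ?z) * ?Q)
                - 2 * ?z * (1 - ?z) * qAB * (?Q - ?N))"
    unfolding W_def by algebra
  ultimately show ?case by simp
qed

lemma urn_as_cond_converges:
  assumes V [measurable]: "V \<in> borel_measurable M" and UV: "AE \<omega> in M. (\<lambda>n. U n \<omega>) \<longlonglongrightarrow> V \<omega>"
    and Zl [measurable]: "Zl \<in> borel_measurable M" and lim: "AE \<omega> in M. (\<lambda>n. Z n \<omega>) \<longlonglongrightarrow> Zl \<omega>"
  shows "as_cond_converges M past (\<lambda>n \<omega>. sqrt (real n) * (Z n \<omega> - Zl \<omega>)) (\<lambda>\<omega>. centered_normal (V \<omega>))"
proof (rule as_cond_converges_normal[OF past_measurable(3) Z_increment_le Z_drift_le _ _ _ _ V UV Zl lim K_nonneg(2)])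
  show "U k \<in> borel_measurable (past k)" for k
    unfolding U_def by (intro borel_measurable_max borel_measurable_min borel_measurable_const
        borel_measurable_times borel_measurable_cond_exp)
  show "0 \<le> U k \<omega>" for k \<omega> by (simp add: U_def)
  show "U k \<omega> \<le> cz\<^sup>2" for k \<omega> by (simp add: U_def)
  show "AE \<omega> in M. cexp k (\<lambda>\<omega>. (Z (Suc k) \<omega> - Z k \<omega>)\<^sup>2) \<omega> = U k \<omega> / (real (Suc k) * real (Suc (Suc k)))" for k
    using U_eq[of k]
  proof eventually_elim
    case (elim \<omega>)
    have "real (Suc k) * real (Suc (Suc k)) \<noteq> 0" by (simp only: mult_eq_0_iff of_nat_eq_0_iff) simp
    then show ?case unfolding elim by simp
  qed
qed

end

theorem theorem3p9:
  fixes M :: "'w measure"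
    and a b :: nat
    and N X A B :: "nat \<Rightarrow> 'w \<Rightarrow> nat"
    and C :: int
    and m :: "nat \<Rightarrow> real"
    and m_lim qA qB qAB :: real
    and N_lim Q_lim :: "'w \<Rightarrow> real"
  assumes urn: "urn_model M a b N X A B"
    and bounded: "\<And>n. n \<ge> 1 \<Longrightarrow>
      AE \<omega> in M. int (max (A n \<omega>) (max (B n \<omega>) (N n \<omega>))) \<le> C"
    and mean_A: "\<And>n. n \<ge> 1 \<Longrightarrow> (\<integral>\<omega>. real (A n \<omega>) \<partial>M) = m n"
    and mean_B: "\<And>n. n \<ge> 1 \<Longrightarrow> (\<integral>\<omega>. real (B n \<omega>) \<partial>M) = m n"
    and m_tendsto: "m \<longlonglongrightarrow> m_lim" and m_pos: "m_lim > 0"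
    and N_rv: "N_lim \<in> borel_measurable M" and N_pos: "AE \<omega> in M. N_lim \<omega> > 0"
    and Q_rv: "Q_lim \<in> borel_measurable M" and Q_pos: "AE \<omega> in M. Q_lim \<omega> > 0"
    and N_tendsto: "AE \<omega> in M.
      (\<lambda>n. real_cond_exp M (urn_filtration M N X A B (n - 1)) (\<lambda>\<omega>'. real (N n \<omega>')) \<omega>)
        \<longlonglongrightarrow> N_lim \<omega>"
    and Q_tendsto: "AE \<omega> in M.
      (\<lambda>n. real_cond_exp M (urn_filtration M N X A B (n - 1)) (\<lambda>\<omega>'. (real (N n \<omega>'))\<^sup>2) \<omega>)
        \<longlonglongrightarrow> Q_lim \<omega>"
    and qA_tendsto: "(\<lambda>n. \<integral>\<omega>. (real (A n \<omega>))\<^sup>2 \<partial>M) \<longlonglongrightarrow> qA" and qA_pos: "qA > 0"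
    and qB_tendsto: "(\<lambda>n. \<integral>\<omega>. (real (B n \<omega>))\<^sup>2 \<partial>M) \<longlonglongrightarrow> qB" and qB_pos: "qB > 0"
    and qAB_tendsto: "(\<lambda>n. \<integral>\<omega>. real (A n \<omega>) * real (B n \<omega>) \<partial>M) \<longlonglongrightarrow> qAB"
    and qAB_pos: "qAB > 0"
  shows "(\<exists>Z \<in> borel_measurable M. AE \<omega> in M. (\<lambda>n. urn_Z a b N X A B n \<omega>) \<longlonglongrightarrow> Z \<omega>) \<and>
    (\<forall>Z \<in> borel_measurable M. (AE \<omega> in M. (\<lambda>n. urn_Z a b N X A B n \<omega>) \<longlonglongrightarrow> Z \<omega>) \<longrightarrow>
      (let V = (\<lambda>\<omega>. Z \<omega> * (1 - Z \<omega>) *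
              ((1 - Z \<omega>) * qA * ((1 - Z \<omega>) * N_lim \<omega> + Z \<omega> * Q_lim \<omega>)
                + Z \<omega> * qB * (Z \<omega> * N_lim \<omega> + (1 - Z \<omega>) * Q_lim \<omega>)
                - 2 * Z \<omega> * (1 - Z \<omega>) * qAB * (Q_lim \<omega> - N_lim \<omega>))
              / (m_lim * N_lim \<omega>)\<^sup>2)
       in (AE \<omega> in M. V \<omega> \<ge> 0) \<and>
          (\<forall>\<omega>\<in>space M. V \<omega> = Z \<omega> * (1 - Z \<omega>) *
              (N_lim \<omega> * ((1 - Z \<omega>)\<^sup>2 * qA + (Z \<omega>)\<^sup>2 * qB + 2 * Z \<omega> * (1 - Z \<omega>) * qAB)
                + Z \<omega> * (1 - Z \<omega>) * Q_lim \<omega> * (qA + qB - 2 * qAB))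
              / (m_lim * N_lim \<omega>)\<^sup>2) \<and>
          as_cond_converges M (urn_filtration M N X A B)
            (\<lambda>n \<omega>. sqrt (real n) * (urn_Z a b N X A B n \<omega> - Z \<omega>))
            (\<lambda>\<omega>. centered_normal (V \<omega>))))"
proof -
  interpret urn_model M a b N X A B by (rule urn)
  interpret bounded_urn M a b N X A B "nat C" m
  proof unfold_locales
    show "AE \<omega> in M. A n \<omega> \<le> nat C \<and> B n \<omega> \<le> nat C \<and> N n \<omega> \<le> nat C" if "n \<ge> 1" for n
      using bounded[OF that] by eventually_elim auto
  qed (use mean_A mean_B in auto)
  have filtration: "urn_filtration M N X A B = past"
    by (rule ext) (simp add: urn_filtration_def)
  have q1: "AE \<omega> in M. (\<lambda>n. q1 n \<omega>) \<longlonglongrightarrow> N_lim \<omega>"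
    using N_tendsto
  proof eventually_elim
    case (elim \<omega>)
    \<comment> \<open>The hypothesis conditions the n-th sample size on F_{n-1}, while
      \<open>q1 n\<close> conditions the (n+1)-st on F_n. The shift also drops the meaningless term
      at index 0.\<close>
    from LIMSEQ_Suc[OF elim] show ?case by (simp add: filtration)
  qed
  have q2: "AE \<omega> in M. (\<lambda>n. q2 n \<omega>) \<longlonglongrightarrow> Q_lim \<omega>"
    using Q_tendsto
  proof eventually_elim
    case (elim \<omega>)
    from LIMSEQ_Suc[OF elim] show ?case by (simp add: filtration)
  qed
  have "\<exists>Z \<in> borel_measurable M. AE \<omega> in M. (\<lambda>n. urn_Z a b N X A B n \<omega>) \<longlonglongrightarrow> Z \<omega>"
  proof
    show "AE \<omega> in M. (\<lambda>n. urn_Z a b N X A B n \<omega>) \<longlonglongrightarrow> lim (\<lambda>n. urn_Z a b N X A B n \<omega>)"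
      using Z_convergent by eventually_elim (simp add: convergent_LIMSEQ_iff)
    show "(\<lambda>\<omega>. lim (\<lambda>n. urn_Z a b N X A B n \<omega>)) \<in> borel_measurable M"
      by measurable
  qed
  moreover
  {
    fix Z assume Z [measurable]: "Z \<in> borel_measurable M"
      and lim: "AE \<omega> in M. (\<lambda>n. urn_Z a b N X A B n \<omega>) \<longlonglongrightarrow> Z \<omega>"
    define V where "V = (\<lambda>\<omega>. Z \<omega> * (1 - Z \<omega>) *
              ((1 - Z \<omega>) * qA * ((1 - Z \<omega>) * N_lim \<omega> + Z \<omega> * Q_lim \<omega>)
                + Z \<omega> * qB * (Z \<omega> * N_lim \<omega> + (1 - Z \<omega>) * Q_lim \<omega>)
                - 2 * Z \<omega> * (1 - Z \<omega>) * qAB * (Q_lim \<omega> - N_lim \<omega>))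
              / (m_lim * N_lim \<omega>)\<^sup>2)"
    have V_meas: "V \<in> borel_measurable M"
      unfolding V_def using N_rv Q_rv by measurable
    have UV: "AE \<omega> in M. (\<lambda>n. U n \<omega>) \<longlonglongrightarrow> V \<omega>"
      unfolding V_def
      by (rule U_tendsto[OF m_tendsto m_pos q1 N_pos q2 qA_tendsto qB_tendsto qAB_tendsto lim])
    have "AE \<omega> in M. V \<omega> \<ge> 0"
      using UV
    proof eventually_elim
      case (elim \<omega>)
      \<comment> \<open>Nonnegativity is inherited from the truncated conditional variances, which
        avoids any algebra relating the limiting moments.\<close>
      show ?case by (rule LIMSEQ_le_const[OF elim]) (simp add: U_def)
    qed
    moreover have "V \<omega> = Z \<omega> * (1 - Z \<omega>) *
              (N_lim \<omega> * ((1 - Z \<omega>)\<^sup>2 * qA + (Z \<omega>)\<^sup>2 * qB + 2 * Z \<omega> * (1 - Z \<omega>) * qAB)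
                + Z \<omega> * (1 - Z \<omega>) * Q_lim \<omega> * (qA + qB - 2 * qAB))
              / (m_lim * N_lim \<omega>)\<^sup>2" for \<omega>
      \<comment> \<open>The common denominator and the factor Z(1-Z) are stripped, leaving a
        polynomial identity between the brackets.\<close>
      unfolding V_def by (intro arg_cong2[of _ _ _ _ "(/)"] arg_cong2[of _ _ _ _ "(*)"] refl) algebra
    moreover have "as_cond_converges M (urn_filtration M N X A B)
            (\<lambda>n \<omega>. sqrt (real n) * (urn_Z a b N X A B n \<omega> - Z \<omega>))
            (\<lambda>\<omega>. centered_normal (V \<omega>))"
      unfolding filtration by (rule urn_as_cond_converges[OF V_meas UV Z lim])
    ultimately have "(AE \<omega> in M. V \<omega> \<ge> 0) \<and>
          (\<forall>\<omega>\<in>space M. V \<omega> = Z \<omega> * (1 - Z \<omega>) *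
              (N_lim \<omega> * ((1 - Z \<omega>)\<^sup>2 * qA + (Z \<omega>)\<^sup>2 * qB + 2 * Z \<omega> * (1 - Z \<omega>) * qAB)
                + Z \<omega> * (1 - Z \<omega>) * Q_lim \<omega> * (qA + qB - 2 * qAB))
              / (m_lim * N_lim \<omega>)\<^sup>2) \<and>
          as_cond_converges M (urn_filtration M N X A B)
            (\<lambda>n \<omega>. sqrt (real n) * (urn_Z a b N X A B n \<omega> - Z \<omega>))
            (\<lambda>\<omega>. centered_normal (V \<omega>))"
      by blast
    note this[unfolded V_def]
  }
  ultimately show ?thesis
    unfolding Let_def by blast
qed

end
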